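(* Let $k\ge3$, let $\mathbf{y}\in\mathbb{R}^k$, and let $(f_n)_{n=1}^\infty$ be an admissible function system (as defined in the context) whose parameter $\tau$ is sufficiently small. Let $\mu$ be a probability measure on $[0,1]^k$ such that $\hat\mu(\boldsymbol{\xi})\ll(1+|\boldsymbol{\xi}|)^{-2}$. Then VTP holds for $(f_n)_n$ and $\mu$: there is a sequence of $N\to\infty$ along which \[ V_N(\mu)=V_N(\lambda)+o(E_N(\mu)^2)+O(1). \]
   Context: $\|x\|$ is the distance from $x\in\mathbb{R}$ to the nearest integer; $\lambda$ is Lebesgue measure on $[0,1]^k$; $\hat\mu(\boldsymbol\xi)=\int e^{-2\pi i\langle\boldsymbol\xi,\mathbf{x}\rangle}d\mu(\mathbf{x})$. For a measure $\nu$ and a function $f$, $\nu(f)=\int_{[0,1]^k}f\,d\nu$; $E_N(\nu)=\sum_{n\le N}\nu(f_n)$ and $V_N(\nu)=\int\bigl(\sum_{n\le N}(f_n(\mathbf{x})-\lambda(f_n))\bigr)^2d\nu(\mathbf{x})$. Admissible systems: fix $\tau\in(0,1/k)$ and $\mathbf{y}\in\mathbb{R}^k$. For $m\in\mathbb{N}$ let $D_m=[2^{m-1},2^m)$. For each $m$ choose a finite index set $I_m$ and, for $i\in I_m$, $1\le j\le k$, numbers $d_{i,j}=d_{i,j,m}>0$ with $d_{i,j}\le 1/(2n)$ and $n^{-(1+1/k+\tau)}\ll d_{i,j}\ll n^{-(1+1/k-\tau)}$ for all $n\in D_m$, such that $\prod_{j\le k}d_{i,j}$ does not depend on $i$. To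 each $(i,j)$ associate an interval $\mathcal{U}_{i,j}$ equal either to $[0,nd_{i,j})$ ("first type") or to $[nd_{i,j}/2,nd_{i,j})$ ("second type"). For $n\in D_m$ set $A_n(\mathbf{d}^{(i)})=\{\mathbf{x}\in[0,1]^k:\|nx_j-y_j\|\in\mathcal{U}_{i,j}\ \forall j\}$ and $A_n=\bigcup_{i\in I_m}A_n(\mathbf{d}^{(i)})$, required to be a disjoint union and to have Property $\mathcal{P}_n(\mathbf{y})$: modulo $\mathbb{Z}^k$, $A_n=\mathcal{Z}+n^{-1}(\mathbf{y}+\mathbb{Z}^k)$ for some strongly star-shaped $\mathcal{Z}\subseteq[-1/2,1/2]^k$ (i.e. $\mathbf{x}\in\mathcal{Z}$ and $|z_j|\le|x_j|$ for all $j$ imply $\mathbf{z}\in\mathcal{Z}$). $(A_n)$ is an admissible set system. Let $\omega_1,\omega_2:\mathbb{R}\to[0,1]$ be non-zero smooth bump functions with $\omega_1$ supported on $\{|x|<1\}$ and $\omega_2$ on $\{1/2\le|x|<1\}$; let $b_{i,j}=\omega_1$ if $\mathcal{U}_{i,j}$ is of the first type and $b_{i,j}=\omega_2$ otherwise. The associated admissible function system is $f_n(\mathbf{x})=\sum_{i\in I_m}\sum_{\mathbf{a}\in\mathbb{Z}^k}\prod_{j\le k}b_{i,j}\bigl((x_j-(a_j+y_j)/n)/d_{i,j}\bigr)$ for $n\in D_m$. *)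

theory Defs
  imports "HOL-Probability.Probability" "HOL-Library.Landau_Symbols"
begin

definition unit_cube :: "(real ^ 'k) set" where
  "unit_cube = {x. \<forall>j. 0 \<le> x $ j \<and> x $ j \<le> 1}"

definition lebesgue_cube :: "(real ^ 'k) measure" where
  "lebesgue_cube = restrict_space lborel unit_cube"

definition prob_measure_on_cube :: "(real ^ 'k) measure \<Rightarrow> bool" where
  "prob_measure_on_cube \<mu> \<longleftrightarrow>
     prob_space \<mu> \<and> sets \<mu> = sets (restrict_space borel unit_cube)"

definition fourier_transform :: "(real ^ 'k) measure \<Rightarrow> real ^ 'k \<Rightarrow> complex" where
  "fourier_transform \<mu> \<xi> =
     (LINT x|\<mu>. exp (- (2 * complex_of_real pi * \<i> * complex_of_real (\<xi> \<bullet> x))))"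

definition dist_nearest_int :: "real \<Rightarrow> real" where
  "dist_nearest_int x = infdist x \<int>"

definition integer_points :: "(real ^ 'k) set" where
  "integer_points = {a. \<forall>j. a $ j \<in> \<int>}"

definition strongly_star_shaped :: "(real ^ 'k) set \<Rightarrow> bool" where
  "strongly_star_shaped Z \<longleftrightarrow>
     (\<forall>x\<in>Z. \<forall>z. (\<forall>j. \<bar>z $ j\<bar> \<le> \<bar>x $ j\<bar>) \<longrightarrow> z \<in> Z)"

text \<open>Equality modulo the integer lattice is stated for the lattice-periodic subsets of the
  whole space; the right-hand side is already periodic.\<close>

definition property_P :: "nat \<Rightarrow> real ^ 'k \<Rightarrow> (real ^ 'k) set \<Rightarrow> bool" where
  "property_P n y A \<longleftrightarrow>
     (\<exists>Z. strongly_star_shaped Z \<and> Z \<subseteq> {z. \<forall>j. \<bar>z $ j\<bar> \<le> 1 / 2} \<and>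
        {x + a | x a. x \<in> A \<and> a \<in> integer_points} =
        {z + (1 / real n) *\<^sub>R (y + a) | z a. z \<in> Z \<and> a \<in> integer_points})"

definition dyadic_block :: "nat \<Rightarrow> nat set" where
  "dyadic_block m = {2 ^ (m - 1)..<2 ^ m}"

datatype interval_type = First_Type | Second_Type

fun type_interval :: "interval_type \<Rightarrow> real \<Rightarrow> real set" where
  "type_interval First_Type r = {0..<r}"
| "type_interval Second_Type r = {r / 2..<r}"

definition A_piece ::
  "nat \<Rightarrow> real ^ 'k \<Rightarrow> ('k \<Rightarrow> interval_type) \<Rightarrow> real ^ 'k \<Rightarrow> (real ^ 'k) set" where
  "A_piece n y t d =
     {x \<in> unit_cube. \<forall>j. dist_nearest_int (real n * x $ j - y $ j)
                             \<in> type_interval (t j) (real n * d $ j)}"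

text \<open>Here \<open>I m\<close> is the index set for block \<open>m \<ge> 1\<close>, and \<open>d m i $ j\<close> and \<open>t m i j\<close> are the
  number and the interval type attached to \<open>(i, j)\<close> in that block.  The constants \<open>c\<close> and \<open>C\<close>
  are uniform in all of \<open>m\<close>, \<open>i\<close>, \<open>j\<close>, \<open>n\<close>.\<close>

definition admissible_set_system ::
  "real \<Rightarrow> real ^ 'k \<Rightarrow> (nat \<Rightarrow> nat set) \<Rightarrow> (nat \<Rightarrow> nat \<Rightarrow> real ^ 'k) \<Rightarrow>
     (nat \<Rightarrow> nat \<Rightarrow> 'k \<Rightarrow> interval_type) \<Rightarrow> bool" where
  "admissible_set_system \<tau> y I d t \<longleftrightarrow>
     0 < \<tau> \<and> \<tau> < 1 / real CARD('k) \<and>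
     (\<forall>m\<ge>1. finite (I m)) \<and>
     (\<forall>m\<ge>1. \<forall>i\<in>I m. \<forall>j. 0 < d m i $ j) \<and>
     (\<forall>m\<ge>1. \<forall>i\<in>I m. \<forall>j. \<forall>n\<in>dyadic_block m. d m i $ j \<le> 1 / (2 * real n)) \<and>
     (\<exists>c>0. \<exists>C>0. \<forall>m\<ge>1. \<forall>i\<in>I m. \<forall>j. \<forall>n\<in>dyadic_block m.
        c * real n powr (- (1 + 1 / real CARD('k) + \<tau>)) \<le> d m i $ j \<and>
        d m i $ j \<le> C * real n powr (- (1 + 1 / real CARD('k) - \<tau>))) \<and>
     (\<forall>m\<ge>1. \<forall>i\<in>I m. \<forall>i'\<in>I m. (\<Prod>j\<in>UNIV. d m i $ j) = (\<Prod>j\<in>UNIV. d m i' $ j)) \<and>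
     (\<forall>m\<ge>1. \<forall>n\<in>dyadic_block m.
        disjoint_family_on (\<lambda>i. A_piece n y (t m i) (d m i)) (I m) \<and>
        property_P n y (\<Union>i\<in>I m. A_piece n y (t m i) (d m i)))"

definition smooth_real :: "(real \<Rightarrow> real) \<Rightarrow> bool" where
  "smooth_real w \<longleftrightarrow> (\<forall>p x. (deriv ^^ p) w field_differentiable at x)"

text \<open>``Supported on \<open>S\<close>'' means vanishing outside \<open>S\<close>; the closed support need not be
  contained in \<open>S\<close>.\<close>

definition bump_function_on :: "real set \<Rightarrow> (real \<Rightarrow> real) \<Rightarrow> bool" where
  "bump_function_on S w \<longleftrightarrow>
     smooth_real w \<and> (\<forall>x. 0 \<le> w x \<and> w x \<le> 1) \<and> (\<exists>x. w x \<noteq> 0) \<and> (\<forall>x. x \<notin> S \<longrightarrow> w x = 0)"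

fun type_bump ::
  "(real \<Rightarrow> real) \<Rightarrow> (real \<Rightarrow> real) \<Rightarrow> interval_type \<Rightarrow> real \<Rightarrow> real" where
  "type_bump w1 w2 First_Type = w1"
| "type_bump w1 w2 Second_Type = w2"

text \<open>For each \<open>x\<close> only finitely many \<open>a\<close> contribute to the lattice sum below.\<close>

definition block_function ::
  "real ^ 'k \<Rightarrow> nat set \<Rightarrow> (nat \<Rightarrow> real ^ 'k) \<Rightarrow> (nat \<Rightarrow> 'k \<Rightarrow> interval_type) \<Rightarrow>
     (real \<Rightarrow> real) \<Rightarrow> (real \<Rightarrow> real) \<Rightarrow> nat \<Rightarrow> real ^ 'k \<Rightarrow> real" where
  "block_function y J d t w1 w2 n x =
     (\<Sum>i\<in>J. infsum (\<lambda>a. \<Prod>j\<in>UNIV. type_bump w1 w2 (t i j)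
         ((x $ j - (a $ j + y $ j) / real n) / d i $ j)) integer_points)"

definition admissible_function_system ::
  "real \<Rightarrow> real ^ 'k \<Rightarrow> (nat \<Rightarrow> real ^ 'k \<Rightarrow> real) \<Rightarrow> bool" where
  "admissible_function_system \<tau> y f \<longleftrightarrow>
     (\<exists>I d t w1 w2.
        admissible_set_system \<tau> y I d t \<and>
        bump_function_on {x. \<bar>x\<bar> < 1} w1 \<and>
        bump_function_on {x. 1 / 2 \<le> \<bar>x\<bar> \<and> \<bar>x\<bar> < 1} w2 \<and>
        (\<forall>m\<ge>1. \<forall>n\<in>dyadic_block m. f n = block_function y (I m) (d m) (t m) w1 w2 n))"

definition E_sum ::
  "(nat \<Rightarrow> real ^ 'k \<Rightarrow> real) \<Rightarrow> nat \<Rightarrow> (real ^ 'k) measure \<Rightarrow> real" where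
  "E_sum f N \<nu> = (\<Sum>n=1..N. LINT x|\<nu>. f n x)"

definition V_sum ::
  "(nat \<Rightarrow> real ^ 'k \<Rightarrow> real) \<Rightarrow> nat \<Rightarrow> (real ^ 'k) measure \<Rightarrow> real" where
  "V_sum f N \<nu> =
     (LINT x|\<nu>. (\<Sum>n=1..N. f n x - (LINT z|lebesgue_cube. f n z))\<^sup>2)"

definition VTP :: "(nat \<Rightarrow> real ^ 'k \<Rightarrow> real) \<Rightarrow> (real ^ 'k) measure \<Rightarrow> bool" where
  "VTP f \<mu> \<longleftrightarrow>
     (\<exists>N. filterlim N at_top sequentially \<and>
        (\<exists>r s. r \<in> o(\<lambda>l. (E_sum f (N l) \<mu>)\<^sup>2) \<and> s \<in> O(\<lambda>_. 1) \<and>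
           (\<forall>l. V_sum f (N l) \<mu> = V_sum f (N l) lebesgue_cube + r l + s l)))"

end

(* Write f n as a Fourier series with frequencies n * xi, xi in Z^k.  Its coefficients are
   dominated by phi * prod_j 1 / (1 + (xi_j / X)^2) with X of order n^(1/k + tau), where phi is
   comparable to lambda(f n).  Expanding the square, V_N(mu) - V_N(lambda) is bounded by the sum of
   these weights times |n xi + m zeta|^(-2) over all nonzero vectors n xi + m zeta.

   Let m <= 2 n and M be the size of m.  For fixed n, m, zeta the best xi turns n xi + m zeta into
   the vector r of centred residues of m zeta modulo n, and all other xi contribute little.
   Summing over m costs O(1) per zeta, since m * zeta_j is equidistributed modulo n / gcd; a power
   of M is saved if some r_i is large.  If all r_i are small then r_j zeta_i = r_i zeta_j, so that
   zeta is determined by zeta_j and r, and there are few such zeta.  With e_a the contribution of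
   the block D_a to E_N(lambda), this yields
   |V_N(mu) - V_N(lambda)| << (sum_a e_a rho^a) (sum_a e_a) for some rho < 1 along N = 2^L - 1,
   which is O(1) if sum_a e_a converges and o(E_N(mu)^2) otherwise. *)
theory Submission
  imports Defs
begin

section \<open>Weighted sums over lattice points\<close>

text \<open>The crude count is only borderline. For fixed n the vectors \<zeta> carry total weight
  up to order \<open>M powr (1 + k * \<tau>)\<close>, so O(1) for each of them misses the number M
  of indices m by the factor \<open>M powr (k * \<tau>)\<close>, whereas large blocks become
  negligible only if a negative power of M is gained. The target is
  \<open>M powr (1 - 1 / (8 * k))\<close>, and \<tau> of order 1 / k^2 keeps the excess below the
  gain. The gain has to come from comparing two coordinates of \<zeta>, since the sum over m treats
  each coordinate separately.

  The measure \<mu> may be singular, so the Fourier series must converge at every point of the cube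
  and not merely almost everywhere for Lebesgue measure. Partial sums over boxes factor into
  symmetric one-dimensional sums, for which a Lipschitz condition suffices. The weights are
  summable, so these partial sums are uniformly bounded and limits pass through the
  integrals.\<close>

definition lorentz :: "real \<Rightarrow> int \<Rightarrow> real" where
  "lorentz X q = 1 / (1 + (real_of_int q / X)\<^sup>2)"

lemma lorentz_bounds: "0 < lorentz X q" "lorentz X q \<le> 1"
  by (auto simp: lorentz_def divide_le_eq_1 intro!: divide_pos_pos add_pos_nonneg)

lemma lorentz_minus: "lorentz X (- q) = lorentz X q"
  by (simp add: lorentz_def power2_eq_square)

lemma lorentz_mono:
  assumes "0 < X" "X \<le> Y"
  shows "lorentz X q \<le> lorentz Y q"
proof -
  have "\<bar>real_of_int q / Y\<bar> \<le> \<bar>real_of_int q / X\<bar>"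
    using assms by (simp add: abs_divide frac_le)
  then have "(real_of_int q / Y)\<^sup>2 \<le> (real_of_int q / X)\<^sup>2"
    by (simp only: abs_le_square_iff)
  then show ?thesis
    unfolding lorentz_def by (intro divide_left_mono) (auto intro!: mult_pos_pos add_pos_nonneg)
qed

text \<open>The Lorentzian is the derivative of \<open>X * arctan (t / X)\<close> in t and decreases
  for t >= 0, so its value at the right end of [s - 1, s] is at most the increment. Summation then
  telescopes.\<close>

lemma lorentz_le_arctan_diff:
  assumes X: "0 < X" and s: "1 \<le> s"
  shows "lorentz X s \<le> X * (arctan (of_int s / X) - arctan (of_int (s - 1) / X))"
proof -
  have lt: "of_int (s - 1) / X < of_int s / X"
    using X by (simp add: divide_strict_right_mono)
  obtain z where z: "of_int (s - 1) / X < z" "z < of_int s / X"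
    and eq: "arctan (of_int s / X) - arctan (of_int (s - 1) / X)
      = (of_int s / X - of_int (s - 1) / X) * inverse (1 + z\<^sup>2)"
    using MVT2[OF lt, of arctan "\<lambda>z. inverse (1 + z\<^sup>2)"] DERIV_arctan by blast
  have "0 \<le> of_int (s - 1) / X" using X s by simp
  then have "z\<^sup>2 \<le> (of_int s / X)\<^sup>2"
    using z by (intro power_mono) auto
  then have "lorentz X s \<le> inverse (1 + z\<^sup>2)"
    unfolding lorentz_def
    by (simp add: inverse_eq_divide) (intro divide_left_mono, auto intro!: mult_pos_pos add_pos_nonneg)
  also have "\<dots> = X * ((of_int s / X - of_int (s - 1) / X) * inverse (1 + z\<^sup>2))"
  proof -
    have "X * (of_int s / X - of_int (s - 1) / X) = 1"
      using X by (simp add: field_simps)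
    then show ?thesis by (metis mult.assoc mult_1)
  qed
  finally show ?thesis using eq by simp
qed

lemma sum_lorentz_pos:
  assumes X: "0 < X"
  shows "(\<Sum>s\<in>{1..int K}. lorentz X s) \<le> 2 * X"
proof -
  have "(\<Sum>s\<in>{1..int K}. lorentz X s) \<le> X * arctan (real K / X)"
  proof (induction K)
    case (Suc K)
    have "{1..int (Suc K)} = insert (int (Suc K)) {1..int K}" by auto
    then show ?case
      using Suc lorentz_le_arctan_diff[OF X, of "int (Suc K)"]
      by (simp add: algebra_simps)
  qed simp
  also have "\<dots> \<le> X * 2"
    using X arctan_ubound[of "real K / X"] pi_less_4 by (intro mult_left_mono) auto
  finally show ?thesis by simp
qed

text \<open>Leaving out 0 makes the bound proportional to X for every X > 0. The residue sums use it
  at the scale \<open>T / h\<close>, which may be far below 1.\<close>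

lemma sum_lorentz:
  assumes X: "0 < X" and A: "finite A" "0 \<notin> A"
  shows "(\<Sum>s\<in>A. lorentz X s) \<le> 4 * X"
proof -
  define K where "K = nat (Max (insert 0 (abs ` A)))"
  have K: "\<bar>s\<bar> \<le> int K" if "s \<in> A" for s
    using that A unfolding K_def by (auto simp: le_max_iff_disj)
  have sub: "A \<subseteq> {1..int K} \<union> uminus ` {1..int K}"
  proof
    fix s assume s: "s \<in> A"
    then have "s \<noteq> 0" using A by metis
    then have "s \<in> {1..int K} \<or> - s \<in> {1..int K}" using K[OF s] by auto
    then show "s \<in> {1..int K} \<union> uminus ` {1..int K}"
      by (metis UnI1 UnI2 add.inverse_inverse imageI)
  qed
  have "(\<Sum>s\<in>A. lorentz X s) \<le> (\<Sum>s\<in>{1..int K} \<union> uminus ` {1..int K}. lorentz X s)"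
    using sub by (intro sum_mono2) (auto intro: less_imp_le[OF lorentz_bounds(1)])
  also have "\<dots> \<le> (\<Sum>s\<in>{1..int K}. lorentz X s) + (\<Sum>s\<in>uminus ` {1..int K}. lorentz X s)"
    by (subst sum.union_disjoint) auto
  also have "(\<Sum>s\<in>uminus ` {1..int K}. lorentz X s) = (\<Sum>s\<in>{1..int K}. lorentz X s)"
    by (subst sum.reindex) (auto simp: lorentz_minus inj_on_def)
  finally show ?thesis using sum_lorentz_pos[OF X, of K] by linarith
qed

lemma sum_lorentz_full:
  assumes X: "1 \<le> X" and A: "finite A"
  shows "(\<Sum>s\<in>A. lorentz X s) \<le> 5 * X"
proof -
  have "(\<Sum>s\<in>A. lorentz X s) \<le> (\<Sum>s\<in>insert 0 (A - {0}). lorentz X s)"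
    using A by (intro sum_mono2) (auto intro: less_imp_le[OF lorentz_bounds(1)])
  also have "\<dots> = lorentz X 0 + (\<Sum>s\<in>A - {0}. lorentz X s)"
    using A by (subst sum.insert) auto
  also have "\<dots> \<le> 1 + 4 * X"
    using sum_lorentz[of X "A - {0}"] A X lorentz_bounds(2)[of X 0] by force
  finally show ?thesis using X by simp
qed

lemma inverse_square_le_lorentz:
  assumes "q \<noteq> 0" shows "1 / (real_of_int q)\<^sup>2 \<le> 2 * lorentz 1 q"
proof -
  have "\<bar>real_of_int q\<bar> \<ge> 1" using assms by linarith
  then have "1 \<le> (real_of_int q)\<^sup>2" by (metis one_le_power power2_abs)
  then show ?thesis by (simp add: lorentz_def divide_le_eq le_divide_eq)
qed

lemma sum_inverse_square:
  assumes "finite A"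
  shows "(\<Sum>q\<in>A. if q = - t then 0 else 1 / (real_of_int (q + t))\<^sup>2) \<le> 8"
proof -
  have "(\<Sum>q\<in>A. if q = - t then 0 else 1 / (real_of_int (q + t))\<^sup>2)
      = (\<Sum>q\<in>A - {- t}. 1 / (real_of_int (q + t))\<^sup>2)"
    using assms by (intro sum.mono_neutral_cong_right) auto
  also have "\<dots> \<le> (\<Sum>q\<in>A - {- t}. 2 * lorentz 1 (q + t))"
    by (intro sum_mono inverse_square_le_lorentz) auto
  also have "\<dots> = 2 * (\<Sum>s\<in>(\<lambda>q. q + t) ` (A - {- t}). lorentz 1 s)"
    by (subst sum.reindex) (auto simp: inj_on_def sum_distrib_left)
  also have "\<dots> \<le> 2 * (4 * 1)"
    using assms by (intro mult_left_mono sum_lorentz) auto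
  finally show ?thesis by simp
qed

text \<open>Beyond Y the value is at most \<open>(Z / q)^2\<close>, hence at most
  \<open>2 * (Z / Y)^2\<close> times the Lorentzian of scale Y, whose sum is already known.\<close>

lemma sum_lorentz_tail:
  assumes Z: "0 < Z" and ZY: "Z \<le> Y" and A: "finite A"
  shows "(\<Sum>q\<in>{q\<in>A. Y < \<bar>real_of_int q\<bar>}. lorentz Z q) \<le> 8 * Z\<^sup>2 / Y"
proof -
  have Y: "0 < Y" using Z ZY by simp
  have le: "lorentz Z q \<le> 2 * (Z / Y)\<^sup>2 * lorentz Y q" if "Y < \<bar>real_of_int q\<bar>" for q
  proof -
    have q: "Y\<^sup>2 \<le> (real_of_int q)\<^sup>2"
      using that Y by (metis abs_le_square_iff abs_of_pos less_imp_le)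
    have q0: "0 < (real_of_int q)\<^sup>2"
      using q zero_less_power[OF Y, of 2] by linarith
    have "lorentz Z q \<le> Z\<^sup>2 / (real_of_int q)\<^sup>2"
    proof -
      have "1 / (1 + (real_of_int q / Z)\<^sup>2) \<le> 1 / ((real_of_int q / Z)\<^sup>2)"
        using q0 Z by (intro divide_left_mono) (auto intro!: mult_pos_pos add_pos_nonneg)
      then show ?thesis by (simp add: lorentz_def power_divide)
    qed
    also have "\<dots> \<le> Z\<^sup>2 * (2 / (Y\<^sup>2 + (real_of_int q)\<^sup>2))"
    proof -
      have "1 / (real_of_int q)\<^sup>2 \<le> 2 / (Y\<^sup>2 + (real_of_int q)\<^sup>2)"
        using q q0 Y by (subst divide_le_eq) (auto simp: le_divide_eq add_pos_pos)
      then show ?thesis using mult_left_mono[of _ _ "Z\<^sup>2"] by fastforce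
    qed
    also have "\<dots> = 2 * (Z / Y)\<^sup>2 * lorentz Y q"
      using Y by (simp add: lorentz_def power_divide divide_simps)
    finally show ?thesis .
  qed
  have "(\<Sum>q\<in>{q\<in>A. Y < \<bar>real_of_int q\<bar>}. lorentz Z q)
      \<le> (\<Sum>q\<in>{q\<in>A. Y < \<bar>real_of_int q\<bar>}. 2 * (Z / Y)\<^sup>2 * lorentz Y q)"
    by (intro sum_mono le) auto
  also have "\<dots> = 2 * (Z / Y)\<^sup>2 * (\<Sum>q\<in>{q\<in>A. Y < \<bar>real_of_int q\<bar>}. lorentz Y q)"
    by (simp add: sum_distrib_left)
  also have "\<dots> \<le> 2 * (Z / Y)\<^sup>2 * (4 * Y)"
    using Y A by (intro mult_left_mono sum_lorentz) auto
  also have "\<dots> = 8 * Z\<^sup>2 / Y"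
    using Y by (simp add: field_simps power2_eq_square)
  finally show ?thesis .
qed

section \<open>Centred residues: representatives modulo n of least absolute value\<close>

definition cres :: "int \<Rightarrow> int \<Rightarrow> int" where
  "cres n z = z - n * round (real_of_int z / real_of_int n)"

lemma cres_bound:
  assumes "0 < n" shows "2 * \<bar>cres n z\<bar> \<le> n"
proof -
  have "\<bar>real_of_int z / real_of_int n - of_int (round (real_of_int z / real_of_int n))\<bar> \<le> 1 / 2"
    by (metis abs_minus_commute of_int_round_abs_le)
  then have "real_of_int n * \<bar>real_of_int z / real_of_int n - of_int (round (real_of_int z / real_of_int n))\<bar>
      \<le> real_of_int n * (1 / 2)"
    using assms by (intro mult_left_mono) auto
  moreover have "real_of_int n * \<bar>real_of_int z / real_of_int n - of_int (round (real_of_int z / real_of_int n))\<bar>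
    = \<bar>real_of_int (cres n z)\<bar>"
  proof -
    have "real_of_int (cres n z) = real_of_int n *
        (real_of_int z / real_of_int n - of_int (round (real_of_int z / real_of_int n)))"
      using assms by (simp add: cres_def right_diff_distrib)
    then show ?thesis using assms by (simp only: abs_mult)
  qed
  ultimately have "2 * \<bar>real_of_int (cres n z)\<bar> \<le> real_of_int n" by linarith
  then show ?thesis by linarith
qed

lemma cres_dvd: "n dvd z - cres n z"
  by (simp add: cres_def)

text \<open>The rounded quotient depends only on the ratio, so a gcd can be divided out.\<close>

lemma cres_mult: "h \<noteq> 0 \<Longrightarrow> cres (h * n) (h * z) = h * cres n z"
  by (simp add: cres_def algebra_simps)

lemma cres_eqD: "cres n z = cres n z' \<Longrightarrow> n dvd z - z'"
  using cres_dvd[of n z] cres_dvd[of n z'] by (metis diff_add_cancel diff_diff_eq2 dvd_diff add_diff_cancel_right)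

text \<open>With \<open>h = gcd q n\<close>, the residues \<open>m * q\<close> run through \<open>h * s\<close> for distinct \<open>s\<close> on each
  of the at most \<open>2 * h\<close> blocks of length \<open>n div h\<close>.\<close>

lemma sum_residues:
  assumes n: "0 < n" and T: "0 < T" and M: "D \<subseteq> {..<2 * n}"
  shows "(\<Sum>m\<in>D. if cres (int n) (int m * q) = 0 then 0
            else 1 / (T\<^sup>2 + (real_of_int (cres (int n) (int m * q)))\<^sup>2)) \<le> 8 / T"
proof -
  define h where "h = nat (gcd q (int n))"
  define g where "g m = (if cres (int n) (int m * q) = 0 then 0
            else 1 / (T\<^sup>2 + (real_of_int (cres (int n) (int m * q)))\<^sup>2))" for m
  have g0: "0 \<le> g m" for m
    unfolding g_def by auto
  have h0: "0 < h" using n by (simp add: h_def)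
  have hn: "int h dvd int n" and hq: "int h dvd q" by (simp_all add: h_def)
  obtain n' where n': "n = h * n'" using hn by (metis dvd_def int_dvd_int_iff)
  obtain q' where q': "q = int h * q'" using hq by blast
  have n'0: "0 < n'" using n n' by simp
  have cop: "coprime q' (int n')"
  proof -
    have "gcd q (int n) = int h"
      by (simp add: h_def)
    then have "gcd (int h * q') (int h * int n') = int h"
      by (simp only: q'[symmetric] n' of_nat_mult)
    then have "int h * gcd q' (int n') = int h"
      by (simp add: gcd_mult_distrib_int[symmetric])
    then have "gcd q' (int n') = 1" using h0 by simp
    then show ?thesis by (simp add: coprime_iff_gcd_eq_1)
  qed
  define s where "s m = cres (int n') (int m * q')" for m
  have cs: "cres (int n) (int m * q) = int h * s m" for m
    unfolding s_def n' q' using h0 cres_mult[of "int h" "int n'" "int m * q'"]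
    by (simp add: algebra_simps)
  have block: "sum g {i * n'..<i * n' + n'} \<le> 4 / (T * h)" for i
  proof -
    define B where "B = {m \<in> {i * n'..<i * n' + n'}. s m \<noteq> 0}"
    have inj: "inj_on s B"
    proof (rule inj_onI)
      fix x y assume xy: "x \<in> B" "y \<in> B" "s x = s y"
      have "int n' dvd int x * q' - int y * q'"
        using xy(3) unfolding s_def by (rule cres_eqD)
      then have "int n' dvd (int x - int y) * q'" by (simp add: algebra_simps)
      then have "int n' dvd int x - int y"
        using cop by (simp add: coprime_commute coprime_dvd_mult_left_iff)
      moreover have "\<bar>int x - int y\<bar> < int n'" using xy(1,2) unfolding B_def by auto
      ultimately have "int x - int y = 0"
        using zdvd_not_zless by (metis abs_ge_zero dvd_abs_iff less_le_not_le zero_less_abs_iff)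
      then show "x = y" by simp
    qed
    have "sum g {i * n'..<i * n' + n'} = sum g B"
      unfolding B_def by (intro sum.mono_neutral_right) (auto simp: g_def cs)
    \<comment> \<open>\<open>T^2 + h^2 * s^2\<close> is \<open>T^2\<close> times the denominator of
      the Lorentzian of scale \<open>T / h\<close>; the scale absorbs the gcd.\<close>
    also have "\<dots> = (\<Sum>m\<in>B. 1 / T\<^sup>2 * lorentz (T / h) (s m))"
      using T h0 by (intro sum.cong) (auto simp: g_def cs[simplified mult.commute[of _ q]] cs B_def lorentz_def divide_simps power_mult_distrib mult.commute)
    also have "\<dots> = 1 / T\<^sup>2 * (\<Sum>r\<in>s ` B. lorentz (T / h) r)"
      using inj by (simp add: sum.reindex sum_distrib_left)
    also have "\<dots> \<le> 1 / T\<^sup>2 * (4 * (T / h))"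
      using T h0 by (intro mult_left_mono sum_lorentz) (auto simp: B_def)
    also have "\<dots> = 4 / (T * h)"
      using T h0 by (simp add: field_simps power2_eq_square)
    finally show ?thesis .
  qed
  have "sum g D \<le> sum g {..<(2 * h) * n'}"
    using M g0 n' by (intro sum_mono2) auto
  also have "\<dots> = (\<Sum>i<2 * h. sum g {i * n'..<i * n' + n'})"
    by (rule sum.nat_group[symmetric])
  \<comment> \<open>The gcd cancels between the number of blocks and the bound for each of them, so
    the result is uniform in q.\<close>
  also have "\<dots> \<le> (\<Sum>i<2 * h. 4 / (T * h))"
    by (intro sum_mono block)
  also have "\<dots> = 8 / T"
    using h0 T by simp
  finally show ?thesis by (simp add: g_def)
qed

section \<open>Product weights and the decay kernel on integer vectors\<close>

definition lattice_box :: "nat \<Rightarrow> ('k::finite \<Rightarrow> int) set" where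
  "lattice_box Q = (UNIV \<rightarrow>\<^sub>E {- int Q..int Q})"

definition lattice_weight :: "real \<Rightarrow> ('k::finite \<Rightarrow> int) \<Rightarrow> real" where
  "lattice_weight X \<xi> = (\<Prod>j\<in>UNIV. lorentz X (\<xi> j))"

text \<open>The value at the zero vector is \<open>1 / 0 = 0\<close>.\<close>

definition inv_sq :: "('k::finite \<Rightarrow> int) \<Rightarrow> real" where
  "inv_sq v = 1 / (real_of_int (MAX j. \<bar>v j\<bar>))\<^sup>2"

lemma finite_lattice_box [simp]: "finite (lattice_box Q)"
  by (simp add: lattice_box_def finite_PiE)

lemma lattice_box_iff: "\<xi> \<in> lattice_box Q \<longleftrightarrow> (\<forall>j. \<bar>\<xi> j\<bar> \<le> int Q)"
  by (simp add: lattice_box_def PiE_iff abs_le_iff minus_le_iff conj_commute)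

lemma sum_lattice_box_prod:
  fixes g :: "'k::finite \<Rightarrow> int \<Rightarrow> 'a::comm_semiring_1"
  shows "(\<Sum>\<xi>\<in>lattice_box Q. \<Prod>j\<in>UNIV. g j (\<xi> j)) = (\<Prod>j\<in>UNIV. \<Sum>q\<in>{- int Q..int Q}. g j q)"
  unfolding lattice_box_def by (rule prod_sum_PiE[symmetric]) auto

lemma lattice_weight_bounds: "0 \<le> lattice_weight X \<xi>" "lattice_weight X \<xi> \<le> 1"
  unfolding lattice_weight_def
  by (auto intro!: prod_nonneg prod_le_1 less_imp_le[OF lorentz_bounds(1)] lorentz_bounds(2))

lemma sum_lattice_weight:
  assumes "1 \<le> X"
  shows "(\<Sum>\<xi>\<in>lattice_box Q. lattice_weight X (\<xi> :: 'k::finite \<Rightarrow> int)) \<le> (5 * X) ^ CARD('k)"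
proof -
  have "(\<Sum>\<xi>\<in>lattice_box Q. lattice_weight X (\<xi> :: 'k \<Rightarrow> int))
      = (\<Prod>j\<in>(UNIV::'k set). \<Sum>q\<in>{- int Q..int Q}. lorentz X q)"
    unfolding lattice_weight_def by (rule sum_lattice_box_prod)
  also have "\<dots> \<le> (\<Prod>j\<in>(UNIV::'k set). 5 * X)"
    using assms by (intro prod_mono conjI sum_nonneg less_imp_le[OF lorentz_bounds(1)] sum_lorentz_full) auto
  finally show ?thesis by simp
qed

text \<open>The factor g changes only the one-dimensional sum over coordinate j. It will be an
  inverse square or the indicator of a tail.\<close>

lemma sum_lattice_weight_coord:
  fixes j :: "'k::finite"
  assumes X: "1 \<le> X" and g: "\<And>q. 0 \<le> g q" "(\<Sum>q\<in>{- int Q..int Q}. lorentz X q * g q) \<le> G"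
  shows "(\<Sum>\<xi>\<in>lattice_box Q. lattice_weight X \<xi> * g (\<xi> j)) \<le> G * (5 * X) ^ (CARD('k) - 1)"
proof -
  define h where "h i q = lorentz X q * (if i = j then g q else 1)" for i q
  have h0: "0 \<le> h i q" for i q
    using g(1) less_imp_le[OF lorentz_bounds(1)] by (simp add: h_def)
  have "lattice_weight X \<xi> * g (\<xi> j) = (\<Prod>i\<in>UNIV. h i (\<xi> i))" for \<xi>
    unfolding h_def lattice_weight_def prod.distrib by simp
  then have "(\<Sum>\<xi>\<in>lattice_box Q. lattice_weight X \<xi> * g (\<xi> j))
      = (\<Prod>i\<in>UNIV. \<Sum>q\<in>{- int Q..int Q}. h i q)"
    using sum_lattice_box_prod[of h Q] by simp
  also have "\<dots> = (\<Sum>q\<in>{- int Q..int Q}. h j q) * (\<Prod>i\<in>UNIV - {j}. \<Sum>q\<in>{- int Q..int Q}. h i q)"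
    by (rule prod.remove) auto
  also have "\<dots> \<le> G * (\<Prod>i\<in>UNIV - {j}. 5 * X)"
  proof (intro mult_mono prod_mono conjI)
    show "(\<Sum>q\<in>{- int Q..int Q}. h j q) \<le> G" using g(2) by (simp add: h_def)
    then show "0 \<le> G" using h0 by (meson order_trans sum_nonneg)
    show "(\<Sum>q\<in>{- int Q..int Q}. h i q) \<le> 5 * X" if "i \<in> UNIV - {j}" for i
      using that X by (simp add: h_def sum_lorentz_full)
  qed (auto intro!: sum_nonneg prod_nonneg h0)
  also have "(\<Prod>i\<in>UNIV - {j}. 5 * X) = (5 * X) ^ (CARD('k) - 1)"
    by (simp add: card_Diff_singleton)
  finally show ?thesis .
qed

lemma inv_sq_nonneg: "0 \<le> inv_sq v"
  by (simp add: inv_sq_def)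

lemma inv_sq_zero: "inv_sq (\<lambda>_. 0) = 0"
  by (simp add: inv_sq_def)

lemma inv_sq_le:
  assumes "0 < t" "t \<le> \<bar>real_of_int (v j)\<bar>"
  shows "inv_sq v \<le> 1 / t\<^sup>2"
proof -
  have "\<bar>v j\<bar> \<le> (MAX j. \<bar>v j\<bar>)" by (intro Max_ge) auto
  then have "t \<le> real_of_int (MAX j. \<bar>v j\<bar>)" using assms by linarith
  then show ?thesis
    unfolding inv_sq_def using assms by (intro divide_left_mono power_mono) auto
qed

lemma inv_sq_le_one: "inv_sq v \<le> 1"
proof (cases "v = (\<lambda>_. 0)")
  case False
  then obtain j where "v j \<noteq> 0" by auto
  then have "1 \<le> \<bar>real_of_int (v j)\<bar>" by linarith
  then show ?thesis using inv_sq_le[of 1 v j] by simp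
qed (simp add: inv_sq_zero)

text \<open>Only the lattice point nearest to \<open>- z / n\<close> can give a vector shorter than \<open>n / 2\<close>.\<close>

lemma shifted_lattice_sum:
  fixes z :: "'k::finite \<Rightarrow> int"
  assumes n: "0 < n" and X: "1 \<le> X"
  shows "(\<Sum>\<xi>\<in>lattice_box Q. lattice_weight X \<xi> * inv_sq (\<lambda>j. n * \<xi> j + z j))
    \<le> inv_sq (\<lambda>j. cres n (z j)) + CARD('k) * (32 / (real_of_int n)\<^sup>2 * (5 * X) ^ (CARD('k) - 1))"
proof -
  define t where "t j = round (real_of_int (z j) / real_of_int n)" for j
  have z: "z j = cres n (z j) + n * t j" for j
    by (simp add: cres_def t_def)
  \<comment> \<open>If coordinate j differs from that of the nearest lattice point, it alone bounds
    the length from below. The nearest point is treated separately, so its entry gets the value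
    0.\<close>
  define u where "u j q = (if q = - t j then 0 else 1 / (real_of_int (q + t j))\<^sup>2)" for j q
  have u0: "0 \<le> u j q" for j q by (simp add: u_def)
  have pt: "lattice_weight X \<xi> * inv_sq (\<lambda>j. n * \<xi> j + z j)
      \<le> (if \<xi> = (\<lambda>j. - t j) then inv_sq (\<lambda>j. cres n (z j)) else 0)
        + 4 / (real_of_int n)\<^sup>2 * (\<Sum>j\<in>UNIV. lattice_weight X \<xi> * u j (\<xi> j))" for \<xi>
  proof (cases "\<xi> = (\<lambda>j. - t j)")
    case True
    have "(\<lambda>j. n * \<xi> j + z j) = (\<lambda>j. cres n (z j))"
      using True z by (auto simp: algebra_simps)
    moreover have "lattice_weight X \<xi> * inv_sq (\<lambda>j. cres n (z j)) \<le> 1 * inv_sq (\<lambda>j. cres n (z j))"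
      by (intro mult_right_mono lattice_weight_bounds inv_sq_nonneg)
    moreover have "0 \<le> 4 / (real_of_int n)\<^sup>2 * (\<Sum>j\<in>UNIV. lattice_weight X \<xi> * u j (\<xi> j))"
      by (intro mult_nonneg_nonneg sum_nonneg u0 lattice_weight_bounds) auto
    ultimately show ?thesis using True by simp
  next
    case False
    then obtain j where j: "\<xi> j \<noteq> - t j" by auto
    define p where "p = \<xi> j + t j"
    have p: "p \<noteq> 0" using j by (simp add: p_def)
    have eq: "n * \<xi> j + z j = n * p + cres n (z j)"
      by (subst z) (simp add: p_def algebra_simps)
    \<comment> \<open>The residue is at most n / 2, hence at most half of
      \<open>n * \<bar>p\<bar>\<close>, since p is nonzero.\<close>
    have "n * \<bar>p\<bar> \<le> 2 * \<bar>n * p + cres n (z j)\<bar>"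
    proof -
      have "n * \<bar>p\<bar> = \<bar>n * p\<bar>" using n by (simp add: abs_mult)
      moreover have "n * 1 \<le> n * \<bar>p\<bar>" using p n by (intro mult_left_mono) auto
      moreover have "2 * \<bar>cres n (z j)\<bar> \<le> n" using n by (rule cres_bound)
      moreover have "\<bar>n * p\<bar> \<le> \<bar>n * p + cres n (z j)\<bar> + \<bar>cres n (z j)\<bar>" by arith
      ultimately show ?thesis by simp
    qed
    then have "real_of_int (n * \<bar>p\<bar>) \<le> real_of_int (2 * \<bar>n * p + cres n (z j)\<bar>)"
      by (simp only: of_int_le_iff)
    then have "real_of_int n * \<bar>real_of_int p\<bar> / 2 \<le> \<bar>real_of_int (n * \<xi> j + z j)\<bar>"
      unfolding eq by simp
    then have "inv_sq (\<lambda>j. n * \<xi> j + z j) \<le> 1 / (real_of_int n * \<bar>real_of_int p\<bar> / 2)\<^sup>2"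
      using n p by (intro inv_sq_le[where j = j]) auto
    also have "\<dots> = 4 / (real_of_int n)\<^sup>2 * u j (\<xi> j)"
      using j by (simp add: u_def p_def power_divide power_mult_distrib)
    finally have "lattice_weight X \<xi> * inv_sq (\<lambda>j. n * \<xi> j + z j)
        \<le> 4 / (real_of_int n)\<^sup>2 * (lattice_weight X \<xi> * u j (\<xi> j))"
      by (subst mult.left_commute) (intro mult_left_mono lattice_weight_bounds)
    also have "\<dots> \<le> 4 / (real_of_int n)\<^sup>2 * (\<Sum>j\<in>UNIV. lattice_weight X \<xi> * u j (\<xi> j))"
      by (intro mult_left_mono member_le_sum mult_nonneg_nonneg u0 lattice_weight_bounds) auto
    finally show ?thesis using False by simp
  qed
  have "(\<Sum>\<xi>\<in>lattice_box Q. lattice_weight X \<xi> * inv_sq (\<lambda>j. n * \<xi> j + z j))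
     \<le> (\<Sum>\<xi>\<in>lattice_box Q. (if \<xi> = (\<lambda>j. - t j) then inv_sq (\<lambda>j. cres n (z j)) else 0)
        + 4 / (real_of_int n)\<^sup>2 * (\<Sum>j\<in>UNIV. lattice_weight X \<xi> * u j (\<xi> j)))"
    by (intro sum_mono pt)
  also have "\<dots> = (\<Sum>\<xi>\<in>lattice_box Q. (if \<xi> = (\<lambda>j. - t j) then inv_sq (\<lambda>j. cres n (z j)) else 0))
        + 4 / (real_of_int n)\<^sup>2 * (\<Sum>j\<in>UNIV. \<Sum>\<xi>\<in>lattice_box Q. lattice_weight X \<xi> * u j (\<xi> j))"
    by (subst sum.swap) (simp add: sum.distrib sum_distrib_left)
  also have "(\<Sum>\<xi>\<in>lattice_box Q. (if \<xi> = (\<lambda>j. - t j) then inv_sq (\<lambda>j. cres n (z j)) else 0))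
      \<le> inv_sq (\<lambda>j. cres n (z j))"
    by (subst sum.delta) (auto simp: inv_sq_nonneg)
  \<comment> \<open>In coordinate j the Lorentzian is dropped, because u already sums to at most 8;
    the other coordinates give \<open>(5 * X) ^ (k - 1)\<close>. With the factor 4 from halving the
    length this makes 32.\<close>
  also have "(\<Sum>j\<in>UNIV. \<Sum>\<xi>\<in>lattice_box Q. lattice_weight X \<xi> * u j (\<xi> j))
      \<le> (\<Sum>j\<in>(UNIV::'k set). 8 * (5 * X) ^ (CARD('k) - 1))"
  proof (intro sum_mono sum_lattice_weight_coord X u0)
    fix j
    have "(\<Sum>q\<in>{- int Q..int Q}. lorentz X q * u j q) \<le> (\<Sum>q\<in>{- int Q..int Q}. u j q)"
      using lorentz_bounds(2) u0 by (intro sum_mono mult_left_le_one_le) (auto intro: less_imp_le[OF lorentz_bounds(1)])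
    also have "\<dots> \<le> 8" unfolding u_def by (rule sum_inverse_square) auto
    finally show "(\<Sum>q\<in>{- int Q..int Q}. lorentz X q * u j q) \<le> 8" .
  qed
  finally show ?thesis
    using n by (simp add: mult_left_mono divide_right_mono mult.assoc algebra_simps)
qed

text \<open>Short residue vectors: from \<open>r j * \<zeta> i \<equiv> r i * \<zeta> j\<close> modulo \<open>n\<close> and the smallness
  of both sides, \<open>\<zeta>\<close> is determined by \<open>\<zeta> j\<close> and \<open>r\<close>.\<close>

lemma card_short_residues:
  fixes j :: "'k::finite"
  assumes n: "0 < n" and T: "0 \<le> T" and Y: "0 \<le> Y" and TY: "2 * T * Y < real_of_int n"
  shows "real (card {\<zeta> \<in> lattice_box Q. \<zeta> j = q \<and> cres n (m * q) \<noteq> 0 \<and>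
            (\<forall>i. \<bar>real_of_int (\<zeta> i)\<bar> \<le> Y) \<and> (\<forall>i. \<bar>real_of_int (cres n (m * \<zeta> i))\<bar> \<le> T)})
       \<le> (2 * T + 1) ^ CARD('k)"
proof -
  define S where "S = {\<zeta> \<in> lattice_box Q. \<zeta> j = q \<and> cres n (m * q) \<noteq> 0 \<and>
            (\<forall>i. \<bar>real_of_int (\<zeta> i)\<bar> \<le> Y) \<and> (\<forall>i. \<bar>real_of_int (cres n (m * \<zeta> i))\<bar> \<le> T)}"
  define R where "R \<zeta> i = cres n (m * \<zeta> i)" for \<zeta> :: "'k \<Rightarrow> int" and i
  have key: "R \<zeta> j * \<zeta> i = R \<zeta> i * q" if "\<zeta> \<in> S" for \<zeta> i
  proof -
    \<comment> \<open>Modulo n each residue is m times its coordinate, and the two products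
      \<open>m * \<zeta> i * \<zeta> j\<close> cancel.\<close>
    have "n dvd (m * \<zeta> i - R \<zeta> i) * \<zeta> j - (m * \<zeta> j - R \<zeta> j) * \<zeta> i"
      unfolding R_def by (intro dvd_diff dvd_mult2 cres_dvd)
    then have d: "n dvd R \<zeta> j * \<zeta> i - R \<zeta> i * \<zeta> j" by (simp add: algebra_simps)
    have "\<bar>real_of_int (R \<zeta> j * \<zeta> i - R \<zeta> i * \<zeta> j)\<bar>
        \<le> \<bar>real_of_int (R \<zeta> j)\<bar> * \<bar>real_of_int (\<zeta> i)\<bar> + \<bar>real_of_int (R \<zeta> i)\<bar> * \<bar>real_of_int (\<zeta> j)\<bar>"
      by (simp add: abs_mult[symmetric] abs_triangle_ineq4)
    also have "\<dots> \<le> T * Y + T * Y"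
      using that T unfolding S_def R_def by (intro add_mono mult_mono) auto
    also have "\<dots> < real_of_int n" using TY by simp
    finally have "\<bar>R \<zeta> j * \<zeta> i - R \<zeta> i * \<zeta> j\<bar> < n" by linarith
    then have "R \<zeta> j * \<zeta> i - R \<zeta> i * \<zeta> j = 0"
      using d by (metis abs_ge_zero dvd_abs_iff less_le_not_le zdvd_not_zless zero_less_abs_iff)
    then show ?thesis using that by (simp add: S_def)
  qed
  have inj: "inj_on R S"
  proof (rule inj_onI)
    fix \<zeta> \<zeta>' assume *: "\<zeta> \<in> S" "\<zeta>' \<in> S" "R \<zeta> = R \<zeta>'"
    \<comment> \<open>Dividing the identity \<open>key\<close> by this nonzero residue recovers
      \<zeta> from its residue vector.\<close>
    have "R \<zeta> j \<noteq> 0" using *(1) by (simp add: S_def R_def)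
    then show "\<zeta> = \<zeta>'" using key[OF *(1)] key[OF *(2)] *(3) by (intro ext) (metis mult_left_cancel)
  qed
  have img: "R ` S \<subseteq> lattice_box (nat \<lfloor>T\<rfloor>)"
  proof safe
    fix \<zeta> assume "\<zeta> \<in> S"
    then have "\<bar>real_of_int (R \<zeta> i)\<bar> \<le> T" for i by (simp add: S_def R_def)
    then have "\<bar>R \<zeta> i\<bar> \<le> \<lfloor>T\<rfloor>" for i by (simp add: le_floor_iff)
    then show "R \<zeta> \<in> lattice_box (nat \<lfloor>T\<rfloor>)" using T by (simp add: lattice_box_iff)
  qed
  have "card S \<le> card (lattice_box (nat \<lfloor>T\<rfloor>) :: ('k \<Rightarrow> int) set)"
    using img inj by (intro card_inj_on_le) auto
  also have "\<dots> = nat (2 * \<lfloor>T\<rfloor> + 1) ^ CARD('k)"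
    using T by (simp add: lattice_box_def card_PiE)
  finally have "real (card S) \<le> real (nat (2 * \<lfloor>T\<rfloor> + 1)) ^ CARD('k)"
    by (metis of_nat_le_iff of_nat_power)
  also have "\<dots> \<le> (2 * T + 1) ^ CARD('k)"
  proof (rule power_mono)
    have "of_int \<lfloor>T\<rfloor> \<le> T" by simp
    then show "real (nat (2 * \<lfloor>T\<rfloor> + 1)) \<le> 2 * T + 1" using T by simp
  qed simp
  finally show ?thesis by (simp add: S_def)
qed

text \<open>One summand for each shape of a nonzero residue vector. If some residue exceeds T, the
  kernel is at most \<open>2 / (T^2 + r^2)\<close> for the residue r of a coordinate where it is
  nonzero, and the sum over m gains 1 / T. If some \<open>\<zeta> i\<close> exceeds Y, the tail of
  the weight gains Z / Y. In the remaining case the residue vectors are short and the \<zeta> are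
  counted. T and Y stay free, to be balanced later.\<close>

lemma near_sum:
  assumes n: "0 < n" and D: "D \<subseteq> {..<2 * n}" and Z: "1 \<le> Z" and ZY: "Z \<le> Y"
    and T: "1 \<le> T" and TY: "2 * T * Y < real n"
  shows "(\<Sum>m\<in>D. \<Sum>\<zeta>\<in>lattice_box Q. lattice_weight Z \<zeta>
            * inv_sq (\<lambda>j::'k::finite. cres (int n) (int m * \<zeta> j)))
    \<le> CARD('k) * ((5 * Z) ^ CARD('k) * (16 / T)
        + 16 * (CARD('k) * (8 * Z\<^sup>2 / Y * (5 * Z) ^ (CARD('k) - 1)))
        + 16 * (2 * Y + 1) * (2 * T + 1) ^ CARD('k))"
proof -
  have fin: "finite D" using D finite_subset by blast
  define r where "r m q = cres (int n) (int m * q)" for m :: nat and q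
  \<comment> \<open>Zero residues get the value 0; the coordinate j used below always has a nonzero
    residue.\<close>
  define g where "g t m q = (if r m q = 0 then 0 else 1 / (t\<^sup>2 + (real_of_int (r m q))\<^sup>2))" for t m q
  have g0: "0 \<le> g t m q" for t m q by (simp add: g_def)
  have gs: "(\<Sum>m\<in>D. g t m q) \<le> 8 / t" if "0 < t" for t q
    unfolding g_def r_def by (rule sum_residues[OF n that D])
  define out where "out \<zeta> i = (Y < \<bar>real_of_int (\<zeta> i)\<bar>)" for \<zeta> :: "'k \<Rightarrow> int" and i
  define S where "S m \<zeta> j = (r m (\<zeta> j) \<noteq> 0 \<and>
            (\<forall>i. \<bar>real_of_int (\<zeta> i)\<bar> \<le> Y) \<and> (\<forall>i. \<bar>real_of_int (r m (\<zeta> i))\<bar> \<le> T))"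
    for m and \<zeta> :: "'k \<Rightarrow> int" and j
  \<comment> \<open>Majorants for the three cases. All are nonnegative, so in each case the other
    two may be added.\<close>
  define a where "a j m \<zeta> = 2 * (lattice_weight Z \<zeta> * g T m (\<zeta> j))" for j :: 'k and m \<zeta>
  define b where "b j m \<zeta> = (\<Sum>i\<in>UNIV. if out \<zeta> i then 2 * (lattice_weight Z \<zeta> * g 1 m (\<zeta> j)) else 0)" for j :: 'k and m \<zeta>
  define c where "c j m \<zeta> = (if S m \<zeta> j then 2 * g 1 m (\<zeta> j) else 0)" for j :: 'k and m \<zeta>
  have a0: "0 \<le> a j m \<zeta>" and b0: "0 \<le> b j m \<zeta>" and c0: "0 \<le> c j m \<zeta>" for j m \<zeta>
    unfolding a_def b_def c_def
    by (auto intro!: sum_nonneg mult_nonneg_nonneg g0 lattice_weight_bounds)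
  have gle: "1 / (real_of_int (r m q))\<^sup>2 \<le> 2 * g 1 m q" if "r m q \<noteq> 0" for m q
    using inverse_square_le_lorentz[OF that] that by (simp add: g_def lorentz_def)
  have pt: "lattice_weight Z \<zeta> * inv_sq (\<lambda>j. r m (\<zeta> j))
      \<le> (\<Sum>j\<in>UNIV. a j m \<zeta> + b j m \<zeta> + c j m \<zeta>)" for m \<zeta>
  proof (cases "(\<lambda>j. r m (\<zeta> j)) = (\<lambda>_. 0)")
    case True
    then show ?thesis using a0 b0 c0 by (simp add: inv_sq_zero sum_nonneg)
  next
    case False
    then obtain j where j: "r m (\<zeta> j) \<noteq> 0" by auto
    have j1: "1 \<le> \<bar>real_of_int (r m (\<zeta> j))\<bar>" using j by linarith
    then have isq: "inv_sq (\<lambda>j. r m (\<zeta> j)) \<le> 1 / (real_of_int (r m (\<zeta> j)))\<^sup>2"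
      using inv_sq_le[of "\<bar>real_of_int (r m (\<zeta> j))\<bar>" "\<lambda>j. r m (\<zeta> j)" j] by simp
    have isq1: "inv_sq (\<lambda>j. r m (\<zeta> j)) \<le> 2 * g 1 m (\<zeta> j)"
      using isq gle[OF j] by linarith
    have "lattice_weight Z \<zeta> * inv_sq (\<lambda>j. r m (\<zeta> j)) \<le> a j m \<zeta> + b j m \<zeta> + c j m \<zeta>"
    proof -
      consider (A) i where "T < \<bar>real_of_int (r m (\<zeta> i))\<bar>" | (B) i where "out \<zeta> i" | (C) "S m \<zeta> j"
        using j unfolding S_def out_def by (meson not_le)
      then show ?thesis
      proof cases
        case A
        let ?R = "(real_of_int (r m (\<zeta> j)))\<^sup>2"
        have i2: "inv_sq (\<lambda>j. r m (\<zeta> j)) \<le> 1 / T\<^sup>2"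
          using A T by (intro inv_sq_le[where j = i]) auto
        have "?R > 0" "T\<^sup>2 > 0" using j T by auto
        \<comment> \<open>The kernel is at most the reciprocal of the larger of \<open>T^2\<close>
          and \<open>?R\<close>, which is at most twice the reciprocal of their sum.\<close>
        have "inv_sq (\<lambda>j. r m (\<zeta> j)) \<le> 2 / (T\<^sup>2 + ?R)"
        proof (cases "T\<^sup>2 \<le> ?R")
          case True
          have "1 / ?R \<le> 2 / (T\<^sup>2 + ?R)"
            using True \<open>?R > 0\<close> \<open>T\<^sup>2 > 0\<close> by (subst divide_le_eq) (auto simp: le_divide_eq add_pos_pos)
          then show ?thesis using isq by linarith
        next
          case False
          have "1 / T\<^sup>2 \<le> 2 / (T\<^sup>2 + ?R)"
            using False \<open>?R > 0\<close> \<open>T\<^sup>2 > 0\<close> by (subst divide_le_eq) (auto simp: le_divide_eq add_pos_pos)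
          then show ?thesis using i2 by linarith
        qed
        then have "inv_sq (\<lambda>j. r m (\<zeta> j)) \<le> 2 * g T m (\<zeta> j)" using j by (simp add: g_def)
        then have "lattice_weight Z \<zeta> * inv_sq (\<lambda>j. r m (\<zeta> j)) \<le> a j m \<zeta>"
          using mult_left_mono[of _ _ "lattice_weight Z \<zeta>"] lattice_weight_bounds(1)[of Z \<zeta>]
          by (fastforce simp: a_def mult.left_commute)
        then show ?thesis using b0[of j m \<zeta>] c0[of j m \<zeta>] by linarith
      next
        case B
        have "lattice_weight Z \<zeta> * inv_sq (\<lambda>j. r m (\<zeta> j)) \<le> 2 * (lattice_weight Z \<zeta> * g 1 m (\<zeta> j))"
          using mult_left_mono[OF isq1 lattice_weight_bounds(1)[of Z \<zeta>]]
          by (simp add: mult.left_commute)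
        also have "\<dots> = (if out \<zeta> i then 2 * (lattice_weight Z \<zeta> * g 1 m (\<zeta> j)) else 0)"
          using B by simp
        also have "\<dots> \<le> b j m \<zeta>"
          unfolding b_def
          by (rule member_le_sum) (auto intro!: mult_nonneg_nonneg g0 lattice_weight_bounds)
        finally show ?thesis using a0[of j m \<zeta>] c0[of j m \<zeta>] by linarith
      next
        case C
        \<comment> \<open>The weight is discarded here: such vectors are few, and their number is
          used instead.\<close>
        have "lattice_weight Z \<zeta> * inv_sq (\<lambda>j. r m (\<zeta> j)) \<le> 1 * (2 * g 1 m (\<zeta> j))"
          by (intro mult_mono isq1 lattice_weight_bounds inv_sq_nonneg) auto
        also have "\<dots> = c j m \<zeta>" using C by (simp add: c_def)
        finally show ?thesis using a0[of j m \<zeta>] b0[of j m \<zeta>] by linarith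
      qed
    qed
    also have "\<dots> \<le> (\<Sum>j\<in>UNIV. a j m \<zeta> + b j m \<zeta> + c j m \<zeta>)"
      by (rule member_le_sum) (auto intro!: add_nonneg_nonneg a0 b0 c0)
    finally show ?thesis .
  qed
  have suma: "(\<Sum>m\<in>D. \<Sum>\<zeta>\<in>lattice_box Q. a j m \<zeta>) \<le> (5 * Z) ^ CARD('k) * (16 / T)" for j
  proof -
    have "(\<Sum>m\<in>D. \<Sum>\<zeta>\<in>lattice_box Q. a j m \<zeta>)
        = (\<Sum>\<zeta>\<in>lattice_box Q. lattice_weight Z \<zeta> * (2 * (\<Sum>m\<in>D. g T m (\<zeta> j))))"
      by (subst sum.swap) (simp add: a_def sum_distrib_left mult.left_commute)
    also have "\<dots> \<le> (\<Sum>\<zeta>\<in>lattice_box Q. lattice_weight Z (\<zeta> :: 'k \<Rightarrow> int) * (16 / T))"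
    proof (intro sum_mono mult_left_mono lattice_weight_bounds)
      show "2 * (\<Sum>m\<in>D. g T m (\<zeta> j)) \<le> 16 / T" for \<zeta> :: "'k \<Rightarrow> int"
        using mult_left_mono[OF gs[of T "\<zeta> j"], of 2] T by simp
    qed
    also have "\<dots> \<le> (5 * Z) ^ CARD('k) * (16 / T)"
      unfolding sum_distrib_right[symmetric]
      using T by (intro mult_right_mono sum_lattice_weight Z) auto
    finally show ?thesis .
  qed
  have sumb: "(\<Sum>m\<in>D. \<Sum>\<zeta>\<in>lattice_box Q. b j m \<zeta>)
      \<le> 16 * (CARD('k) * (8 * Z\<^sup>2 / Y * (5 * Z) ^ (CARD('k) - 1)))" for j
  proof -
    have "(\<Sum>m\<in>D. \<Sum>\<zeta>\<in>lattice_box Q. b j m \<zeta>)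
        = (\<Sum>\<zeta>\<in>lattice_box Q. \<Sum>m\<in>D. \<Sum>i\<in>UNIV. if out \<zeta> i then 2 * (lattice_weight Z \<zeta> * g 1 m (\<zeta> j)) else 0)"
      unfolding b_def by (rule sum.swap)
    also have "\<dots> = (\<Sum>\<zeta>\<in>lattice_box Q. \<Sum>i\<in>UNIV. \<Sum>m\<in>D. if out \<zeta> i then 2 * (lattice_weight Z \<zeta> * g 1 m (\<zeta> j)) else 0)"
      by (intro sum.cong refl sum.swap)
    also have "\<dots> \<le> (\<Sum>\<zeta>\<in>lattice_box Q. \<Sum>i\<in>UNIV. 16 * (lattice_weight Z \<zeta> * (if out \<zeta> i then 1 else 0)))"
    proof (intro sum_mono)
      fix \<zeta> :: "'k \<Rightarrow> int" and i
      have "lattice_weight Z \<zeta> * (2 * (\<Sum>m\<in>D. g 1 m (\<zeta> j))) \<le> lattice_weight Z \<zeta> * 16"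
        using gs[of 1 "\<zeta> j"] by (intro mult_left_mono lattice_weight_bounds) auto
      then show "(\<Sum>m\<in>D. if out \<zeta> i then 2 * (lattice_weight Z \<zeta> * g 1 m (\<zeta> j)) else 0)
          \<le> 16 * (lattice_weight Z \<zeta> * (if out \<zeta> i then 1 else 0))"
        by (simp add: sum_distrib_left mult.left_commute mult.commute)
    qed
    also have "\<dots> = (\<Sum>i\<in>UNIV. 16 * (\<Sum>\<zeta>\<in>lattice_box Q. lattice_weight Z \<zeta> * (if out \<zeta> i then 1 else 0)))"
      by (subst sum.swap) (simp add: sum_distrib_left)
    also have "\<dots> \<le> (\<Sum>i\<in>(UNIV::'k set). 16 * (8 * Z\<^sup>2 / Y * (5 * Z) ^ (CARD('k) - 1)))"
    proof (intro sum_mono mult_left_mono)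
      fix i :: 'k
      have "(\<Sum>q\<in>{- int Q..int Q}. lorentz Z q * (if Y < \<bar>real_of_int q\<bar> then 1 else 0))
          = (\<Sum>q\<in>{q\<in>{- int Q..int Q}. Y < \<bar>real_of_int q\<bar>}. lorentz Z q)"
        by (intro sum.mono_neutral_cong_right) auto
      also have "\<dots> \<le> 8 * Z\<^sup>2 / Y"
        using Z ZY by (intro sum_lorentz_tail) auto
      finally show "(\<Sum>\<zeta>\<in>lattice_box Q. lattice_weight Z \<zeta> * (if out \<zeta> i then 1 else 0))
          \<le> 8 * Z\<^sup>2 / Y * (5 * Z) ^ (CARD('k) - 1)"
        unfolding out_def
        by (intro sum_lattice_weight_coord[where g = "\<lambda>q. if Y < \<bar>real_of_int q\<bar> then 1 else 0"] Z) auto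
    qed simp
    also have "\<dots> = 16 * (CARD('k) * (8 * Z\<^sup>2 / Y * (5 * Z) ^ (CARD('k) - 1)))" by simp
    finally show ?thesis .
  qed
  have sumc: "(\<Sum>m\<in>D. \<Sum>\<zeta>\<in>lattice_box Q. c j m \<zeta>) \<le> 16 * (2 * Y + 1) * (2 * T + 1) ^ CARD('k)" for j
  proof -
    let ?I = "{- \<lfloor>Y\<rfloor>..\<lfloor>Y\<rfloor>}"
    \<comment> \<open>Sort the vectors by \<open>q = \<zeta> j\<close>. For fixed m and q at most
      \<open>(2 * T + 1) ^ k\<close> of them remain, and the sum over m then costs at most 8 for
      each of the at most \<open>2 * Y + 1\<close> values of q.\<close>
    have inner: "(\<Sum>\<zeta>\<in>lattice_box Q. c j m \<zeta>) \<le> (\<Sum>q\<in>?I. 2 * g 1 m q * (2 * T + 1) ^ CARD('k))" for m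
    proof -
      define L where "L = {\<zeta> \<in> lattice_box Q. S m \<zeta> j}"
      have "(\<Sum>\<zeta>\<in>lattice_box Q. c j m \<zeta>) = (\<Sum>\<zeta>\<in>L. 2 * g 1 m (\<zeta> j))"
        unfolding L_def c_def by (intro sum.mono_neutral_cong_right) auto
      also have "\<dots> = (\<Sum>q\<in>?I. \<Sum>\<zeta>\<in>{\<zeta>\<in>L. \<zeta> j = q}. 2 * g 1 m (\<zeta> j))"
      proof (rule sum.group[symmetric])
        show "(\<lambda>\<zeta>. \<zeta> j) ` L \<subseteq> ?I"
        proof safe
          fix \<zeta> assume "\<zeta> \<in> L"
          then have "\<bar>real_of_int (\<zeta> j)\<bar> \<le> Y" by (simp add: L_def S_def)
          then have "\<bar>\<zeta> j\<bar> \<le> \<lfloor>Y\<rfloor>" by (simp add: le_floor_iff)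
          then show "\<zeta> j \<in> ?I" by (simp add: abs_le_iff)
        qed
      qed (auto simp: L_def)
      also have "\<dots> \<le> (\<Sum>q\<in>?I. 2 * g 1 m q * (2 * T + 1) ^ CARD('k))"
      proof (rule sum_mono)
        fix q
        have "(\<Sum>\<zeta>\<in>{\<zeta>\<in>L. \<zeta> j = q}. 2 * g 1 m (\<zeta> j)) = 2 * g 1 m q * real (card {\<zeta>\<in>L. \<zeta> j = q})"
          by simp
        also have "\<dots> \<le> 2 * g 1 m q * (2 * T + 1) ^ CARD('k)"
        proof (rule mult_left_mono)
          have "{\<zeta>\<in>L. \<zeta> j = q} = {\<zeta> \<in> lattice_box Q. \<zeta> j = q \<and> cres (int n) (int m * q) \<noteq> 0 \<and>
            (\<forall>i. \<bar>real_of_int (\<zeta> i)\<bar> \<le> Y) \<and> (\<forall>i. \<bar>real_of_int (cres (int n) (int m * \<zeta> i))\<bar> \<le> T)}"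
            by (auto simp: L_def S_def r_def)
          then show "real (card {\<zeta>\<in>L. \<zeta> j = q}) \<le> (2 * T + 1) ^ CARD('k)"
            using n T TY Z ZY card_short_residues[of "int n" T Y Q j q "int m"] by simp
        qed (use g0 in auto)
        finally show "(\<Sum>\<zeta>\<in>{\<zeta>\<in>L. \<zeta> j = q}. 2 * g 1 m (\<zeta> j)) \<le> 2 * g 1 m q * (2 * T + 1) ^ CARD('k)" .
      qed
      finally show ?thesis .
    qed
    have "(\<Sum>m\<in>D. \<Sum>\<zeta>\<in>lattice_box Q. c j m \<zeta>) \<le> (\<Sum>m\<in>D. \<Sum>q\<in>?I. 2 * g 1 m q * (2 * T + 1) ^ CARD('k))"
      by (intro sum_mono inner)
    also have "\<dots> = (\<Sum>q\<in>?I. 2 * (\<Sum>m\<in>D. g 1 m q) * (2 * T + 1) ^ CARD('k))"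
      by (subst sum.swap) (simp add: sum_distrib_left sum_distrib_right)
    also have "\<dots> \<le> (\<Sum>q\<in>?I. 16 * (2 * T + 1) ^ CARD('k))"
    proof (intro sum_mono mult_right_mono)
      show "2 * (\<Sum>m\<in>D. g 1 m q) \<le> 16" for q using gs[of 1 q] by simp
    qed (use T in auto)
    also have "\<dots> = real (card ?I) * (16 * (2 * T + 1) ^ CARD('k))" by simp
    also have "\<dots> \<le> (2 * Y + 1) * (16 * (2 * T + 1) ^ CARD('k))"
    proof (rule mult_right_mono)
      have "0 \<le> \<lfloor>Y\<rfloor>" using Z ZY by simp
      then have "real (card ?I) = 2 * of_int \<lfloor>Y\<rfloor> + 1" by simp
      moreover have "of_int \<lfloor>Y\<rfloor> \<le> Y" by simp
      ultimately show "real (card ?I) \<le> 2 * Y + 1" by linarith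
    qed (use T in auto)
    finally show ?thesis by (simp only: mult_ac)
  qed
  have "(\<Sum>m\<in>D. \<Sum>\<zeta>\<in>lattice_box Q. lattice_weight Z \<zeta> * inv_sq (\<lambda>j::'k. r m (\<zeta> j)))
     \<le> (\<Sum>m\<in>D. \<Sum>\<zeta>\<in>lattice_box Q. \<Sum>j\<in>UNIV. a j m \<zeta> + b j m \<zeta> + c j m \<zeta>)"
    by (rule sum_mono, rule sum_mono, rule pt)
  also have "\<dots> = (\<Sum>m\<in>D. \<Sum>j\<in>UNIV. \<Sum>\<zeta>\<in>lattice_box Q. a j m \<zeta> + b j m \<zeta> + c j m \<zeta>)"
    by (intro sum.cong refl sum.swap)
  also have "\<dots> = (\<Sum>j\<in>UNIV. \<Sum>m\<in>D. \<Sum>\<zeta>\<in>lattice_box Q. a j m \<zeta> + b j m \<zeta> + c j m \<zeta>)"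
    by (rule sum.swap)
  also have "\<dots> = (\<Sum>j\<in>UNIV. (\<Sum>m\<in>D. \<Sum>\<zeta>\<in>lattice_box Q. a j m \<zeta>)
      + (\<Sum>m\<in>D. \<Sum>\<zeta>\<in>lattice_box Q. b j m \<zeta>) + (\<Sum>m\<in>D. \<Sum>\<zeta>\<in>lattice_box Q. c j m \<zeta>))"
    by (simp add: sum.distrib)
  also have "\<dots> \<le> (\<Sum>j\<in>(UNIV::'k set). (5 * Z) ^ CARD('k) * (16 / T)
        + 16 * (CARD('k) * (8 * Z\<^sup>2 / Y * (5 * Z) ^ (CARD('k) - 1)))
        + 16 * (2 * Y + 1) * (2 * T + 1) ^ CARD('k))"
    by (intro sum_mono add_mono suma sumb sumc)
  finally show ?thesis by (simp add: r_def)
qed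

section \<open>The sum over a pair of dyadic blocks\<close>

text \<open>Put s = 1 / (8 k), \<eta> = 2 s, T = \<open>M powr \<eta>\<close> and Y = Z * T. The
  bound on \<tau> says k * \<tau> <= s, so the gain 1 / T beats the excess
  \<open>M powr (k * \<tau>)\<close> of the weight with s to spare: 1 + k * \<tau> - \<eta> <= 1 -
  s.\<close>

lemma near_sum_scaled:
  fixes \<tau> B :: real
  assumes k: "CARD('k::finite) \<ge> 3" and \<tau>: "0 < \<tau>" "\<tau> \<le> 1 / (8 * (real CARD('k))\<^sup>2)" and B: "1 \<le> B"
  shows "\<exists>C\<ge>0. \<forall>n M D Q. 1 \<le> M \<longrightarrow> M \<le> 2 * real n \<longrightarrow> D \<subseteq> {..<2 * n} \<longrightarrow> real (card D) \<le> M \<longrightarrow>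
    (\<Sum>m\<in>D. \<Sum>\<zeta>\<in>lattice_box Q. lattice_weight (B * M powr (1 / CARD('k) + \<tau>)) \<zeta>
            * inv_sq (\<lambda>j::'k. cres (int n) (int m * \<zeta> j))) \<le> C * M powr (1 - 1 / (8 * real CARD('k)))"
proof -
  define k where "k = real CARD('k)"
  define \<eta> where "\<eta> = 1 / (4 * k)"
  define s where "s = 1 / (8 * k)"
  define \<theta> where "\<theta> = 1 / k + \<tau>"
  have k3: "3 \<le> k" using k by (simp add: k_def)
  have k\<tau>: "k * \<tau> \<le> s" "\<tau> \<le> 1 / 72"
  proof -
    have "k * \<tau> \<le> k * (1 / (8 * k\<^sup>2))" using \<tau> k3 by (intro mult_left_mono) (auto simp: k_def)
    then show "k * \<tau> \<le> s" using k3 by (simp add: s_def power2_eq_square)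
    have "3\<^sup>2 \<le> k\<^sup>2" using k3 by (intro power_mono) auto
    then have "1 / (8 * k\<^sup>2) \<le> 1 / 72" by (simp add: divide_simps)
    then show "\<tau> \<le> 1 / 72" using \<tau>(2) unfolding k_def by linarith
  qed
  have kk: "1 / k \<le> 1 / 3" using k3 by (simp add: divide_simps)
  have s\<eta>: "s = (1 / k) / 8" "\<eta> = (1 / k) / 4" "k * \<eta> = 1 / 4" "k * \<theta> = 1 + k * \<tau>"
    using k3 by (simp_all add: s_def \<eta>_def \<theta>_def field_simps)
  have s0: "0 < s" "0 < \<eta>" "0 < \<theta>" using k3 \<tau> by (auto simp: s_def \<eta>_def \<theta>_def add_pos_pos)
  \<comment> \<open>\<open>C1\<close> serves the range where \<open>near_sum\<close> applies,
    \<open>C2\<close> the bounded range \<open>M \<le> (4 * B) ^ 4\<close>.\<close>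
  define C1 where "C1 = k * (16 * (5 * B) ^ CARD('k) + 128 * k * (5 * B) ^ CARD('k)
      + 48 * B * 3 ^ CARD('k))"
  define C2 where "C2 = (5 * B) ^ CARD('k) * ((4 * B) ^ 4) ^ 4"
  have C12: "0 \<le> C1" "0 \<le> C2" using B k3 by (auto simp: C1_def C2_def)
  show ?thesis
  proof (intro exI[of _ "C1 + C2"] conjI allI impI)
    show "0 \<le> C1 + C2" using C12 by simp
    fix n :: nat and M :: real and D :: "nat set" and Q :: nat
    assume M1: "1 \<le> M" and Mn: "M \<le> 2 * real n" and D: "D \<subseteq> {..<2 * n}" and cD: "real (card D) \<le> M"
    define Z where "Z = B * M powr \<theta>"
    define T where "T = M powr \<eta>"
    define Y where "Y = Z * M powr \<eta>"
    let ?L = "\<Sum>m\<in>D. \<Sum>\<zeta>\<in>lattice_box Q. lattice_weight Z \<zeta>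
            * inv_sq (\<lambda>j::'k. cres (int n) (int m * \<zeta> j))"
    have p1: "1 \<le> M powr x" if "0 \<le> x" for x using M1 that by (rule ge_one_powr_ge_zero)
    have Z1: "1 \<le> Z" using mult_mono[of 1 B 1 "M powr \<theta>"] B p1[of \<theta>] s0 by (simp add: Z_def)
    have T1: "1 \<le> T" using p1[of \<eta>] s0 by (simp add: T_def)
    have ZY: "Z \<le> Y" using mult_left_mono[OF p1[of \<eta>], of Z] Z1 s0 by (simp add: Y_def)
    have Zk: "(5 * Z) ^ CARD('k) = (5 * B) ^ CARD('k) * M powr (1 + k * \<tau>)"
      unfolding Z_def using M1 s\<eta>(4)
      by (simp add: power_mult_distrib powr_power k_def mult.commute)
    have "?L \<le> (C1 + C2) * M powr (1 - s)"
    proof (cases "2 * T * Y < real n")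
      case True
      have n0: "0 < n" using Mn M1 by (cases n) auto
      have t1: "(5 * Z) ^ CARD('k) * (16 / T) \<le> 16 * (5 * B) ^ CARD('k) * M powr (1 - s)"
      proof -
        have "(5 * Z) ^ CARD('k) * (16 / T) = 16 * (5 * B) ^ CARD('k) * M powr (1 + k * \<tau> - \<eta>)"
          unfolding Zk T_def by (simp add: powr_diff)
        also have "\<dots> \<le> 16 * (5 * B) ^ CARD('k) * M powr (1 - s)"
          using k\<tau> s\<eta> s0 M1 B by (intro mult_left_mono powr_mono) auto
        finally show ?thesis .
      qed
      \<comment> \<open>Because Y is Z * T, the second summand is a constant multiple of the
        first.\<close>
      have t2: "16 * (CARD('k) * (8 * Z\<^sup>2 / Y * (5 * Z) ^ (CARD('k) - 1)))
          \<le> 128 * k * (5 * B) ^ CARD('k) * M powr (1 - s)"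
      proof -
        have "Z\<^sup>2 / Y = Z / T" using Z1 by (simp add: Y_def T_def power2_eq_square)
        then have "8 * Z\<^sup>2 / Y = 8 / 5 / T * (5 * Z)"
          by (metis (no_types, opaque_lifting) divide_divide_eq_left mult.commute nonzero_mult_div_cancel_left
              times_divide_eq_left times_divide_eq_right zero_neq_numeral)
        then have "8 * Z\<^sup>2 / Y * (5 * Z) ^ (CARD('k) - 1) = 8 / 5 / T * ((5 * Z) * (5 * Z) ^ (CARD('k) - 1))"
          by (simp only: mult.assoc)
        also have "(5 * Z) * (5 * Z) ^ (CARD('k) - 1) = (5 * Z) ^ CARD('k)"
          using k by (metis One_nat_def Suc_pred not_less_eq_eq numeral_3_eq_3 power_Suc zero_less_card_finite)
        also have "8 / 5 / T * (5 * Z) ^ CARD('k) = (1 / 10) * ((5 * Z) ^ CARD('k) * (16 / T))" by simp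
        also have "\<dots> \<le> (1 / 10) * (16 * (5 * B) ^ CARD('k) * M powr (1 - s))"
          by (intro mult_left_mono t1) auto
        also have "\<dots> \<le> 8 * ((5 * B) ^ CARD('k) * M powr (1 - s))"
          using B by simp
        finally have "8 * Z\<^sup>2 / Y * (5 * Z) ^ (CARD('k) - 1) \<le> 8 * ((5 * B) ^ CARD('k) * M powr (1 - s))" .
        from mult_left_mono[OF this, of "16 * k"] k3 show ?thesis
          by (simp add: k_def mult.assoc mult.left_commute)
      qed
      have t3: "16 * (2 * Y + 1) * (2 * T + 1) ^ CARD('k) \<le> 48 * B * 3 ^ CARD('k) * M powr (1 - s)"
      proof -
        have "16 * (2 * Y + 1) * (2 * T + 1) ^ CARD('k) \<le> 16 * (3 * Y) * (3 * T) ^ CARD('k)"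
          using Z1 ZY T1 by (intro mult_mono power_mono) auto
        also have "\<dots> = 48 * B * 3 ^ CARD('k) * M powr (\<theta> + \<eta> + k * \<eta>)"
          using M1 by (simp add: Y_def Z_def T_def power_mult_distrib powr_power powr_add k_def mult.commute)
        also have "\<dots> \<le> 48 * B * 3 ^ CARD('k) * M powr (1 - s)"
        proof (intro mult_left_mono powr_mono)
          \<comment> \<open>The count of short residue vectors contributes k * \<eta>, which is
            exactly 1 / 4. With 1 / k <= 1 / 3 the total is at most 11 / 24 + 1 / 72 + 1 / 4, which
            is below 1.\<close>
          have "\<theta> + \<eta> + k * \<eta> + s = 11 / 8 * (1 / k) + \<tau> + 1 / 4"
            unfolding s\<eta>(3) unfolding s\<eta>(1,2) \<theta>_def by simp
          then show "\<theta> + \<eta> + k * \<eta> \<le> 1 - s" using kk k\<tau>(2) by linarith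
        qed (use M1 B in auto)
        finally show ?thesis .
      qed
      have "?L \<le> CARD('k) * ((5 * Z) ^ CARD('k) * (16 / T)
        + 16 * (CARD('k) * (8 * Z\<^sup>2 / Y * (5 * Z) ^ (CARD('k) - 1)))
        + 16 * (2 * Y + 1) * (2 * T + 1) ^ CARD('k))"
        by (rule near_sum[OF n0 D Z1 ZY T1 True])
      also have "\<dots> \<le> k * (16 * (5 * B) ^ CARD('k) * M powr (1 - s)
         + 128 * k * (5 * B) ^ CARD('k) * M powr (1 - s) + 48 * B * 3 ^ CARD('k) * M powr (1 - s))"
        unfolding k_def[symmetric]
        using k3 t1 t2 t3 by (intro mult_left_mono add_mono) (auto simp: k_def)
      also have "\<dots> = C1 * M powr (1 - s)" by (simp add: C1_def algebra_simps)
      also have "\<dots> \<le> (C1 + C2) * M powr (1 - s)" using C12 by (intro mult_right_mono) auto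
      finally show ?thesis .
    next
      case False
      \<comment> \<open>Failure of \<open>2 * T * Y < n\<close> forces
        \<open>M \<le> 4 * B * M powr (3 / 4)\<close>. So M is bounded, and estimating the kernel by
        1 is enough.\<close>
      have "M \<le> 4 * (T * Y)" using False Mn by simp
      also have "T * Y = B * M powr (\<theta> + 2 * \<eta>)"
        using M1 by (simp add: T_def Y_def Z_def powr_add[symmetric] mult.left_commute mult.assoc)
          (simp add: algebra_simps)
      also have "\<dots> \<le> B * M powr (3 / 4)"
        using kk k\<tau> s\<eta> M1 B by (intro mult_left_mono powr_mono) (auto simp: \<theta>_def)
      finally have "M \<le> 4 * B * M powr (3 / 4)" by simp
      then have "M powr (1 / 4) * M powr (3 / 4) \<le> 4 * B * M powr (3 / 4)"
        using M1 by (simp add: powr_add[symmetric])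
      then have "M powr (1 / 4) \<le> 4 * B" using M1 by (simp add: mult_le_cancel_right)
      then have "(M powr (1 / 4)) ^ 4 \<le> (4 * B) ^ 4" by (intro power_mono) auto
      then have M4: "M \<le> (4 * B) ^ 4" using M1 by (simp add: powr_power)
      have "?L \<le> (\<Sum>m\<in>D. \<Sum>\<zeta>\<in>lattice_box Q. lattice_weight Z (\<zeta> :: 'k \<Rightarrow> int))"
        by (intro sum_mono mult_right_le_one_le inv_sq_le_one inv_sq_nonneg lattice_weight_bounds)
      also have "\<dots> \<le> (\<Sum>m\<in>D. (5 * Z) ^ CARD('k))"
        by (intro sum_mono sum_lattice_weight Z1)
      also have "\<dots> = real (card D) * (5 * Z) ^ CARD('k)" by simp
      also have "\<dots> \<le> M * (5 * Z) ^ CARD('k)" using cD Z1 by (intro mult_right_mono) auto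
      also have "\<dots> \<le> M * ((5 * B) ^ CARD('k) * M powr 2)"
        unfolding Zk using k\<tau> kk s\<eta> M1 B by (intro mult_left_mono powr_mono) auto
      also have "\<dots> = (5 * B) ^ CARD('k) * M ^ 3 * 1"
        using M1 by (simp add: powr_numeral numeral_3_eq_3 power2_eq_square)
      also have "\<dots> \<le> (5 * B) ^ CARD('k) * ((4 * B) ^ 4) ^ 4 * M powr (1 - s)"
      proof (intro mult_mono)
        have "M ^ 3 \<le> M ^ 4" using M1 by (intro power_increasing) auto
        also have "\<dots> \<le> ((4 * B) ^ 4) ^ 4" using M4 M1 by (intro power_mono) auto
        finally show "M ^ 3 \<le> ((4 * B) ^ 4) ^ 4" .
        show "1 \<le> M powr (1 - s)" using s\<eta> kk by (intro p1) auto
      qed (use B M1 in auto)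
      also have "\<dots> \<le> (C1 + C2) * M powr (1 - s)"
        unfolding C2_def[symmetric] using C12 by (intro mult_right_mono) auto
      finally show ?thesis .
    qed
    then show "(\<Sum>m\<in>D. \<Sum>\<zeta>\<in>lattice_box Q. lattice_weight (B * M powr (1 / CARD('k) + \<tau>)) \<zeta>
            * inv_sq (\<lambda>j::'k. cres (int n) (int m * \<zeta> j))) \<le> (C1 + C2) * M powr (1 - 1 / (8 * real CARD('k)))"
      unfolding Z_def \<theta>_def s_def k_def .
  qed
qed

text \<open>The frequency attached to the larger index n is summed first: b <= a gives M <= 2 n,
  which the residue sums require. The remainder from all but the nearest lattice point is harmless,
  because the bound for \<open>(5 * X a) ^ (k - 1) / n^2\<close> does not increase with N, so N = M
  is the worst case.\<close>

lemma dyadic_pair_sum: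
  fixes \<tau> B :: real
  assumes k: "CARD('k::finite) \<ge> 3" and \<tau>: "0 < \<tau>" "\<tau> \<le> 1 / (8 * (real CARD('k))\<^sup>2)" and B: "1 \<le> B"
  defines "X \<equiv> \<lambda>m. B * (2 ^ m) powr (1 / CARD('k) + \<tau>)"
  shows "\<exists>C\<ge>0. \<forall>a b n Q. 1 \<le> b \<longrightarrow> b \<le> a \<longrightarrow> n \<in> dyadic_block a \<longrightarrow>
    (\<Sum>m\<in>dyadic_block b. \<Sum>\<zeta>\<in>lattice_box Q. \<Sum>\<xi>\<in>lattice_box Q.
       lattice_weight (X a) \<xi> * lattice_weight (X b) \<zeta> * inv_sq (\<lambda>j::'k. int n * \<xi> j + int m * \<zeta> j))
     \<le> C * (2 ^ b * (2 powr (- 1 / (8 * real CARD('k)))) ^ b)"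
proof -
  define k where "k = real CARD('k)"
  define s where "s = 1 / (8 * k)"
  define \<theta> where "\<theta> = 1 / k + \<tau>"
  have k3: "3 \<le> k" using k by (simp add: k_def)
  have k\<tau>: "k * \<tau> \<le> s"
  proof -
    have "k * \<tau> \<le> k * (1 / (8 * k\<^sup>2))" using \<tau> k3 by (intro mult_left_mono) (auto simp: k_def)
    then show "k * \<tau> \<le> s" using k3 by (simp add: s_def power2_eq_square)
  qed
  have kk: "1 / k \<le> 1 / 3" using k3 by (simp add: divide_simps)
  have s1: "s = (1 / k) / 8" "k * \<theta> = 1 + k * \<tau>"
    using k3 by (simp_all add: s_def \<theta>_def field_simps)
  have s0: "0 < s" using k3 by (simp add: s_def)
  have \<theta>0: "0 < \<theta>" using k3 \<tau> by (auto simp: \<theta>_def add_pos_pos)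
  obtain C0 where C0: "0 \<le> C0" and near: "\<And>n M D Q. 1 \<le> M \<Longrightarrow> M \<le> 2 * real n \<Longrightarrow> D \<subseteq> {..<2 * n} \<Longrightarrow>
      real (card D) \<le> M \<Longrightarrow> (\<Sum>m\<in>D. \<Sum>\<zeta>\<in>lattice_box Q. lattice_weight (B * M powr \<theta>) \<zeta>
            * inv_sq (\<lambda>j::'k. cres (int n) (int m * \<zeta> j))) \<le> C0 * M powr (1 - s)"
  proof -
    assume *: "\<And>C0. 0 \<le> C0 \<Longrightarrow> (\<And>n M D Q. 1 \<le> M \<Longrightarrow> M \<le> 2 * real n \<Longrightarrow> D \<subseteq> {..<2 * n} \<Longrightarrow>
      real (card D) \<le> M \<Longrightarrow> (\<Sum>m\<in>D. \<Sum>\<zeta>\<in>lattice_box Q. lattice_weight (B * M powr \<theta>) \<zeta>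
            * inv_sq (\<lambda>j::'k. cres (int n) (int m * \<zeta> j))) \<le> C0 * M powr (1 - s)) \<Longrightarrow> thesis"
    from near_sum_scaled[OF k \<tau> B, folded k_def, folded \<theta>_def s_def]
    show thesis by (elim exE conjE) (rule *, auto)
  qed
  define C1 where "C1 = (5 * B) ^ CARD('k) * (k * (128 * (5 * B) ^ (CARD('k) - 1)))"
  have C1: "0 \<le> C1" using B k3 by (simp add: C1_def)
  show ?thesis
  proof (intro exI[of _ "C0 + C1"] conjI allI impI)
    show "0 \<le> C0 + C1" using C0 C1 by simp
    fix a b n Q :: nat
    assume b: "1 \<le> b" "b \<le> a" and n: "n \<in> dyadic_block a"
    define M :: real where "M = 2 ^ b"
    define N :: real where "N = 2 ^ a"
    define W where "W = CARD('k) * (32 / (real n)\<^sup>2 * (5 * X a) ^ (CARD('k) - 1))"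
    let ?D = "dyadic_block b"
    have M1: "1 \<le> M" and MN: "M \<le> N" using b by (auto simp: M_def N_def power_increasing)
    have a1: "1 \<le> a" using b by simp
    have nN: "N \<le> 2 * real n"
    proof -
      have "2 * 2 ^ (a - 1) \<le> 2 * n" using n by (auto simp: dyadic_block_def)
      moreover have "2 * 2 ^ (a - 1) = (2::nat) ^ a" using a1 by (cases a) auto
      ultimately have "real (2 ^ a) \<le> real (2 * n)" by (simp only: of_nat_le_iff)
      then show ?thesis by (simp add: N_def)
    qed
    have n0: "0 < n" using nN MN M1 by (cases n) auto
    have D2: "?D \<subseteq> {..<2 * n}"
    proof
      fix m assume "m \<in> ?D"
      then have "real m < M" by (simp add: dyadic_block_def M_def)
      then have "real m < real (2 * n)" using MN nN by simp
      then show "m \<in> {..<2 * n}" by (simp only: of_nat_less_iff lessThan_iff)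
    qed
    have cD: "real (card ?D) \<le> M"
    proof -
      have "card ?D \<le> 2 ^ b" by (simp add: dyadic_block_def)
      then have "real (card ?D) \<le> real (2 ^ b)" by (simp only: of_nat_le_iff)
      then show ?thesis by (simp add: M_def)
    qed
    have Xge: "1 \<le> X m" for m
      using mult_mono[of 1 B 1 "(2 ^ m) powr \<theta>"] ge_one_powr_ge_zero[of "2 ^ m" \<theta>] B \<theta>0
      by (simp add: X_def \<theta>_def k_def)
    have W0: "0 \<le> W" using Xge[of a] by (simp add: W_def)
    have Xpow: "(5 * X m) ^ p = (5 * B) ^ p * (2 ^ m) powr (p * \<theta>)" for m p
      by (simp add: X_def power_mult_distrib powr_power \<theta>_def k_def mult.commute)
    have sp: "(\<Sum>\<xi>\<in>lattice_box Q.
       lattice_weight (X a) \<xi> * lattice_weight (X b) \<zeta> * inv_sq (\<lambda>j::'k. int n * \<xi> j + int m * \<zeta> j))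
      \<le> lattice_weight (X b) \<zeta> * inv_sq (\<lambda>j. cres (int n) (int m * \<zeta> j)) + lattice_weight (X b) \<zeta> * W"
      for m \<zeta>
    proof -
      have "(\<Sum>\<xi>\<in>lattice_box Q.
         lattice_weight (X a) \<xi> * lattice_weight (X b) \<zeta> * inv_sq (\<lambda>j::'k. int n * \<xi> j + int m * \<zeta> j))
        = lattice_weight (X b) \<zeta> * (\<Sum>\<xi>\<in>lattice_box Q.
         lattice_weight (X a) \<xi> * inv_sq (\<lambda>j::'k. int n * \<xi> j + int m * \<zeta> j))"
        by (simp add: sum_distrib_left mult.assoc mult.left_commute)
      also have "\<dots> \<le> lattice_weight (X b) \<zeta> * (inv_sq (\<lambda>j. cres (int n) (int m * \<zeta> j)) + W)"
        unfolding W_def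
        using shifted_lattice_sum[of "int n" "X a" "\<lambda>j. int m * \<zeta> j" Q] n0 Xge
        by (intro mult_left_mono lattice_weight_bounds) auto
      finally show ?thesis by (simp add: distrib_left)
    qed
    have "(\<Sum>m\<in>?D. \<Sum>\<zeta>\<in>lattice_box Q. \<Sum>\<xi>\<in>lattice_box Q.
       lattice_weight (X a) \<xi> * lattice_weight (X b) \<zeta> * inv_sq (\<lambda>j::'k. int n * \<xi> j + int m * \<zeta> j))
      \<le> (\<Sum>m\<in>?D. \<Sum>\<zeta>\<in>lattice_box Q. lattice_weight (X b) \<zeta> * inv_sq (\<lambda>j::'k. cres (int n) (int m * \<zeta> j))
          + lattice_weight (X b) \<zeta> * W)"
      by (intro sum_mono sp)
    also have "\<dots> = (\<Sum>m\<in>?D. \<Sum>\<zeta>\<in>lattice_box Q. lattice_weight (X b) \<zeta> * inv_sq (\<lambda>j::'k. cres (int n) (int m * \<zeta> j)))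
          + (\<Sum>m\<in>?D. (\<Sum>\<zeta>\<in>lattice_box Q. lattice_weight (X b) (\<zeta> :: 'k \<Rightarrow> int)) * W)"
      by (simp add: sum.distrib sum_distrib_right)
    also have "\<dots> \<le> C0 * M powr (1 - s) + C1 * M powr (1 - s)"
    proof (rule add_mono)
      show "(\<Sum>m\<in>?D. \<Sum>\<zeta>\<in>lattice_box Q. lattice_weight (X b) \<zeta> * inv_sq (\<lambda>j::'k. cres (int n) (int m * \<zeta> j)))
          \<le> C0 * M powr (1 - s)"
        using near[OF M1 _ D2 cD, of Q] MN nN unfolding X_def M_def \<theta>_def k_def by simp
      have "(\<Sum>m\<in>?D. (\<Sum>\<zeta>\<in>lattice_box Q. lattice_weight (X b) (\<zeta> :: 'k \<Rightarrow> int)) * W)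
          \<le> (\<Sum>m\<in>?D. (5 * X b) ^ CARD('k) * W)"
        by (intro sum_mono mult_right_mono sum_lattice_weight Xge W0)
      also have "\<dots> \<le> M * ((5 * X b) ^ CARD('k) * W)"
        using cD Xge[of b] W0 by (simp add: mult_right_mono)
      also have "W \<le> k * (128 * (5 * B) ^ (CARD('k) - 1)) * M powr ((k - 1) * \<theta> - 2)"
      proof -
        have "32 / (real n)\<^sup>2 \<le> 32 / (N / 2)\<^sup>2"
          using nN MN M1 n0 by (intro divide_left_mono power_mono) auto
        also have "\<dots> = 128 * N powr (- 2)"
          by (simp add: N_def powr_minus powr_numeral field_simps)
        finally have "W \<le> k * (128 * N powr (- 2) * (5 * X a) ^ (CARD('k) - 1))"
          unfolding W_def k_def using Xge[of a] by (intro mult_left_mono mult_right_mono) auto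
        also have "\<dots> = k * (128 * (5 * B) ^ (CARD('k) - 1)) * N powr ((k - 1) * \<theta> - 2)"
          unfolding Xpow N_def[symmetric] using k
          by (simp add: k_def of_nat_diff powr_diff powr_minus powr_add field_simps)
        also have "N powr ((k - 1) * \<theta> - 2) \<le> M powr ((k - 1) * \<theta> - 2)"
        proof (rule powr_mono2')
          have "(k - 1) * \<theta> \<le> k * \<theta>" using \<theta>0 by simp
          also have "\<dots> \<le> 2" using s1 k\<tau> kk by simp
          finally show "(k - 1) * \<theta> - 2 \<le> 0" by simp
        qed (use M1 MN in auto)
        finally show ?thesis using k3 B by (simp add: mult_left_mono)
      qed
      also have "M * ((5 * X b) ^ CARD('k) * (k * (128 * (5 * B) ^ (CARD('k) - 1)) * M powr ((k - 1) * \<theta> - 2)))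
          = C1 * M powr (1 + k * \<theta> + ((k - 1) * \<theta> - 2))"
        unfolding Xpow M_def[symmetric] C1_def powr_add using M1
        by (simp add: k_def mult_ac)
      also have "\<dots> \<le> C1 * M powr (1 - s)"
      proof (intro mult_left_mono powr_mono C1 M1)
        \<comment> \<open>The gain 1 / k equals 8 s, while the losses amount to at most 2 k * \<tau>
          <= 2 s.\<close>
        have k8: "1 / k = 8 * s" using k3 by (simp add: s_def)
        have "(k - 1) * \<theta> = 1 + k * \<tau> - 1 / k - \<tau>"
          unfolding left_diff_distrib s1(2) by (simp add: \<theta>_def)
        then show "1 + k * \<theta> + ((k - 1) * \<theta> - 2) \<le> 1 - s"
          unfolding s1(2) using k\<tau> \<tau>(1) s0 k8 by linarith
      qed
      finally show "(\<Sum>m\<in>?D. (\<Sum>\<zeta>\<in>lattice_box Q. lattice_weight (X b) (\<zeta> :: 'k \<Rightarrow> int)) * W) \<le> C1 * M powr (1 - s)"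
        using Xge[of b] M1 by (simp add: mult_left_mono)
    qed
    also have "\<dots> = (C0 + C1) * M powr (1 - s)" by (simp add: distrib_right)
    also have "M powr (1 - s) = 2 ^ b * (2 powr (- 1 / (8 * real CARD('k)))) ^ b"
    proof -
      have "M powr (- s) = (2 powr (- s)) ^ b"
        by (simp add: M_def powr_powr powr_power mult.commute flip: powr_realpow)
      then show ?thesis using M1
        by (simp add: diff_conv_add_uminus powr_add M_def s_def k_def del: add_uminus_conv_diff)
    qed
    finally show "(\<Sum>m\<in>dyadic_block b. \<Sum>\<zeta>\<in>lattice_box Q. \<Sum>\<xi>\<in>lattice_box Q.
       lattice_weight (X a) \<xi> * lattice_weight (X b) \<zeta> * inv_sq (\<lambda>j::'k. int n * \<xi> j + int m * \<zeta> j))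
     \<le> (C0 + C1) * (2 ^ b * (2 powr (- 1 / (8 * real CARD('k)))) ^ b)" .
  qed
qed

section \<open>Fourier inversion on the circle\<close>

text \<open>The period is centred at 0, so that every rescaled bump \<open>w (s / \<delta>)\<close>
  with \<delta> <= 1 / 2 vanishes at both of its ends.\<close>

definition unit_period :: "real measure" where
  "unit_period = restrict_space lborel {- 1 / 2..1 / 2}"

definition fourier_coeff :: "(real \<Rightarrow> complex) \<Rightarrow> int \<Rightarrow> complex" where
  "fourier_coeff g q = (LINT s|unit_period. g s * cis (- 2 * pi * of_int q * s))"

lemma space_unit_period [simp]: "space unit_period = {- 1 / 2..1 / 2}"
  by (simp add: unit_period_def space_restrict_space)

lemma prob_space_unit_period: "prob_space unit_period"
  by (rule prob_spaceI) (simp add: unit_period_def emeasure_restrict_space space_restrict_space)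

lemma measurable_unit_period:
  "f \<in> borel_measurable borel \<Longrightarrow> f \<in> borel_measurable unit_period"
  unfolding unit_period_def by (rule measurable_restrict_space1) simp

lemma cis_measurable [measurable]: "cis \<in> borel_measurable borel"
  by (intro borel_measurable_continuous_onI continuous_intros)

lemma cnj_measurable [measurable]: "cnj \<in> borel_measurable borel"
  by (intro borel_measurable_continuous_onI continuous_intros)

lemma integrable_unit_period:
  fixes f :: "real \<Rightarrow> complex"
  assumes "f \<in> borel_measurable borel" "\<And>s. s \<in> {- 1 / 2..1 / 2} \<Longrightarrow> norm (f s) \<le> K"
  shows "integrable unit_period f"
proof -
  interpret prob_space unit_period by (rule prob_space_unit_period)
  show ?thesis
    using assms by (intro integrable_const_bound[where B = K] AE_I2 measurable_unit_period) auto
qed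

lemma integral_cis:
  "(LINT s|unit_period. cis (2 * pi * of_int q * s)) = (if q = 0 then 1 else 0)"
proof (cases "q = 0")
  case True
  interpret prob_space unit_period by (rule prob_space_unit_period)
  show ?thesis using True by (simp add: prob_space[simplified])
next
  case False
  define c where "c = 2 * pi * real_of_int q"
  have c0: "c \<noteq> 0" using False by (simp add: c_def)
  have "(LINT s|unit_period. cis (c * s))
      = (LINT s|lborel. indicator {- 1 / 2..1 / 2} s *\<^sub>R cis (c * s))"
    by (simp add: unit_period_def integral_restrict_space)
  also have "\<dots> = cis (c * (1 / 2)) / (\<i> * c) - cis (c * (- 1 / 2)) / (\<i> * c)"
  proof (rule integral_FTC_atLeastAtMost)
    show "((\<lambda>s. cis (c * s) / (\<i> * c)) has_vector_derivative cis (c * s)) (at s within {- 1 / 2..1 / 2})" for s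
    proof -
      have "((\<lambda>w. exp (\<i> * of_real c * w) / (\<i> * c)) has_field_derivative exp (\<i> * of_real c * of_real s)) (at (of_real s))"
        using c0 by (auto intro!: derivative_eq_intros)
      from has_vector_derivative_real_field[OF this] show ?thesis
        by (simp add: cis_conv_exp mult.assoc)
    qed
    show "continuous_on {- 1 / 2..1 / 2} (\<lambda>s. cis (c * s))" by (intro continuous_intros)
  qed simp
  also have "cis (c * (- 1 / 2)) = cis (c * (1 / 2))"
  proof -
    have "cis (c * (1 / 2)) = cis (c * (- 1 / 2)) * cis (2 * pi * of_int q)"
      unfolding cis_mult by (simp add: c_def)
    moreover have "cis (2 * pi * of_int q) = 1" by (rule cis_multiple_2pi) simp
    ultimately show ?thesis by simp
  qed
  finally show ?thesis using False by (simp add: c_def)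
qed

text \<open>The mean of the squared modulus of g minus its partial sum P is nonnegative. By
  orthogonality the two cross terms and the square of P all have the same mean, the sum of the
  squared coefficients.\<close>

lemma bessel_inequality:
  assumes g: "g \<in> borel_measurable borel" and K: "\<And>s. s \<in> {- 1 / 2..1 / 2} \<Longrightarrow> norm (g s) \<le> K"
    and A: "finite A"
  shows "(\<Sum>q\<in>A. (norm (fourier_coeff g q))\<^sup>2) \<le> K\<^sup>2"
proof -
  interpret prob_space unit_period by (rule prob_space_unit_period)
  note [measurable] = g
  have "norm (g 0) \<le> K" by (rule K) simp
  then have K0: "0 \<le> K" by (meson norm_ge_zero order_trans)
  define E where "E q s = cis (2 * pi * of_int q * s)" for q :: int and s :: real
  have [measurable]: "E q \<in> borel_measurable borel" for q unfolding E_def by measurable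
  have nE: "norm (E q s) = 1" "cnj (E q s) = E (- q) s" for q s by (simp_all add: E_def cis_cnj)
  have EE: "E q s * E r s = E (q + r) s" for q r s by (simp add: E_def cis_mult algebra_simps)
  have intE: "(LINT s|unit_period. E q s) = (if q = 0 then 1 else 0)" for q
    unfolding E_def by (rule integral_cis)
  define G where "G = fourier_coeff g"
  have G: "G q = (LINT s|unit_period. g s * E (- q) s)" for q
    by (simp add: G_def fourier_coeff_def E_def)
  define P where "P s = (\<Sum>q\<in>A. G q * E q s)" for s
  have [measurable]: "P \<in> borel_measurable borel" unfolding P_def by measurable
  have igE: "integrable unit_period (\<lambda>s. g s * E q s)" for q
    by (rule integrable_unit_period[where K = K]) (use K in \<open>auto simp: norm_mult nE\<close>)
  have iE: "integrable unit_period (E q)" for q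
    by (rule integrable_unit_period[where K = 1]) (auto simp: nE)
  have igg: "integrable unit_period (\<lambda>s. g s * cnj (g s))"
    by (rule integrable_unit_period[where K = "K * K"])
      (use K K0 in \<open>simp_all add: norm_mult mult_mono\<close>)
  have gP: "(\<lambda>s. g s * cnj (P s)) = (\<lambda>s. \<Sum>q\<in>A. cnj (G q) * (g s * E (- q) s))"
    by (auto simp: P_def nE sum_distrib_left mult_ac)
  have igP: "integrable unit_period (\<lambda>s. g s * cnj (P s))"
    unfolding gP by (intro Bochner_Integration.integrable_sum integrable_mult_right igE)
  have vgP: "(LINT s|unit_period. g s * cnj (P s)) = (\<Sum>q\<in>A. cnj (G q) * G q)"
    unfolding gP by (subst Bochner_Integration.integral_sum) (auto intro!: igE simp: G)
  have iPg: "integrable unit_period (\<lambda>s. cnj (g s * cnj (P s)))"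
    by (rule Bochner_Integration.integrable_cnj[OF igP])
  have vPg: "(LINT s|unit_period. cnj (g s * cnj (P s))) = (\<Sum>q\<in>A. cnj (G q) * G q)"
    unfolding Bochner_Integration.integral_cnj vgP by (simp add: mult.commute)
  have PP: "(\<lambda>s. P s * cnj (P s)) = (\<lambda>s. \<Sum>q\<in>A. \<Sum>r\<in>A. (G q * cnj (G r)) * E (q - r) s)"
  proof
    fix s
    have "G q * E q s * cnj (G r * E r s) = (G q * cnj (G r)) * E (q - r) s" for q r
      using EE[of q s "- r"] by (simp add: nE mult_ac)
    then show "P s * cnj (P s) = (\<Sum>q\<in>A. \<Sum>r\<in>A. (G q * cnj (G r)) * E (q - r) s)"
      by (simp only: P_def cnj_sum sum_product)
  qed
  have iPP: "integrable unit_period (\<lambda>s. P s * cnj (P s))"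
    unfolding PP by (intro Bochner_Integration.integrable_sum integrable_mult_right iE)
  have vPP: "(LINT s|unit_period. P s * cnj (P s)) = (\<Sum>q\<in>A. cnj (G q) * G q)"
  proof -
    have "(LINT s|unit_period. P s * cnj (P s)) = (\<Sum>q\<in>A. \<Sum>r\<in>A. (G q * cnj (G r)) * (if q - r = 0 then 1 else 0))"
      unfolding PP by (simp only: Bochner_Integration.integral_sum Bochner_Integration.integrable_sum
          integrable_mult_right iE integral_mult_right_zero intE)
    also have "\<dots> = (\<Sum>q\<in>A. \<Sum>r\<in>A. if r = q then G q * cnj (G r) else 0)"
      by (intro sum.cong) auto
    finally show ?thesis using A by (simp add: mult.commute)
  qed
  have "(LINT s|unit_period. (g s - P s) * cnj (g s - P s))
      = (LINT s|unit_period. (g s * cnj (g s) + P s * cnj (P s)) - (g s * cnj (P s) + cnj (g s * cnj (P s))))"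
    by (intro Bochner_Integration.integral_cong) (auto simp: algebra_simps)
  also have "\<dots> = (LINT s|unit_period. g s * cnj (g s)) - (\<Sum>q\<in>A. cnj (G q) * G q)"
    by (subst Bochner_Integration.integral_diff Bochner_Integration.integral_add
        | intro Bochner_Integration.integrable_add igg iPP igP iPg)+ (simp only: vPP vgP vPg, simp)
  finally have *: "(LINT s|unit_period. (g s - P s) * cnj (g s - P s))
      = (LINT s|unit_period. g s * cnj (g s)) - (\<Sum>q\<in>A. cnj (G q) * G q)" .
  have sq: "x * cnj x = complex_of_real ((norm x)\<^sup>2)" for x
    by (simp only: complex_norm_square)
  have "0 \<le> (LINT s|unit_period. (norm (g s - P s))\<^sup>2)" by simp
  also have "\<dots> = (LINT s|unit_period. (norm (g s))\<^sup>2) - (\<Sum>q\<in>A. (norm (G q))\<^sup>2)"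
  proof -
    have "complex_of_real (LINT s|unit_period. (norm (g s - P s))\<^sup>2)
       = complex_of_real ((LINT s|unit_period. (norm (g s))\<^sup>2) - (\<Sum>q\<in>A. (norm (G q))\<^sup>2))"
      using *[unfolded mult.commute[of "cnj (G _)"]] unfolding sq by (simp only: integral_complex_of_real of_real_diff of_real_sum)
    then show ?thesis by (simp only: of_real_eq_iff)
  qed
  finally have "(\<Sum>q\<in>A. (norm (G q))\<^sup>2) \<le> (LINT s|unit_period. (norm (g s))\<^sup>2)" by simp
  also have "\<dots> \<le> (LINT s|unit_period. K\<^sup>2)"
  proof (rule integral_mono)
    show "integrable unit_period (\<lambda>s. (norm (g s))\<^sup>2)"
      using integrable_norm[OF igg] by (simp add: norm_mult power2_eq_square)
  qed (use K in \<open>auto intro!: power_mono\<close>)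
  finally show ?thesis by (simp add: G_def prob_space[simplified])
qed

text \<open>Square summability, from Bessel's inequality, forces decay along every enumeration of
  frequencies without repetition. Two enumerations, one towards each infinity, will be used.\<close>

lemma riemann_lebesgue:
  assumes "g \<in> borel_measurable borel" "\<And>s. s \<in> {- 1 / 2..1 / 2} \<Longrightarrow> norm (g s) \<le> K" "inj h"
  shows "(\<lambda>n::nat. fourier_coeff g (h n)) \<longlonglongrightarrow> 0"
proof -
  have "summable (\<lambda>n. (norm (fourier_coeff g (h n)))\<^sup>2)"
  proof (rule bounded_imp_summable)
    show "(\<Sum>i\<le>n. (norm (fourier_coeff g (h i)))\<^sup>2) \<le> K\<^sup>2" for n
    proof -
      have "inj_on h {..n}" using assms(3) by (rule inj_on_subset) simp
      then have "(\<Sum>i\<le>n. (norm (fourier_coeff g (h i)))\<^sup>2) = (\<Sum>q\<in>h ` {..n}. (norm (fourier_coeff g q))\<^sup>2)"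
        by (simp add: sum.reindex)
      also have "\<dots> \<le> K\<^sup>2" by (rule bessel_inequality[OF assms(1,2)]) auto
      finally show ?thesis .
    qed
  qed simp
  then have "(\<lambda>n. (norm (fourier_coeff g (h n)))\<^sup>2) \<longlonglongrightarrow> 0" by (rule summable_LIMSEQ_zero)
  then have "(\<lambda>n. sqrt ((norm (fourier_coeff g (h n)))\<^sup>2)) \<longlonglongrightarrow> sqrt 0" by (rule tendsto_real_sqrt)
  then show ?thesis by (simp add: tendsto_norm_zero_iff)
qed

text \<open>The chord has length \<open>2 * \<bar>sin (pi * t)\<bar>\<close>. The argument of the
  sine is at most 8 / 5 in modulus, and there the cubic Taylor error takes away no more than half of
  it.\<close>

lemma norm_cis_minus_one: "\<bar>t\<bar> \<le> 1 / 2 \<Longrightarrow> \<bar>t\<bar> \<le> norm (cis (2 * pi * t) - 1)"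
proof -
  assume t: "\<bar>t\<bar> \<le> 1 / 2"
  define x where "x = pi * t"
  have *: "\<bar>sin x - (\<Sum>m<3. sin_coeff m * x ^ m)\<bar> \<le> inverse (fact 3) * \<bar>x\<bar> ^ 3"
    by (rule Maclaurin_sin_bound)
  then have 1: "\<bar>sin x - x\<bar> \<le> \<bar>x\<bar> ^ 3 / 6"
  proof -
    have a: "(\<Sum>m<3. sin_coeff m * x ^ m) = x" by (simp add: numeral_3_eq_3 sin_coeff_def)
    have b: "inverse (fact 3 :: real) = 1 / 6" by (simp add: fact_numeral)
    show ?thesis using * unfolding a b by simp
  qed
  have px: "\<bar>x\<bar> \<le> 8 / 5"
  proof -
    have "\<bar>x\<bar> = pi * \<bar>t\<bar>" by (simp add: x_def abs_mult)
    also have "\<dots> \<le> 16 / 5 * (1 / 2)" using t pi_less_4 pi_approx(2) by (intro mult_mono) auto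
    finally show ?thesis by simp
  qed
  have "\<bar>x\<bar> ^ 3 / 6 \<le> \<bar>x\<bar> / 2"
  proof -
    have "\<bar>x\<bar>\<^sup>2 \<le> (8 / 5)\<^sup>2" using px by (intro power_mono) auto
    then have "\<bar>x\<bar>\<^sup>2 \<le> 3" by (simp add: power2_eq_square)
    then have "\<bar>x\<bar> * \<bar>x\<bar>\<^sup>2 \<le> \<bar>x\<bar> * 3" by (intro mult_left_mono) auto
    then show ?thesis by (simp add: power3_eq_cube power2_eq_square)
  qed
  then have 2: "\<bar>x\<bar> / 2 \<le> \<bar>sin x\<bar>" using 1 by linarith
  have "cis (2 * pi * t) - 1 = cis x * (2 * \<i> * of_real (sin x))"
  proof -
    have "cis (2 * pi * t) = cis x * cis x" by (simp add: cis_mult x_def mult.assoc)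
    moreover have "cis x * cnj (cis x) = 1" by (simp add: cis_cnj cis_mult)
    ultimately have "cis (2 * pi * t) - 1 = cis x * cis x - cis x * cnj (cis x)" by simp
    moreover have "cis x - cnj (cis x) = 2 * \<i> * of_real (sin x)"
      by (auto simp: complex_eq_iff)
    ultimately show ?thesis by (simp only: right_diff_distrib[symmetric])
  qed
  then have "norm (cis (2 * pi * t) - 1) = 2 * \<bar>sin x\<bar>" by (simp add: norm_mult)
  also have "\<dots> \<ge> \<bar>x\<bar>" using 2 by simp
  moreover have "\<bar>x\<bar> \<ge> \<bar>t\<bar>"
    using mult_right_mono[of 1 pi "\<bar>t\<bar>"] pi_gt3 by (simp add: x_def abs_mult)
  ultimately show ?thesis by linarith
qed

lemma dirichlet_telescope:
  "(\<Sum>q\<in>{- int Q..int Q}. cis (- 2 * pi * of_int q * t)) * (cis (2 * pi * t) - 1)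
    = cis (2 * pi * of_int (int Q + 1) * t) - cis (- 2 * pi * of_int (int Q) * t)"
proof (induction Q)
  case 0
  show ?case by simp
next
  case (Suc Q)
  have set: "{- int (Suc Q)..int (Suc Q)} = insert (- int (Suc Q)) (insert (int (Suc Q)) {- int Q..int Q})"
    by auto
  have e: "cis (x * t) * (cis (2 * pi * t) - 1) = cis (x * t + 2 * pi * t) - cis (x * t)" for x
    by (simp add: right_diff_distrib cis_mult)
  have "(\<Sum>q\<in>{- int (Suc Q)..int (Suc Q)}. cis (- 2 * pi * of_int q * t)) * (cis (2 * pi * t) - 1)
     = cis (- 2 * pi * of_int (- int (Suc Q)) * t) * (cis (2 * pi * t) - 1)
     + (cis (- 2 * pi * of_int (int (Suc Q)) * t) * (cis (2 * pi * t) - 1)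
     + (\<Sum>q\<in>{- int Q..int Q}. cis (- 2 * pi * of_int q * t)) * (cis (2 * pi * t) - 1))"
    unfolding set by (simp add: distrib_right)
  also have "\<dots> = cis (2 * pi * of_int (int (Suc Q) + 1) * t) - cis (- 2 * pi * of_int (int (Suc Q)) * t)"
    unfolding e Suc.IH by (simp add: algebra_simps)
  finally show ?case .
qed

text \<open>The quotient \<open>(f s - f z) / (cis (2 * pi * (s - z)) - 1)\<close> is bounded, and multiplication by
  its denominator makes the symmetric partial sums telescope.\<close>

lemma fourier_inversion:
  fixes f :: "real \<Rightarrow> real"
  assumes lip: "\<And>s t. \<bar>f s - f t\<bar> \<le> L * \<bar>s - t\<bar>" and f0: "f (1 / 2) = 0" "f (- 1 / 2) = 0"
    and z: "\<bar>z\<bar> \<le> 1 / 2"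
  shows "(\<lambda>Q. \<Sum>q\<in>{- int Q..int Q}. fourier_coeff (\<lambda>s. of_real (f s)) q * cis (2 * pi * of_int q * z))
          \<longlonglongrightarrow> of_real (f z)"
proof -
  interpret prob_space unit_period by (rule prob_space_unit_period)
  have L0: "0 \<le> L" using lip[of 1 0] by simp
  have "L-lipschitz_on UNIV f" using lip L0 by (intro lipschitz_onI) (auto simp: dist_real_def)
  then have [measurable]: "f \<in> borel_measurable borel"
    using lipschitz_on_continuous_on borel_measurable_continuous_onI by blast
  define g where "g s = (complex_of_real (f s) - of_real (f z)) / (cis (2 * pi * (s - z)) - 1)" for s
  have [measurable]: "g \<in> borel_measurable borel" unfolding g_def by measurable
  have num: "\<bar>f s - f z\<bar> \<le> L * norm (cis (2 * pi * (s - z)) - 1)" if s: "s \<in> {- 1 / 2..1 / 2}" for s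
  proof -
    \<comment> \<open>\<open>norm_cis_minus_one\<close> needs a difference of at most 1 / 2.
      Otherwise s and z are close across the end of the period: shift by 1 and pass through the end
      points, where f vanishes.\<close>
    consider "\<bar>s - z\<bar> \<le> 1 / 2" | "s - z > 1 / 2" | "z - s > 1 / 2" by linarith
    then show ?thesis
    proof cases
      case 1
      have "L * \<bar>s - z\<bar> \<le> L * norm (cis (2 * pi * (s - z)) - 1)"
        by (intro mult_left_mono norm_cis_minus_one 1 L0)
      then show ?thesis using lip[of s z] by linarith
    next
      case 2
      have per: "cis (2 * pi * (s - z)) = cis (2 * pi * (s - z - 1))"
      proof -
        have "cis (2 * pi * (s - z)) = cis (2 * pi * (s - z - 1)) * cis (2 * pi)"
          by (simp add: cis_mult algebra_simps)
        then show ?thesis by simp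
      qed
      have "\<bar>f s - f z\<bar> \<le> \<bar>f s - f (1 / 2)\<bar> + \<bar>f (- 1 / 2) - f z\<bar>" using f0 by simp
      also have "\<dots> \<le> L * \<bar>s - 1 / 2\<bar> + L * \<bar>- 1 / 2 - z\<bar>" by (intro add_mono lip)
      also have "\<dots> = L * \<bar>s - z - 1\<bar>"
      proof -
        have "\<bar>s - 1 / 2\<bar> + \<bar>- 1 / 2 - z\<bar> = \<bar>s - z - 1\<bar>" using s z by (auto simp: abs_le_iff)
        then show ?thesis by (simp only: distrib_left[symmetric])
      qed
      also have "\<dots> \<le> L * norm (cis (2 * pi * (s - z)) - 1)"
        unfolding per using s z 2 by (intro mult_left_mono norm_cis_minus_one L0) auto
      finally show ?thesis .
    next
      case 3
      have per: "cis (2 * pi * (s - z)) = cis (2 * pi * (s - z + 1))"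
      proof -
        have "cis (2 * pi * (s - z + 1)) = cis (2 * pi * (s - z)) * cis (2 * pi)"
          by (simp add: cis_mult algebra_simps)
        then show ?thesis by simp
      qed
      have "\<bar>f s - f z\<bar> \<le> \<bar>f s - f (- 1 / 2)\<bar> + \<bar>f (1 / 2) - f z\<bar>" using f0 by simp
      also have "\<dots> \<le> L * \<bar>s - - 1 / 2\<bar> + L * \<bar>1 / 2 - z\<bar>" by (intro add_mono lip)
      also have "\<dots> = L * \<bar>s - z + 1\<bar>"
      proof -
        have "\<bar>s - - 1 / 2\<bar> + \<bar>1 / 2 - z\<bar> = \<bar>s - z + 1\<bar>" using s z by (auto simp: abs_le_iff)
        then show ?thesis by (simp only: distrib_left[symmetric])
      qed
      also have "\<dots> \<le> L * norm (cis (2 * pi * (s - z)) - 1)"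
        unfolding per using s z 3 by (intro mult_left_mono norm_cis_minus_one L0) auto
      finally show ?thesis .
    qed
  qed
  have gb: "norm (g s) \<le> L" if s: "s \<in> {- 1 / 2..1 / 2}" for s
  proof (cases "cis (2 * pi * (s - z)) - 1 = 0")
    case False
    have "norm (complex_of_real (f s) - of_real (f z)) = \<bar>f s - f z\<bar>"
      by (metis norm_of_real of_real_diff)
    then show ?thesis using num[OF s] False by (simp add: g_def norm_divide divide_le_eq)
  qed (simp add: g_def L0)
  \<comment> \<open>Where the denominator vanishes, \<open>num\<close> makes the numerator vanish
    too, so the default quotient 0 is consistent.\<close>
  have geq: "g s * (cis (2 * pi * (s - z)) - 1) = of_real (f s) - of_real (f z)" if s: "s \<in> {- 1 / 2..1 / 2}" for s
    using num[OF s] by (cases "cis (2 * pi * (s - z)) - 1 = 0") (auto simp: g_def)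
  define F where "F = (\<lambda>s. complex_of_real (f s))"
  have Fm [measurable]: "F \<in> borel_measurable borel" unfolding F_def by measurable
  have Fb: "norm (F s) \<le> L" if "s \<in> {- 1 / 2..1 / 2}" for s
  proof -
    have "\<bar>f s\<bar> \<le> L * \<bar>s - 1 / 2\<bar>" using lip[of s "1 / 2"] f0 by simp
    also have "\<dots> \<le> L * 1" using that L0 by (intro mult_left_mono) auto
    finally show ?thesis by (simp add: F_def)
  qed
  have iF: "integrable unit_period (\<lambda>s. F s * cis (c * s))" for c
    by (rule integrable_unit_period[where K = L]) (use Fb in \<open>auto simp: norm_mult\<close>)
  have ig: "integrable unit_period (\<lambda>s. g s * cis (c * s))" for c
    by (rule integrable_unit_period[where K = L]) (use gb in \<open>auto simp: norm_mult\<close>)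
  have ic: "integrable unit_period (\<lambda>s. cis (c * s))" for c
    by (rule integrable_unit_period[where K = 1]) auto
  define E where "E q = cis (2 * pi * of_int q * z)" for q :: int
  have split: "cis (- 2 * pi * of_int q * (s - z)) = cis (- 2 * pi * of_int q * s) * E q" for q s
    by (simp add: E_def cis_mult algebra_simps)
  have coeff_term: "fourier_coeff F q * E q - (if q = 0 then of_real (f z) else 0)
      = (LINT s|unit_period. (F s - of_real (f z)) * cis (- 2 * pi * of_int q * (s - z)))" for q
  proof -
    have "(LINT s|unit_period. (F s - of_real (f z)) * cis (- 2 * pi * of_int q * (s - z)))
        = (LINT s|unit_period. E q * (F s * cis (- 2 * pi * of_int q * s))
            - of_real (f z) * E q * cis (- 2 * pi * of_int q * s))"
      by (intro Bochner_Integration.integral_cong refl) (simp only: split, simp add: algebra_simps)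
    also have "\<dots> = E q * fourier_coeff F q - of_real (f z) * E q * (LINT s|unit_period. cis (- 2 * pi * of_int q * s))"
      by (subst Bochner_Integration.integral_diff, intro integrable_mult_right iF,
          intro integrable_mult_right ic) (simp add: fourier_coeff_def)
    also have "(LINT s|unit_period. cis (- 2 * pi * of_int q * s)) = (if q = 0 then 1 else 0)"
      using integral_cis[of "- q"] by simp
    finally show ?thesis by (simp add: E_def mult.commute)
  qed
  \<comment> \<open>The constant \<open>f z\<close> has only a zeroth coefficient, so it can be
    subtracted inside the integrals. Factoring through g then leaves just two coefficients of g, at
    high frequencies.\<close>
  have ps: "(\<Sum>q\<in>{- int Q..int Q}. fourier_coeff F q * E q) - of_real (f z)
      = fourier_coeff g (- int Q - 1) * cis (- 2 * pi * of_int (int Q + 1) * z)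
        - fourier_coeff g (int Q) * cis (2 * pi * of_int (int Q) * z)" for Q
  proof -
    have "(\<Sum>q\<in>{- int Q..int Q}. fourier_coeff F q * E q) - of_real (f z)
        = (\<Sum>q\<in>{- int Q..int Q}. fourier_coeff F q * E q - (if q = 0 then of_real (f z) else 0))"
      by (simp add: sum_subtractf)
    also have "\<dots> = (\<Sum>q\<in>{- int Q..int Q}. (LINT s|unit_period. (F s - of_real (f z)) * cis (- 2 * pi * of_int q * (s - z))))"
      by (simp only: coeff_term)
    also have "\<dots> = (LINT s|unit_period. (\<Sum>q\<in>{- int Q..int Q}. (F s - of_real (f z)) * cis (- 2 * pi * of_int q * (s - z))))"
    proof (rule Bochner_Integration.integral_sum[symmetric])
      show "integrable unit_period (\<lambda>s. (F s - of_real (f z)) * cis (- 2 * pi * of_int q * (s - z)))" for q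
      proof (rule integrable_unit_period[where K = "L + L"])
        fix s :: real assume s: "s \<in> {- 1 / 2..1 / 2}"
        show "norm ((F s - complex_of_real (f z)) * cis (- 2 * pi * of_int q * (s - z))) \<le> L + L"
        proof -
          have "z \<in> {- 1 / 2..1 / 2}" using z by auto
          then have "norm (F s - F z) \<le> L + L"
            using norm_triangle_ineq4[of "F s" "F z"] Fb[OF s] Fb[of z] by linarith
          then show ?thesis by (simp add: norm_mult F_def)
        qed
      qed measurable
    qed
    also have "\<dots> = (LINT s|unit_period. g s * cis (2 * pi * of_int (int Q + 1) * s) * cis (- 2 * pi * of_int (int Q + 1) * z)
        - g s * cis (- 2 * pi * of_int (int Q) * s) * cis (2 * pi * of_int (int Q) * z))"
    proof (rule Bochner_Integration.integral_cong[OF refl])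
      fix s assume "s \<in> space unit_period"
      then have s: "s \<in> {- 1 / 2..1 / 2}" by simp
      have "(\<Sum>q\<in>{- int Q..int Q}. (F s - of_real (f z)) * cis (- 2 * pi * of_int q * (s - z)))
          = g s * ((\<Sum>q\<in>{- int Q..int Q}. cis (- 2 * pi * of_int q * (s - z))) * (cis (2 * pi * (s - z)) - 1))"
        unfolding sum_distrib_left[symmetric] F_def geq[OF s, symmetric] by (simp only: mult_ac)
      also have "\<dots> = g s * (cis (2 * pi * of_int (int Q + 1) * (s - z)) - cis (- 2 * pi * of_int (int Q) * (s - z)))"
        by (simp only: dirichlet_telescope)
      also have "cis (2 * pi * of_int (int Q + 1) * (s - z))
          = cis (2 * pi * of_int (int Q + 1) * s) * cis (- 2 * pi * of_int (int Q + 1) * z)"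
        by (simp add: cis_mult algebra_simps)
      also have "cis (- 2 * pi * of_int (int Q) * (s - z))
          = cis (- 2 * pi * of_int (int Q) * s) * cis (2 * pi * of_int (int Q) * z)"
        by (simp add: cis_mult algebra_simps)
      finally show "(\<Sum>q\<in>{- int Q..int Q}. (F s - of_real (f z)) * cis (- 2 * pi * of_int q * (s - z)))
          = g s * cis (2 * pi * of_int (int Q + 1) * s) * cis (- 2 * pi * of_int (int Q + 1) * z)
        - g s * cis (- 2 * pi * of_int (int Q) * s) * cis (2 * pi * of_int (int Q) * z)"
        by (simp only: right_diff_distrib mult.assoc)
    qed
    also have "\<dots> = fourier_coeff g (- int Q - 1) * cis (- 2 * pi * of_int (int Q + 1) * z)
        - fourier_coeff g (int Q) * cis (2 * pi * of_int (int Q) * z)"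
    proof -
      have fc: "fourier_coeff g (- int Q - 1) = (LINT s|unit_period. g s * cis (2 * pi * of_int (int Q + 1) * s))"
        by (simp add: fourier_coeff_def algebra_simps)
      show ?thesis
        unfolding fc unfolding fourier_coeff_def
        by (subst Bochner_Integration.integral_diff, intro integrable_mult_left ig,
            intro integrable_mult_left ig) (simp only: integral_mult_left_zero)
    qed
    finally show ?thesis .
  qed
  have lim: "(\<lambda>Q. fourier_coeff g (h Q) * cis (c Q)) \<longlonglongrightarrow> 0" if "inj h" for h :: "nat \<Rightarrow> int" and c
  proof (rule tendsto_norm_zero_cancel)
    show "(\<lambda>Q. norm (fourier_coeff g (h Q) * cis (c Q))) \<longlonglongrightarrow> 0"
      using tendsto_norm_zero[OF riemann_lebesgue[OF _ gb that]] by (simp add: norm_mult)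
  qed
  have "(\<lambda>Q. fourier_coeff g (- int Q - 1) * cis (- 2 * pi * of_int (int Q + 1) * z)
        - fourier_coeff g (int Q) * cis (2 * pi * of_int (int Q) * z)) \<longlonglongrightarrow> 0 - 0"
    by (intro tendsto_diff lim) (auto simp: inj_on_def)
  then have "(\<lambda>Q. (\<Sum>q\<in>{- int Q..int Q}. fourier_coeff F q * E q) - of_real (f z)) \<longlonglongrightarrow> 0"
    by (simp only: ps diff_0_right)
  then show ?thesis unfolding LIM_zero_iff F_def E_def .
qed

section \<open>Fourier coefficients of rescaled bump functions\<close>

lemma cis_has_vector_derivative:
  "((\<lambda>s. cis (c * s)) has_vector_derivative \<i> * of_real c * cis (c * s)) (at s within S)"
proof -
  have "((\<lambda>w. exp (\<i> * of_real c * w)) has_field_derivative \<i> * of_real c * exp (\<i> * of_real c * of_real s)) (at (of_real s))"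
    by (auto intro!: derivative_eq_intros)
  from has_vector_derivative_real_field[OF this] show ?thesis
    by (simp add: cis_conv_exp mult.assoc)
qed

lemma integral_interval_bound:
  fixes h :: "real \<Rightarrow> complex"
  assumes "continuous_on {- \<delta>..\<delta>} h" "0 < \<delta>" "\<And>s. s \<in> {- \<delta>..\<delta>} \<Longrightarrow> norm (h s) \<le> K"
  shows "norm (LINT s|lborel. indicator {- \<delta>..\<delta>} s *\<^sub>R h s) \<le> 2 * \<delta> * K"
proof -
  have "norm (LINT s|lborel. indicator {- \<delta>..\<delta>} s *\<^sub>R h s)
      \<le> (LINT s|lborel. norm (indicator {- \<delta>..\<delta>} s *\<^sub>R h s))"
    by (rule integral_norm_bound)
  also have "\<dots> \<le> (LINT s|lborel. indicator {- \<delta>..\<delta>} s *\<^sub>R K)"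
  proof (rule integral_mono)
    show "integrable lborel (\<lambda>s. norm (indicator {- \<delta>..\<delta>} s *\<^sub>R h s))"
      using assms(1) by (intro integrable_norm borel_integrable_compact) auto
    show "integrable lborel (\<lambda>s. indicator {- \<delta>..\<delta>} s *\<^sub>R K)"
      by (intro borel_integrable_compact) auto
  qed (use assms in \<open>auto split: split_indicator\<close>)
  also have "\<dots> = 2 * \<delta> * K" using assms(2) by simp
  finally show ?thesis .
qed

text \<open>Shared by both kinds of bump, so that they are treated once. Smoothness and support give
  the decay of the coefficients; nonnegativity and nonvanishing give the positive mass.\<close>

locale compact_bump =
  fixes w :: "real \<Rightarrow> real"
  assumes smooth: "smooth_real w" and supp: "\<And>x. 1 \<le> \<bar>x\<bar> \<Longrightarrow> w x = 0"
    and nonneg: "\<And>x. 0 \<le> w x" and le_one: "\<And>x. w x \<le> 1" and nonzero: "\<exists>x. w x \<noteq> 0"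
begin

definition "w1 = deriv w"
definition "w2 = deriv w1"

lemma deriv_w: "(w has_real_derivative w1 x) (at x)"
proof -
  have "((deriv ^^ 0) w) field_differentiable at x" using smooth unfolding smooth_real_def by blast
  then show ?thesis by (simp add: w1_def DERIV_deriv_iff_field_differentiable)
qed

lemma deriv_w1: "(w1 has_real_derivative w2 x) (at x)"
proof -
  have "((deriv ^^ 1) w) field_differentiable at x" using smooth unfolding smooth_real_def by blast
  then show ?thesis by (simp add: w1_def w2_def DERIV_deriv_iff_field_differentiable)
qed

lemma continuous_w2: "continuous_on S w2"
proof -
  have "((deriv ^^ 2) w) field_differentiable at x" for x using smooth unfolding smooth_real_def by blast
  then have "w2 field_differentiable at x" for x by (simp add: w1_def w2_def numeral_2_eq_2)
  then show ?thesis
    by (intro continuous_at_imp_continuous_on ballI field_differentiable_imp_continuous_at)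
qed

lemma continuous_w: "continuous_on S w"
  by (intro continuous_at_imp_continuous_on ballI DERIV_isCont[OF deriv_w])

lemma continuous_w1: "continuous_on S w1"
  by (intro continuous_at_imp_continuous_on ballI DERIV_isCont[OF deriv_w1])

text \<open>Where \<open>1 < \<bar>x\<bar>\<close> the function is locally zero; the end points
  follow from continuity of the derivative through one-sided limits. This removes the boundary terms
  when integrating by parts.\<close>

lemma w1_zero:
  assumes "1 \<le> \<bar>x\<bar>" shows "w1 x = 0"
proof -
  have z: "w1 x = 0" if "1 < \<bar>x\<bar>" for x
  proof -
    have "open {y::real. 1 < \<bar>y\<bar>}" by (intro open_Collect_less continuous_intros)
    then have "(w has_real_derivative 0) (at x)"
      by (rule has_field_derivative_transform_within_open[where f = "\<lambda>_. 0", OF DERIV_const])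
        (use that supp in auto)
    then show ?thesis by (rule DERIV_unique[OF deriv_w])
  qed
  have c: "isCont w1 y" for y by (rule DERIV_isCont[OF deriv_w1])
  have "w1 1 = 0"
  proof (rule tendsto_unique[of "at_right (1::real)" w1])
    show "(w1 \<longlongrightarrow> w1 1) (at_right 1)" using c[of 1] by (simp add: filterlim_at_split isCont_def)
    show "(w1 \<longlongrightarrow> 0) (at_right 1)"
      by (rule tendsto_eventually) (auto simp: eventually_at_right_field intro!: exI[of _ 2] z)
  qed simp
  moreover have "w1 (- 1) = 0"
  proof (rule tendsto_unique[of "at_left (- 1::real)" w1])
    show "(w1 \<longlongrightarrow> w1 (- 1)) (at_left (- 1))" using c[of "- 1"] by (simp add: filterlim_at_split isCont_def)
    show "(w1 \<longlongrightarrow> 0) (at_left (- 1))"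
      by (rule tendsto_eventually) (auto simp: eventually_at_left_field intro!: exI[of _ "- 2"] z)
  qed simp
  moreover have "1 < \<bar>x\<bar> \<or> x = 1 \<or> x = - 1" using assms by linarith
  ultimately show ?thesis using z[of x] by blast
qed

lemma lipschitz_bump:
  obtains L where "0 \<le> L" "\<And>s t. \<bar>w s - w t\<bar> \<le> L * \<bar>s - t\<bar>"
proof -
  have "bounded (w1 ` {- 1..1})"
    using continuous_w1 by (intro compact_imp_bounded compact_continuous_image) auto
  then obtain L where "\<forall>y\<in>w1 ` {- 1..1}. norm y \<le> L" unfolding bounded_iff by blast
  then have L: "\<bar>w1 x\<bar> \<le> L" if "x \<in> {- 1..1}" for x using that by auto
  have L0: "0 \<le> L" using L[of 0] by auto
  have b: "\<bar>w1 x\<bar> \<le> L" for x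
    using L[of x] w1_zero[of x] L0 by (cases "1 \<le> \<bar>x\<bar>") (auto simp: abs_if split: if_splits)
  have "norm (w s - w t) \<le> L * norm (s - t)" for s t
    by (rule field_differentiable_bound[of UNIV w w1])
      (use b deriv_w in \<open>auto intro: has_field_derivative_at_within\<close>)
  then show ?thesis using that L0 by auto
qed

lemma fourier_coeff_bump:
  assumes \<delta>: "0 < \<delta>" "\<delta> \<le> 1 / 2"
  shows "fourier_coeff (\<lambda>s. of_real (w (s / \<delta>))) q
    = (LINT s|lborel. indicator {- \<delta>..\<delta>} s *\<^sub>R (of_real (w (s / \<delta>)) * cis (- 2 * pi * of_int q * s)))"
proof -
  have "fourier_coeff (\<lambda>s. of_real (w (s / \<delta>))) q
    = (LINT s|lborel. indicator {- 1 / 2..1 / 2} s *\<^sub>R (of_real (w (s / \<delta>)) * cis (- 2 * pi * of_int q * s)))"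
    by (simp add: fourier_coeff_def unit_period_def integral_restrict_space)
  also have "\<dots> = (LINT s|lborel. indicator {- \<delta>..\<delta>} s *\<^sub>R (of_real (w (s / \<delta>)) * cis (- 2 * pi * of_int q * s)))"
  proof (rule Bochner_Integration.integral_cong[OF refl])
    fix s
    have "w (s / \<delta>) = 0" if "s \<notin> {- \<delta>..\<delta>}"
      using that \<delta> by (intro supp) (auto simp: abs_if field_simps)
    moreover have "{- \<delta>..\<delta>} \<subseteq> {- 1 / 2..1 / 2}" using \<delta> by auto
    ultimately show "indicator {- 1 / 2..1 / 2} s *\<^sub>R (complex_of_real (w (s / \<delta>)) * cis (- 2 * pi * of_int q * s))
       = indicator {- \<delta>..\<delta>} s *\<^sub>R (complex_of_real (w (s / \<delta>)) * cis (- 2 * pi * of_int q * s))"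
      by (cases "s \<in> {- \<delta>..\<delta>}") (auto simp: subset_iff)
  qed
  finally show ?thesis .
qed

text \<open>Two integrations by parts bound the coefficient by a multiple of
  \<open>1 / (\<delta> * q^2)\<close>, and the trivial bound is \<open>2 * \<delta>\<close>.
  Combined they give the Lorentzian of scale 1 / \<delta>, with a constant depending only on
  w.\<close>

lemma fourier_coeff_bump_bound:
  obtains C where "0 \<le> C" "\<And>\<delta> q. 0 < \<delta> \<Longrightarrow> \<delta> \<le> 1 / 2 \<Longrightarrow>
    norm (fourier_coeff (\<lambda>s. of_real (w (s / \<delta>))) q) \<le> C * \<delta> * lorentz (1 / \<delta>) q"
proof -
  have "bounded (w2 ` {- 1..1})"
    using continuous_w2 by (intro compact_imp_bounded compact_continuous_image) auto
  then obtain M where "\<forall>y\<in>w2 ` {- 1..1}. norm y \<le> M" unfolding bounded_iff by blast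
  then have M: "\<bar>w2 x\<bar> \<le> M" if "x \<in> {- 1..1}" for x using that by auto
  have M0: "0 \<le> M" using M[of 0] by auto
  have "norm (fourier_coeff (\<lambda>s. of_real (w (s / \<delta>))) q) \<le> (2 + M) * \<delta> * lorentz (1 / \<delta>) q"
    if \<delta>: "0 < \<delta>" "\<delta> \<le> 1 / 2" for \<delta> q
  proof -
    define c where "c = - 2 * pi * real_of_int q"
    define I where "I = fourier_coeff (\<lambda>s. of_real (w (s / \<delta>))) q"
    have I: "I = (LINT s|lborel. indicator {- \<delta>..\<delta>} s *\<^sub>R (of_real (w (s / \<delta>)) * cis (c * s)))"
      unfolding I_def c_def by (rule fourier_coeff_bump[OF \<delta>])
    have cw: "continuous_on {- \<delta>..\<delta>} (\<lambda>s. w (s / \<delta>))" "continuous_on {- \<delta>..\<delta>} (\<lambda>s. w2 (s / \<delta>))"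
      by (rule continuous_on_compose2[OF continuous_w[of UNIV]] continuous_on_compose2[OF continuous_w2[of UNIV]];
          use \<delta> in \<open>auto intro!: continuous_intros\<close>)+
    have "continuous_on {- \<delta>..\<delta>} (\<lambda>s. complex_of_real (w (s / \<delta>)) * cis (c * s))"
      by (intro continuous_intros cw)
    then have I1: "norm I \<le> 2 * \<delta>"
      unfolding I using integral_interval_bound[of \<delta> "\<lambda>s. of_real (w (s / \<delta>)) * cis (c * s)" 1] \<delta> nonneg le_one
      by (simp add: norm_mult)
    define u where "u s = complex_of_real (w2 (s / \<delta>) / \<delta>\<^sup>2) * cis (c * s)" for s
    define v where "v s = complex_of_real (w (s / \<delta>)) * cis (c * s)" for s
    \<comment> \<open>An antiderivative of \<open>u s + c^2 * v s\<close>: it merges both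
      integrations by parts into one use of the fundamental theorem, and it vanishes at both
      ends.\<close>
    define H where "H s = (complex_of_real (w1 (s / \<delta>) / \<delta>) - \<i> * c * complex_of_real (w (s / \<delta>))) * cis (c * s)" for s
    have cu: "continuous_on {- \<delta>..\<delta>} u"
      unfolding u_def by (intro continuous_intros cw) (use \<delta> in simp)
    have cv: "continuous_on {- \<delta>..\<delta>} v"
      unfolding v_def by (intro continuous_intros cw)
    have "(LINT s|lborel. indicator {- \<delta>..\<delta>} s *\<^sub>R (u s + of_real (c\<^sup>2) * v s)) = H \<delta> - H (- \<delta>)"
    proof (rule integral_FTC_atLeastAtMost)
      show "continuous_on {- \<delta>..\<delta>} (\<lambda>s. u s + of_real (c\<^sup>2) * v s)"
        using cu cv by (intro continuous_intros)
      fix s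
      have dd: "((\<lambda>s. s / \<delta>) has_real_derivative 1 / \<delta>) (at s)"
        using DERIV_cdivide[OF DERIV_ident, of \<delta> s UNIV] by simp
      have d0: "((\<lambda>s. w (s / \<delta>)) has_real_derivative w1 (s / \<delta>) / \<delta>) (at s)"
        using DERIV_chain2[OF deriv_w dd] by simp
      have d1: "((\<lambda>s. w1 (s / \<delta>) / \<delta>) has_real_derivative w2 (s / \<delta>) / \<delta>\<^sup>2) (at s)"
        using DERIV_cdivide[OF DERIV_chain2[OF deriv_w1 dd], of \<delta>] by (simp add: power2_eq_square)
      have e0: "((\<lambda>s. complex_of_real (w (s / \<delta>))) has_vector_derivative of_real (w1 (s / \<delta>) / \<delta>)) (at s within {- \<delta>..\<delta>})"
        by (intro has_vector_derivative_of_real has_vector_derivative_at_within) (use d0 in \<open>simp add: has_real_derivative_iff_has_vector_derivative\<close>)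
      have e1: "((\<lambda>s. complex_of_real (w1 (s / \<delta>) / \<delta>)) has_vector_derivative of_real (w2 (s / \<delta>) / \<delta>\<^sup>2)) (at s within {- \<delta>..\<delta>})"
        by (intro has_vector_derivative_of_real has_vector_derivative_at_within) (use d1 in \<open>simp add: has_real_derivative_iff_has_vector_derivative\<close>)
      have e: "((\<lambda>s. complex_of_real (w1 (s / \<delta>) / \<delta>) - \<i> * c * complex_of_real (w (s / \<delta>))) has_vector_derivative
          (of_real (w2 (s / \<delta>) / \<delta>\<^sup>2) - \<i> * c * of_real (w1 (s / \<delta>) / \<delta>))) (at s within {- \<delta>..\<delta>})"
        by (intro has_vector_derivative_diff e1 has_vector_derivative_mult_right e0)
      have "(H has_vector_derivative
          ((complex_of_real (w1 (s / \<delta>) / \<delta>) - \<i> * c * complex_of_real (w (s / \<delta>))) * (\<i> * of_real c * cis (c * s))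
          + (of_real (w2 (s / \<delta>) / \<delta>\<^sup>2) - \<i> * c * of_real (w1 (s / \<delta>) / \<delta>)) * cis (c * s))) (at s within {- \<delta>..\<delta>})"
        unfolding H_def by (rule has_vector_derivative_mult[OF e cis_has_vector_derivative])
      also have "(complex_of_real (w1 (s / \<delta>) / \<delta>) - \<i> * c * complex_of_real (w (s / \<delta>))) * (\<i> * of_real c * cis (c * s))
          + (of_real (w2 (s / \<delta>) / \<delta>\<^sup>2) - \<i> * c * of_real (w1 (s / \<delta>) / \<delta>)) * cis (c * s)
          = u s + of_real (c\<^sup>2) * v s"
        by (simp add: u_def v_def algebra_simps power2_eq_square)
      finally show "(H has_vector_derivative u s + of_real (c\<^sup>2) * v s) (at s within {- \<delta>..\<delta>})" .
    qed (use \<delta> in simp)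
    also have "\<dots> = 0" using \<delta> by (simp add: H_def supp w1_zero)
    also have "(LINT s|lborel. indicator {- \<delta>..\<delta>} s *\<^sub>R (u s + of_real (c\<^sup>2) * v s))
        = (LINT s|lborel. indicator {- \<delta>..\<delta>} s *\<^sub>R u s + of_real (c\<^sup>2) * (indicator {- \<delta>..\<delta>} s *\<^sub>R v s))"
      by (intro Bochner_Integration.integral_cong) (auto simp: scaleR_conv_of_real algebra_simps)
    also have "\<dots> = (LINT s|lborel. indicator {- \<delta>..\<delta>} s *\<^sub>R u s) + of_real (c\<^sup>2) * I"
    proof -
      have iu: "integrable lborel (\<lambda>s. indicator {- \<delta>..\<delta>} s *\<^sub>R u s)"
        and iv: "integrable lborel (\<lambda>s. indicator {- \<delta>..\<delta>} s *\<^sub>R v s)"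
        using cu cv by (auto intro: borel_integrable_compact)
      show ?thesis unfolding I v_def[symmetric]
        by (subst Bochner_Integration.integral_add[OF iu integrable_mult_right[OF iv]])
          (simp only: integral_mult_right_zero)
    qed
    finally have "of_real (c\<^sup>2) * I = - (LINT s|lborel. indicator {- \<delta>..\<delta>} s *\<^sub>R u s)"
      by (simp add: eq_neg_iff_add_eq_0 add.commute)
    then have "c\<^sup>2 * norm I = norm (LINT s|lborel. indicator {- \<delta>..\<delta>} s *\<^sub>R u s)"
      by (metis abs_power2 norm_minus_cancel norm_mult norm_of_real)
    also have "\<dots> \<le> 2 * \<delta> * (M / \<delta>\<^sup>2)"
    proof (rule integral_interval_bound[OF cu \<delta>(1)])
      fix s assume "s \<in> {- \<delta>..\<delta>}"
      then have "s / \<delta> \<in> {- 1..1}" using \<delta> by (auto simp: field_simps)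
      from M[OF this] show "norm (u s) \<le> M / \<delta>\<^sup>2"
        using \<delta> by (simp add: u_def norm_mult norm_divide norm_power divide_right_mono)
    qed
    finally have cI: "c\<^sup>2 * norm I \<le> 2 * M / \<delta>" using \<delta> by (simp add: power2_eq_square)
    have "(\<delta> * real_of_int q)\<^sup>2 * norm I \<le> \<delta> * M"
    proof -
      have "2 * (real_of_int q)\<^sup>2 \<le> c\<^sup>2"
      proof -
        have "1 \<le> pi\<^sup>2" using pi_gt3 by (intro one_le_power) auto
        then have "1 * (real_of_int q)\<^sup>2 \<le> pi\<^sup>2 * (real_of_int q)\<^sup>2" by (intro mult_right_mono) auto
        moreover have "c\<^sup>2 = 4 * (pi\<^sup>2 * (real_of_int q)\<^sup>2)" by (simp add: c_def power_mult_distrib)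
        moreover have "0 \<le> (real_of_int q)\<^sup>2" by simp
        ultimately show ?thesis by linarith
      qed
      then have "2 * (real_of_int q)\<^sup>2 * norm I \<le> 2 * M / \<delta>"
        using cI by (meson mult_right_mono norm_ge_zero order_trans)
      then have "\<delta>\<^sup>2 * ((real_of_int q)\<^sup>2 * norm I) \<le> \<delta>\<^sup>2 * (M / \<delta>)"
        by (intro mult_left_mono) auto
      then show ?thesis using \<delta> by (simp add: power_mult_distrib power2_eq_square mult_ac)
    qed
    then have "norm I * (1 + (\<delta> * real_of_int q)\<^sup>2) \<le> (2 + M) * \<delta>"
      using I1 by (simp add: algebra_simps)
    moreover have "0 < 1 + (\<delta> * real_of_int q)\<^sup>2" by (simp add: add_pos_nonneg)
    ultimately have "norm I \<le> (2 + M) * \<delta> / (1 + (\<delta> * real_of_int q)\<^sup>2)"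
      by (simp add: pos_le_divide_eq)
    then show ?thesis using \<delta> by (simp add: I_def lorentz_def mult.commute)
  qed
  then show ?thesis using that[of "2 + M"] M0 by auto
qed

definition mass :: real where
  "mass = (LINT s|lborel. indicator {- 1..1} s *\<^sub>R w s)"

lemma fourier_coeff_bump_zero:
  assumes \<delta>: "0 < \<delta>" "\<delta> \<le> 1 / 2"
  shows "fourier_coeff (\<lambda>s. of_real (w (s / \<delta>))) 0 = of_real (\<delta> * mass)"
proof -
  have "fourier_coeff (\<lambda>s. of_real (w (s / \<delta>))) 0
      = (LINT s|lborel. indicator {- \<delta>..\<delta>} s *\<^sub>R complex_of_real (w (s / \<delta>)))"
    unfolding fourier_coeff_bump[OF \<delta>] by simp
  also have "\<dots> = \<bar>\<delta>\<bar> *\<^sub>R (LINT s|lborel. indicator {- \<delta>..\<delta>} (0 + \<delta> * s) *\<^sub>R complex_of_real (w ((0 + \<delta> * s) / \<delta>)))"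
    using \<delta> by (intro lborel_integral_real_affine) auto
  also have "(\<lambda>s. indicator {- \<delta>..\<delta>} (0 + \<delta> * s) *\<^sub>R complex_of_real (w ((0 + \<delta> * s) / \<delta>)))
      = (\<lambda>s. complex_of_real (indicator {- 1..1} s *\<^sub>R w s))"
  proof
    fix s
    have "- \<delta> \<le> \<delta> * s \<longleftrightarrow> - 1 \<le> s" "\<delta> * s \<le> \<delta> \<longleftrightarrow> s \<le> 1"
      using \<delta> mult_le_cancel_left_pos[of \<delta> "- 1" s] mult_le_cancel_left_pos[of \<delta> s 1] by auto
    then show "indicator {- \<delta>..\<delta>} (0 + \<delta> * s) *\<^sub>R complex_of_real (w ((0 + \<delta> * s) / \<delta>))
      = complex_of_real (indicator {- 1..1} s *\<^sub>R w s)"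
      using \<delta> by (simp add: indicator_def)
  qed
  also have "(LINT s|lborel. complex_of_real (indicator {- 1..1} s *\<^sub>R w s)) = of_real mass"
    unfolding mass_def by (rule integral_complex_of_real)
  finally show ?thesis using \<delta> by (simp add: scaleR_conv_of_real)
qed

text \<open>Zero integral would make w vanish outside a null set, but the set where w is nonzero is
  open and nonempty. The mass later bounds the means of \<open>f n\<close> from below.\<close>

lemma mass_pos: "0 < mass"
proof -
  obtain x where x: "w x \<noteq> 0" using nonzero by blast
  have int: "integrable lborel (\<lambda>s. indicator {- 1..1} s *\<^sub>R w s)"
    using continuous_w by (intro borel_integrable_compact) auto
  have x1: "x \<in> {- 1<..<1}" using x supp[of x] by (cases "1 \<le> \<bar>x\<bar>") auto
  have "mass \<noteq> 0"
  proof
    assume "mass = 0"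
    then have "AE s in lborel. indicator {- 1..1} s *\<^sub>R w s = 0"
      unfolding mass_def using int nonneg by (subst (asm) integral_nonneg_eq_0_iff_AE) (auto simp: indicator_def)
    then have "AE s in lborel. s \<notin> {s. w s \<noteq> 0}"
      by eventually_elim (use supp in \<open>fastforce simp: indicator_def abs_if split: if_splits\<close>)
    moreover have op: "open {s. w s \<noteq> 0}"
      using continuous_w[of UNIV] by (intro open_Collect_neq) auto
    ultimately have "{s. w s \<noteq> 0} \<in> null_sets lborel"
      by (subst AE_iff_null_sets) auto
    then have "negligible {s. w s \<noteq> 0}"
      using negligible_iff_null_sets null_sets_completionI by blast
    then show False using op x open_not_negligible by blast
  qed
  moreover have "0 \<le> mass" unfolding mass_def using nonneg by (intro integral_nonneg_AE) (auto simp: indicator_def)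
  ultimately show ?thesis by simp
qed

end

section \<open>Characters on the unit cube\<close>

definition character :: "('k::finite \<Rightarrow> int) \<Rightarrow> real ^ 'k \<Rightarrow> complex" where
  "character v x = cis (2 * pi * (\<Sum>j\<in>UNIV. of_int (v j) * x $ j))"

lemma norm_character [simp]: "norm (character v x) = 1"
  by (simp add: character_def)

lemma character_add: "character v x * character v' x = character (\<lambda>j. v j + v' j) x"
  by (simp add: character_def cis_mult distrib_left[symmetric] sum.distrib[symmetric] distrib_right[symmetric])

lemma character_zero [simp]: "character (\<lambda>_. 0) x = 1"
  by (simp add: character_def)

lemma character_measurable: "character v \<in> borel_measurable borel"
  unfolding character_def by (intro borel_measurable_continuous_onI continuous_intros)

lemma integral_cis_unit:
  "(LINT t|lborel. indicator {0..1} t *\<^sub>R cis (2 * pi * of_int q * t)) = (if q = 0 then 1 else 0)"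
proof -
  have "(LINT t|lborel. indicator {0..1} t *\<^sub>R cis (2 * pi * of_int q * t))
    = \<bar>1\<bar> *\<^sub>R (LINT s|lborel. indicator {0..1} (1 / 2 + 1 * s) *\<^sub>R cis (2 * pi * of_int q * (1 / 2 + 1 * s)))"
    by (rule lborel_integral_real_affine) simp
  also have "(\<lambda>s. indicator {0..1} (1 / 2 + 1 * s) *\<^sub>R cis (2 * pi * of_int q * (1 / 2 + 1 * s)))
     = (\<lambda>s. cis (pi * of_int q) * (indicator {- 1 / 2..1 / 2} s *\<^sub>R cis (2 * pi * of_int q * s)))"
  proof
    fix s :: real
    have "cis (2 * pi * of_int q * (1 / 2 + 1 * s)) = cis (pi * of_int q) * cis (2 * pi * of_int q * s)"
      by (simp add: cis_mult algebra_simps)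
    moreover have "indicator {0..1} (1 / 2 + 1 * s) = (indicator {- 1 / 2..1 / 2} s :: real)"
      by (auto simp: indicator_def)
    ultimately show "indicator {0..1} (1 / 2 + 1 * s) *\<^sub>R cis (2 * pi * of_int q * (1 / 2 + 1 * s))
     = cis (pi * of_int q) * (indicator {- 1 / 2..1 / 2} s *\<^sub>R cis (2 * pi * of_int q * s))"
      by simp
  qed
  also have "(LINT s|lborel. cis (pi * of_int q) * (indicator {- 1 / 2..1 / 2} s *\<^sub>R cis (2 * pi * of_int q * s)))
      = cis (pi * of_int q) * (LINT s|unit_period. cis (2 * pi * of_int q * s))"
    unfolding unit_period_def by (subst integral_restrict_space, simp, simp only: integral_mult_right_zero)
  finally show ?thesis by (simp add: integral_cis)
qed

lemma unit_cube_borel [measurable]: "(unit_cube :: (real ^ 'k::finite) set) \<in> sets borel"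
proof -
  have "(unit_cube :: (real ^ 'k) set) = (\<Inter>j. {x. 0 \<le> x $ j} \<inter> {x. x $ j \<le> 1})"
    by (auto simp: unit_cube_def)
  moreover have "closed (\<Inter>j. {x :: real ^ 'k. 0 \<le> x $ j} \<inter> {x. x $ j \<le> 1})"
    by (intro closed_INT ballI closed_Int closed_Collect_le continuous_intros)
  ultimately show ?thesis using borel_closed by metis
qed

text \<open>\<open>lborel\<close> on vectors is the image of a product measure over the basis. The
  character and the indicator of the cube factor along it, and a single nonzero entry of v makes the
  product vanish.\<close>

lemma integral_character_cube:
  "(LINT x|lebesgue_cube. character v x) = (if v = (\<lambda>_. 0) then 1 else 0)"
proof -
  interpret product_sigma_finite "\<lambda>_. lborel :: real measure" by standard
  define V :: "real ^ 'a" where "V = (\<chi> j. of_int (v j))"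
  define h where "h b t = indicator {0..1} t *\<^sub>R cis (2 * pi * (V \<bullet> b) * t)" for b :: "real ^ 'a" and t :: real
  have "(LINT x|lebesgue_cube. character v x) = (LINT x|lborel. indicator unit_cube x *\<^sub>R character v x)"
    unfolding lebesgue_cube_def by (rule integral_restrict_space) simp
  also have "\<dots> = (LINT x|lborel. (\<Prod>b\<in>Basis. h b (x \<bullet> b)))"
  proof (rule Bochner_Integration.integral_cong[OF refl])
    fix x :: "real ^ 'a"
    have "(\<Sum>j\<in>UNIV. of_int (v j) * x $ j) = V \<bullet> x" by (simp add: V_def inner_vec_def)
    also have "\<dots> = (\<Sum>b\<in>Basis. (V \<bullet> b) * (x \<bullet> b))" by (rule euclidean_inner)
    finally have "character v x = cis (\<Sum>b\<in>Basis. 2 * pi * (V \<bullet> b) * (x \<bullet> b))"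
      by (simp add: character_def sum_distrib_left mult.assoc)
    also have "\<dots> = (\<Prod>b\<in>Basis. cis (2 * pi * (V \<bullet> b) * (x \<bullet> b)))"
      by (simp add: cis_conv_exp sum_distrib_left exp_sum)
    finally have "character v x = (\<Prod>b\<in>Basis. cis (2 * pi * (V \<bullet> b) * (x \<bullet> b)))" .
    moreover have "complex_of_real (indicator unit_cube x) = (\<Prod>b\<in>Basis. complex_of_real (indicator {0..1} (x \<bullet> b)))"
    proof (cases "x \<in> unit_cube")
      case True
      then have "x \<bullet> b \<in> {0..1}" if "b \<in> Basis" for b
        using that by (auto simp: Basis_vec_def unit_cube_def inner_axis)
      then show ?thesis using True by simp
    next
      case False
      then obtain j where "x \<bullet> axis j 1 \<notin> {0..1}" by (auto simp: unit_cube_def inner_axis)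
      moreover have "axis j 1 \<in> (Basis :: (real ^ 'a) set)" by (auto simp: Basis_vec_def)
      ultimately have "\<exists>b\<in>Basis. complex_of_real (indicator {0..1} (x \<bullet> b)) = 0" by (intro bexI[of _ "axis j 1"]) auto
      then show ?thesis using False by simp
    qed
    ultimately show "indicator unit_cube x *\<^sub>R character v x = (\<Prod>b\<in>Basis. h b (x \<bullet> b))"
      by (simp add: h_def scaleR_conv_of_real prod.distrib)
  qed
  also have "\<dots> = (LINT f|(\<Pi>\<^sub>M b\<in>Basis. lborel). (\<Prod>b\<in>Basis. h b ((\<Sum>b\<in>Basis. f b *\<^sub>R b) \<bullet> b)))"
  proof (subst lborel_eq, rule integral_distr)
    show "(\<lambda>x :: real ^ 'a. \<Prod>b\<in>Basis. h b (x \<bullet> b)) \<in> borel_measurable borel"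
      unfolding h_def by measurable
  qed measurable
  also have "\<dots> = (LINT f|(\<Pi>\<^sub>M b\<in>Basis. lborel). (\<Prod>b\<in>Basis. h b (f b)))"
    by (intro Bochner_Integration.integral_cong prod.cong refl) (simp add: inner_sum_left inner_Basis if_distrib cong: if_cong)
  also have "\<dots> = (\<Prod>b\<in>Basis. (LINT t|lborel. h b t))"
  proof (rule product_integral_prod)
    show "integrable lborel (h b)" for b
      unfolding h_def by (intro borel_integrable_compact continuous_intros) auto
  qed simp
  also have "\<dots> = (if v = (\<lambda>_. 0) then 1 else 0)"
  proof -
    have int: "(LINT t|lborel. h (axis j 1) t) = (if v j = 0 then 1 else 0)" for j
      using integral_cis_unit[of "v j"] by (simp add: h_def V_def inner_axis)
    show ?thesis
    proof (cases "v = (\<lambda>_. 0)")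
      case True
      then show ?thesis using int by (auto intro!: prod.neutral simp: Basis_vec_def)
    next
      case False
      then obtain j where "v j \<noteq> 0" by auto
      then have "\<exists>b\<in>Basis. (LINT t|lborel. h b t) = 0"
        using int[of j] by (intro bexI[of _ "axis j 1"]) (auto simp: Basis_vec_def)
      then show ?thesis using False by simp
    qed
  qed
  finally show ?thesis .
qed

text \<open>The total mass is read off from the trivial character. Since the real-valued
  \<open>measure\<close> of a set of infinite mass is 0, the value 1 also yields finiteness.\<close>

lemma prob_measure_lebesgue_cube: "prob_measure_on_cube (lebesgue_cube :: (real ^ 'k::finite) measure)"
  unfolding prob_measure_on_cube_def
proof
  have "(LINT x|(lebesgue_cube :: (real ^ 'k) measure). character (\<lambda>_. 0) x) = 1"
    by (subst integral_character_cube) simp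
  then have "measure (lebesgue_cube :: (real ^ 'k) measure) (space lebesgue_cube) = 1"
    by (simp add: scaleR_conv_of_real)
  moreover from this have "emeasure (lebesgue_cube :: (real ^ 'k) measure) (space lebesgue_cube) \<noteq> \<infinity>"
    by (metis enn2real_top infinity_ennreal_def measure_def zero_neq_one)
  ultimately have "emeasure (lebesgue_cube :: (real ^ 'k) measure) (space lebesgue_cube) = 1"
    by (simp add: emeasure_eq_ennreal_measure)
  then show "prob_space (lebesgue_cube :: (real ^ 'k) measure)" by (rule prob_spaceI)
  show "sets (lebesgue_cube :: (real ^ 'k) measure) = sets (restrict_space borel unit_cube)"
    by (simp add: lebesgue_cube_def sets_restrict_space)
qed

lemma space_prob_cube: "prob_measure_on_cube \<nu> \<Longrightarrow> space \<nu> = unit_cube"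
  using sets_eq_imp_space_eq[of \<nu> "restrict_space borel unit_cube"]
  by (simp add: prob_measure_on_cube_def space_restrict_space)

lemma measurable_prob_cube:
  assumes "prob_measure_on_cube \<nu>" "g \<in> borel_measurable borel"
  shows "g \<in> borel_measurable \<nu>"
proof -
  have "g \<in> borel_measurable (restrict_space borel unit_cube)"
    by (rule measurable_restrict_space1[OF assms(2)])
  then show ?thesis using assms(1) measurable_cong_sets unfolding prob_measure_on_cube_def by blast
qed

text \<open>The kernel \<open>inv_sq\<close> vanishes at \<open>0\<close>, where both measures have mass one.\<close>

lemma integral_character_decay:
  assumes \<mu>: "prob_measure_on_cube \<mu>"
    and dec: "\<And>\<xi>. norm (fourier_transform \<mu> \<xi>) \<le> C * (1 + norm \<xi>) powr (- 2)"
  shows "norm ((LINT x|\<mu>. character v x) - (LINT x|lebesgue_cube. character v x)) \<le> \<bar>C\<bar> * inv_sq v"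
proof (cases "v = (\<lambda>_. 0)")
  case True
  have "prob_space \<mu>" using \<mu> by (simp add: prob_measure_on_cube_def)
  then have "(LINT x|\<mu>. character v x) = 1" using True by (simp add: prob_space.prob_space)
  then show ?thesis using True integral_character_cube[of v] by (simp add: inv_sq_zero)
next
  case False
  define V :: "real ^ 'a" where "V = (\<chi> j. of_int (v j))"
  define m where "m = (MAX j. \<bar>v j\<bar>)"
  have "m \<in> range (\<lambda>j. \<bar>v j\<bar>)" unfolding m_def by (rule Max_in) auto
  then obtain j where j: "m = \<bar>v j\<bar>" by auto
  obtain i where "v i \<noteq> 0" using False by auto
  moreover have "\<bar>v i\<bar> \<le> m" unfolding m_def by (intro Max_ge) auto
  ultimately have m0: "0 < real_of_int m" by linarith
  have "\<bar>V $ j\<bar> \<le> norm V" by (rule component_le_norm_cart)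
  then have mV: "real_of_int m \<le> norm V" using j by (simp add: V_def)
  \<comment> \<open>The transform has the opposite sign in the exponent, hence the argument
    \<open>- V\<close>. The Euclidean norm of V then dominates the maximum norm m.\<close>
  have "(LINT x|\<mu>. character v x) = fourier_transform \<mu> (- V)"
    unfolding fourier_transform_def
    by (intro Bochner_Integration.integral_cong refl)
      (simp add: character_def cis_conv_exp V_def inner_vec_def sum_negf mult_ac)
  then have "norm ((LINT x|\<mu>. character v x) - (LINT x|lebesgue_cube. character v x)) \<le> C * (1 + norm V) powr (- 2)"
    using dec[of "- V"] False integral_character_cube[of v] by simp
  also have "\<dots> \<le> \<bar>C\<bar> * (1 + norm V) powr (- 2)" by (intro mult_right_mono) auto
  also have "(1 + norm V) powr (- 2) \<le> (real_of_int m) powr (- 2)"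
    using m0 mV by (intro powr_mono2') auto
  also have "\<dots> = inv_sq v"
    using m0 by (simp add: inv_sq_def m_def[symmetric] powr_minus powr_numeral divide_inverse)
  finally show ?thesis by (simp add: mult_left_mono)
qed

section \<open>Transference of the variance\<close>

text \<open>At N = 2^L - 1 only complete blocks occur. The error goes into the bounded part if U is
  bounded and into the small part otherwise, where G is negligible against U and half of \<alpha>
  survives in the lower bound for \<open>E_sum\<close>.\<close>

lemma VTP_along_dyadic:
  fixes f :: "nat \<Rightarrow> real ^ 'k::finite \<Rightarrow> real"
  assumes e: "\<And>a. 0 \<le> e a" and \<rho>: "0 < \<rho>" "\<rho> < 1" and \<alpha>: "0 < \<alpha>" and K: "0 \<le> K"
    and V: "\<And>L. \<bar>V_sum f (2 ^ L - 1) \<mu> - V_sum f (2 ^ L - 1) lebesgue_cube\<bar>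
        \<le> K * (\<Sum>a\<in>{1..L}. e a * \<rho> ^ a) * (\<Sum>a\<in>{1..L}. e a)"
    and E: "\<And>L. \<alpha> * (\<Sum>a\<in>{1..L}. e a) - K * (\<Sum>a\<in>{1..L}. e a * \<rho> ^ a) \<le> E_sum f (2 ^ L - 1) \<mu>"
  shows "VTP f \<mu>"
proof -
  define U where "U L = (\<Sum>a\<in>{1..L}. e a)" for L :: nat
  define G where "G L = (\<Sum>a\<in>{1..L}. e a * \<rho> ^ a)" for L :: nat
  define N where "N l = (2::nat) ^ l - 1" for l
  define \<Delta> where "\<Delta> l = V_sum f (N l) \<mu> - V_sum f (N l) lebesgue_cube" for l
  have U0: "0 \<le> U L" for L unfolding U_def by (intro sum_nonneg e)
  have G0: "0 \<le> G L" for L unfolding G_def using \<rho> by (intro sum_nonneg mult_nonneg_nonneg e) auto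
  have GU: "G L \<le> U L" for L
    unfolding G_def U_def using \<rho> e by (intro sum_mono mult_right_le_one_le power_le_one) auto
  have Umono: "U L \<le> U L'" if "L \<le> L'" for L L'
    unfolding U_def using that e by (intro sum_mono2) auto
  have \<Delta>: "\<bar>\<Delta> l\<bar> \<le> K * G l * U l" for l
    using V[of l] by (simp add: \<Delta>_def N_def G_def U_def)
  have N: "filterlim N at_top sequentially"
  proof (rule filterlim_at_top_mono[OF filterlim_ident])
    have "x \<le> N x" for x unfolding N_def using less_exp[of x] by linarith
    then show "eventually (\<lambda>x. x \<le> N x) sequentially" by simp
  qed
  show ?thesis
  proof (cases "\<exists>M. \<forall>L. U L \<le> M")
    case True
    then obtain M where M: "\<And>L. U L \<le> M" by blast
    have M0: "0 \<le> M" using M[of 0] U0[of 0] by linarith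
    have "\<Delta> \<in> O(\<lambda>_. 1)"
    proof (rule bigoI)
      have "\<bar>\<Delta> l\<bar> \<le> K * M * M" for l
      proof -
        have "K * G l * U l \<le> K * M * M"
          using K G0 U0 M GU[of l] M0 by (intro mult_mono) (auto intro: order_trans)
        then show ?thesis using \<Delta>[of l] by linarith
      qed
      then show "eventually (\<lambda>l. norm (\<Delta> l) \<le> (K * M * M) * norm (1::real)) sequentially" by simp
    qed
    then show ?thesis
      unfolding VTP_def using N
      by (intro exI[of _ N] conjI exI[of _ "\<lambda>_. 0"] exI[of _ \<Delta>]) (auto simp: \<Delta>_def)
  next
    case False
    then have unb: "\<exists>L. M < U L" for M by (simp add: not_le)
    have big: "eventually (\<lambda>L. M \<le> U L) sequentially" for M
    proof -
      obtain L where "M < U L" using unb by blast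
      then have "M \<le> U L'" if "L \<le> L'" for L' using Umono[OF that] by linarith
      then show ?thesis by (rule eventually_sequentiallyI)
    qed
    have Gsmall: "eventually (\<lambda>L. G L \<le> \<epsilon> * U L) sequentially" if \<epsilon>: "0 < \<epsilon>" for \<epsilon>
    proof -
      \<comment> \<open>Blocks up to \<open>a0\<close> are bounded by the fixed number
        \<open>U a0\<close>, absorbed once U is large; later blocks carry a factor below
        \<open>\<epsilon> / 2\<close>.\<close>
      obtain a0 where a0: "\<rho> ^ a0 < \<epsilon> / 2" using real_arch_pow_inv[of "\<epsilon> / 2" \<rho>] \<epsilon> \<rho> by auto
      have GL: "G L \<le> U a0 + \<epsilon> / 2 * U L" for L
      proof -
        have "G L \<le> (\<Sum>a\<in>{1..L}. (if a \<le> a0 then e a else 0) + \<epsilon> / 2 * e a)"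
          unfolding G_def
        proof (rule sum_mono)
          fix a
          show "e a * \<rho> ^ a \<le> (if a \<le> a0 then e a else 0) + \<epsilon> / 2 * e a"
          proof (cases "a \<le> a0")
            case True
            have "e a * \<rho> ^ a \<le> e a * 1" using \<rho> e by (intro mult_left_mono power_le_one) auto
            then show ?thesis using True e[of a] \<epsilon> by (simp add: add_increasing2)
          next
            case False
            have "\<rho> ^ a \<le> \<rho> ^ a0" using \<rho> False by (intro power_decreasing) auto
            then have "e a * \<rho> ^ a \<le> e a * (\<epsilon> / 2)" using a0 e by (intro mult_left_mono) auto
            then show ?thesis using False by (simp add: mult.commute)
          qed
        qed
        also have "\<dots> = (\<Sum>a\<in>{1..L} \<inter> {..a0}. e a) + \<epsilon> / 2 * U L"
          using sum.inter_restrict[of "{1..L}" e "{..a0}"] by (simp add: sum.distrib U_def sum_distrib_left)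
        also have "(\<Sum>a\<in>{1..L} \<inter> {..a0}. e a) \<le> U a0"
          unfolding U_def using e by (intro sum_mono2) auto
        finally show ?thesis by simp
      qed
      from big[of "2 * U a0 / \<epsilon>"] show ?thesis
      proof eventually_elim
        case (elim L)
        then have "U a0 \<le> \<epsilon> / 2 * U L" using \<epsilon> by (simp add: field_simps)
        then show ?case using GL[of L] by simp
      qed
    qed
    have Elow: "eventually (\<lambda>L. \<alpha> / 2 * U L \<le> E_sum f (N L) \<mu>) sequentially"
    proof -
      \<comment> \<open>K + 1 in place of K keeps the quotient positive when K is 0.\<close>
      have "0 < \<alpha> / (2 * (K + 1))" using \<alpha> K by simp
      from Gsmall[OF this] show ?thesis
      proof eventually_elim
        case (elim L)
        have "K * G L \<le> (K + 1) * G L" using G0[of L] by (simp add: mult_right_mono)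
        also have "\<dots> \<le> (K + 1) * (\<alpha> / (2 * (K + 1)) * U L)" using elim K by (intro mult_left_mono) auto
        also have "\<dots> = \<alpha> / 2 * U L" using K by (simp add: field_simps)
        finally have "\<alpha> / 2 * U L \<le> \<alpha> * U L - K * G L" by (simp add: field_simps)
        then show ?case using E[of L] by (simp add: N_def U_def G_def)
      qed
    qed
    have "\<Delta> \<in> o(\<lambda>l. (E_sum f (N l) \<mu>)\<^sup>2)"
    proof (rule landau_o.smallI)
      fix c :: real assume c: "0 < c"
      \<comment> \<open>Chosen so that \<open>K * G l * U l\<close> is at most
        \<open>c * (\<alpha> / 2 * U l)^2\<close>, where \<open>\<alpha> / 2 * U l\<close> is at
        most the expectation sum.\<close>
      have "0 < c * \<alpha>\<^sup>2 / (4 * (K + 1))" using \<alpha> K c by simp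
      from Gsmall[OF this] Elow
      show "eventually (\<lambda>l. norm (\<Delta> l) \<le> c * norm ((E_sum f (N l) \<mu>)\<^sup>2)) sequentially"
      proof eventually_elim
        case (elim l)
        have "K * G l \<le> (K + 1) * G l" using G0[of l] by (simp add: mult_right_mono)
        also have "\<dots> \<le> (K + 1) * (c * \<alpha>\<^sup>2 / (4 * (K + 1)) * U l)" using elim K by (intro mult_left_mono) auto
        also have "\<dots> = c * (\<alpha>\<^sup>2 / 4) * U l" using K by (simp add: field_simps)
        finally have "K * G l * U l \<le> c * (\<alpha>\<^sup>2 / 4) * U l * U l" using U0 by (intro mult_right_mono) auto
        also have "\<dots> = c * (\<alpha> / 2 * U l)\<^sup>2" by (simp add: power2_eq_square)
        also have "\<dots> \<le> c * (E_sum f (N l) \<mu>)\<^sup>2"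
          using elim c \<alpha> U0[of l] by (intro mult_left_mono power_mono) auto
        finally show ?case using \<Delta>[of l] by simp
      qed
    qed
    then show ?thesis
      unfolding VTP_def using N
      by (intro exI[of _ N] conjI exI[of _ \<Delta>] exI[of _ "\<lambda>_. 0"]) (auto simp: \<Delta>_def)
  qed
qed

section \<open>Dyadic blocks, and function systems with dominated Fourier series\<close>

lemma sum_dyadic_blocks:
  "(\<Sum>n\<in>{1..2 ^ L - 1}. g n) = (\<Sum>a\<in>{1..L}. \<Sum>n\<in>dyadic_block a. g n)"
proof (induction L)
  case (Suc L)
  have "(1::nat) \<le> 2 ^ L" by simp
  then have "{1..2 ^ Suc L - 1} = {1..2 ^ L - 1} \<union> dyadic_block (Suc L)"
    unfolding dyadic_block_def by (intro set_eqI) (simp, linarith)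
  moreover have "{1..2 ^ L - 1} \<inter> dyadic_block (Suc L) = {}" by (auto simp: dyadic_block_def)
  ultimately have "(\<Sum>n\<in>{1..2 ^ Suc L - 1}. g n) = (\<Sum>n\<in>{1..2 ^ L - 1}. g n) + (\<Sum>n\<in>dyadic_block (Suc L). g n)"
    by (simp add: sum.union_disjoint dyadic_block_def)
  then show ?case using Suc by simp
qed simp

lemma ex_dyadic_block:
  assumes "1 \<le> n" shows "\<exists>a\<ge>1. n \<in> dyadic_block a"
proof -
  obtain L where "n < 2 ^ L" using less_exp by blast
  then have "n \<in> {1..2 ^ L - 1}" using assms by simp
  moreover have "{1..2 ^ L - 1} \<subseteq> (\<Union>a\<in>{1..L}. dyadic_block a)" for L
  proof (induction L)
    case (Suc L)
    have "{1..2 ^ Suc L - 1} \<subseteq> {1..2 ^ L - 1} \<union> dyadic_block (Suc L)"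
      by (auto simp: dyadic_block_def)
    then show ?case using Suc by (auto simp: atLeastAtMostSuc_conv)
  qed simp
  ultimately show ?thesis by fastforce
qed

lemma card_dyadic_block: "1 \<le> a \<Longrightarrow> real (card (dyadic_block a)) = 2 ^ a / 2"
  by (cases a) (auto simp: dyadic_block_def)

lemma dyadic_block_half_le:
  assumes "1 \<le> a" "n \<in> dyadic_block a"
  shows "2 ^ a / 2 \<le> real n" "real n \<le> 2 ^ a"
proof -
  obtain b where a: "a = Suc b" using assms(1) by (cases a) auto
  have "2 ^ b \<le> n" "n \<le> 2 ^ a" using assms(2) a by (auto simp: dyadic_block_def)
  then have "real (2 ^ b) \<le> real n" "real n \<le> real (2 ^ a)" by (simp_all only: of_nat_le_iff)
  then show "2 ^ a / 2 \<le> real n" "real n \<le> 2 ^ a" by (simp_all add: a)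
qed

text \<open>What the estimates use of an admissible system. The scale \<open>\<phi> a\<close> bounds
  all coefficients of a block from above and, through \<alpha>, the mean from below; this is what
  makes the error comparable with the square of \<open>E_sum\<close>.\<close>

locale lattice_system =
  fixes f :: "nat \<Rightarrow> real ^ 'k::finite \<Rightarrow> real" and c :: "nat \<Rightarrow> ('k \<Rightarrow> int) \<Rightarrow> complex"
    and \<phi> :: "nat \<Rightarrow> real" and A B \<tau> \<alpha> :: real
  assumes k: "CARD('k) \<ge> 3" and \<tau>: "0 < \<tau>" "\<tau> \<le> 1 / (8 * (real CARD('k))\<^sup>2)"
    and A: "0 \<le> A" and B: "1 \<le> B" and \<alpha>: "0 < \<alpha>" and \<phi>: "\<And>a. 1 \<le> a \<Longrightarrow> 0 \<le> \<phi> a"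
    and coeff: "\<And>a n \<xi>. 1 \<le> a \<Longrightarrow> n \<in> dyadic_block a \<Longrightarrow>
      norm (c n \<xi>) \<le> A * \<phi> a * lattice_weight (B * (2 ^ a) powr (1 / real CARD('k) + \<tau>)) \<xi>"
    and coeff_zero: "\<And>a n. 1 \<le> a \<Longrightarrow> n \<in> dyadic_block a \<Longrightarrow> \<alpha> * \<phi> a \<le> Re (c n (\<lambda>_. 0))"
    and expansion: "\<And>n x. 1 \<le> n \<Longrightarrow> x \<in> unit_cube \<Longrightarrow>
      (\<lambda>Q. \<Sum>\<xi>\<in>lattice_box Q. c n \<xi> * character (\<lambda>j. int n * \<xi> j) x) \<longlonglongrightarrow> of_real (f n x)"
begin

definition X :: "nat \<Rightarrow> real" where
  "X a = B * (2 ^ a) powr (1 / real CARD('k) + \<tau>)"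

definition \<rho> :: real where
  "\<rho> = 2 powr (- 1 / (8 * real CARD('k)))"

definition partial :: "nat \<Rightarrow> nat \<Rightarrow> real ^ 'k \<Rightarrow> complex" where
  "partial n Q x = (\<Sum>\<xi>\<in>lattice_box Q. c n \<xi> * character (\<lambda>j. int n * \<xi> j) x)"

lemma \<rho>: "0 < \<rho>" "\<rho> < 1"
  using k powr_less_cancel_iff[of 2 "- 1 / (8 * real CARD('k))" 0] by (simp_all add: \<rho>_def)

lemma X_ge_one: "1 \<le> X a"
proof -
  have "1 \<le> (2 ^ a) powr (1 / real CARD('k) + \<tau>)"
    using \<tau> by (intro ge_one_powr_ge_zero) auto
  then show ?thesis using B mult_mono[of 1 B 1 "(2 ^ a) powr (1 / real CARD('k) + \<tau>)"]
    by (simp add: X_def)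
qed

lemma sum_norm_coeff:
  assumes "1 \<le> a" "n \<in> dyadic_block a"
  shows "(\<Sum>\<xi>\<in>lattice_box Q. norm (c n \<xi>)) \<le> A * \<phi> a * (5 * X a) ^ CARD('k)"
proof -
  have "(\<Sum>\<xi>\<in>lattice_box Q. norm (c n \<xi>)) \<le> (\<Sum>\<xi>\<in>lattice_box Q. A * \<phi> a * lattice_weight (X a) (\<xi> :: 'k \<Rightarrow> int))"
    unfolding X_def by (intro sum_mono coeff assms)
  also have "\<dots> = A * \<phi> a * (\<Sum>\<xi>\<in>lattice_box Q. lattice_weight (X a) (\<xi> :: 'k \<Rightarrow> int))" by (simp add: sum_distrib_left)
  also have "\<dots> \<le> A * \<phi> a * (5 * X a) ^ CARD('k)"
    using A \<phi> assms by (intro mult_left_mono sum_lattice_weight X_ge_one mult_nonneg_nonneg) auto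
  finally show ?thesis .
qed

text \<open>The bound is uniform in Q and in the point, so it is a constant majorant for dominated
  convergence under every probability measure on the cube.\<close>

lemma partial_bounded:
  assumes "1 \<le> n" obtains S where "0 \<le> S" "\<And>Q x. norm (partial n Q x) \<le> S"
proof -
  obtain a where a: "1 \<le> a" "n \<in> dyadic_block a" using ex_dyadic_block[OF assms] by blast
  have "norm (partial n Q x) \<le> A * \<phi> a * (5 * X a) ^ CARD('k)" for Q x
  proof -
    have "norm (partial n Q x) \<le> (\<Sum>\<xi>\<in>lattice_box Q. norm (c n \<xi> * character (\<lambda>j. int n * \<xi> j) x))"
      unfolding partial_def by (rule norm_sum)
    also have "\<dots> = (\<Sum>\<xi>\<in>lattice_box Q. norm (c n \<xi>))" by (simp add: norm_mult)
    finally show ?thesis using sum_norm_coeff[OF a, of Q] by linarith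
  qed
  moreover from this[of 0 0] have "0 \<le> A * \<phi> a * (5 * X a) ^ CARD('k)"
    by (meson norm_ge_zero order_trans)
  ultimately show ?thesis using that by blast
qed

lemma partial_measurable: "partial n Q \<in> borel_measurable borel"
  unfolding partial_def
  by (intro borel_measurable_sum borel_measurable_times borel_measurable_const character_measurable)

lemma partial_tendsto: "1 \<le> n \<Longrightarrow> x \<in> unit_cube \<Longrightarrow> (\<lambda>Q. partial n Q x) \<longlonglongrightarrow> of_real (f n x)"
  unfolding partial_def by (rule expansion)

text \<open>On the cube \<open>f n\<close> is a pointwise limit of trigonometric
  polynomials.\<close>

lemma f_measurable:
  assumes \<nu>: "prob_measure_on_cube \<nu>" and n: "1 \<le> n"
  shows "f n \<in> borel_measurable \<nu>"
proof -
  have "(\<lambda>x. complex_of_real (f n x)) \<in> borel_measurable \<nu>"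
  proof (rule borel_measurable_LIMSEQ_metric)
    show "partial n Q \<in> borel_measurable \<nu>" for Q
      by (rule measurable_prob_cube[OF \<nu> partial_measurable])
    show "(\<lambda>Q. partial n Q x) \<longlonglongrightarrow> complex_of_real (f n x)" if "x \<in> space \<nu>" for x
      using that n by (intro partial_tendsto) (auto simp: space_prob_cube[OF \<nu>])
  qed
  then have "(\<lambda>x. Re (complex_of_real (f n x))) \<in> borel_measurable \<nu>" by measurable
  then show ?thesis by simp
qed

lemma integrable_character:
  assumes \<nu>: "prob_measure_on_cube \<nu>" shows "integrable \<nu> (character v)"
proof -
  interpret prob_space \<nu> using \<nu> by (simp add: prob_measure_on_cube_def)
  show ?thesis
    by (rule integrable_const_bound[where B = 1])
      (auto intro: measurable_prob_cube[OF \<nu> character_measurable])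
qed

lemma integral_partial:
  assumes \<nu>: "prob_measure_on_cube \<nu>"
  shows "(LINT x|\<nu>. partial n Q x) = (\<Sum>\<xi>\<in>lattice_box Q. c n \<xi> * (LINT x|\<nu>. character (\<lambda>j. int n * \<xi> j) x))"
  unfolding partial_def
  by (subst Bochner_Integration.integral_sum)
    (auto intro!: integrable_mult_right integrable_character[OF \<nu>])

lemma integral_f_tendsto:
  assumes \<nu>: "prob_measure_on_cube \<nu>" and n: "1 \<le> n"
  shows "(\<lambda>Q. LINT x|\<nu>. partial n Q x) \<longlonglongrightarrow> of_real (LINT x|\<nu>. f n x)"
proof -
  interpret prob_space \<nu> using \<nu> by (simp add: prob_measure_on_cube_def)
  obtain S where S: "0 \<le> S" "\<And>Q x. norm (partial n Q x) \<le> S" using partial_bounded[OF n] by blast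
  have "(\<lambda>Q. LINT x|\<nu>. partial n Q x) \<longlonglongrightarrow> (LINT x|\<nu>. complex_of_real (f n x))"
  proof (rule integral_dominated_convergence[where w = "\<lambda>_. S"])
    show "(\<lambda>x. complex_of_real (f n x)) \<in> borel_measurable \<nu>"
      using f_measurable[OF \<nu> n] by measurable
    show "AE x in \<nu>. (\<lambda>Q. partial n Q x) \<longlonglongrightarrow> complex_of_real (f n x)"
      using n by (intro AE_I2 partial_tendsto) (auto simp: space_prob_cube[OF \<nu>])
  qed (use S in \<open>auto intro: measurable_prob_cube[OF \<nu> partial_measurable]\<close>)
  then show ?thesis by (simp only: integral_complex_of_real)
qed

text \<open>Orthogonality of characters: for n >= 1 only \<xi> = 0 has frequency zero.\<close>

lemma integral_f_cube:
  assumes n: "1 \<le> n"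
  shows "complex_of_real (LINT x|lebesgue_cube. f n x) = c n (\<lambda>_. 0)"
proof -
  have "(LINT x|lebesgue_cube. partial n Q x) = c n (\<lambda>_. 0)" for Q
  proof -
    have "(\<lambda>j. int n * \<xi> j) = (\<lambda>_. 0) \<longleftrightarrow> \<xi> = (\<lambda>_. 0)" for \<xi> :: "'k \<Rightarrow> int"
      using n by (auto simp: fun_eq_iff)
    then have "(LINT x|lebesgue_cube. partial n Q x)
        = (\<Sum>\<xi>\<in>lattice_box Q. if \<xi> = (\<lambda>_. 0) then c n \<xi> else 0)"
      unfolding integral_partial[OF prob_measure_lebesgue_cube] integral_character_cube
      by (intro sum.cong) auto
    also have "\<dots> = c n (\<lambda>_. 0)"
      by (subst sum.delta) (auto simp: lattice_box_iff)
    finally show ?thesis .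
  qed
  then have "(\<lambda>Q. LINT x|lebesgue_cube. partial n Q x) \<longlonglongrightarrow> c n (\<lambda>_. 0)" by simp
  then show ?thesis using integral_f_tendsto[OF prob_measure_lebesgue_cube n] LIMSEQ_unique by blast
qed

text \<open>Deleting the zero frequency amounts to subtracting the Lebesgue mean of
  \<open>f n\<close>.\<close>

definition excess :: "nat \<Rightarrow> ('k \<Rightarrow> int) \<Rightarrow> complex" where
  "excess n \<xi> = (if \<xi> = (\<lambda>_. 0) then 0 else c n \<xi>)"

definition deviation :: "nat \<Rightarrow> nat \<Rightarrow> real ^ 'k \<Rightarrow> complex" where
  "deviation N Q x = (\<Sum>p\<in>{1..N} \<times> lattice_box Q. excess (fst p) (snd p) * character (\<lambda>j. int (fst p) * snd p j) x)"

lemma deviation_eq: "deviation N Q x = (\<Sum>n\<in>{1..N}. partial n Q x - c n (\<lambda>_. 0))"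
proof -
  have "(\<Sum>\<xi>\<in>lattice_box Q. excess n \<xi> * character (\<lambda>j. int n * \<xi> j) x) = partial n Q x - c n (\<lambda>_. 0)" for n
  proof -
    have "excess n \<xi> * character (\<lambda>j. int n * \<xi> j) x
        = c n \<xi> * character (\<lambda>j. int n * \<xi> j) x - (if \<xi> = (\<lambda>_. 0) then c n (\<lambda>_. 0) else 0)" for \<xi>
      by (simp add: excess_def)
    then show ?thesis
      by (simp add: partial_def sum_subtractf sum.delta lattice_box_iff)
  qed
  moreover have "deviation N Q x = (\<Sum>n\<in>{1..N}. \<Sum>\<xi>\<in>lattice_box Q. excess n \<xi> * character (\<lambda>j. int n * \<xi> j) x)"
    unfolding deviation_def by (simp add: sum.cartesian_product split_def)
  ultimately show ?thesis by simp
qed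

text \<open>The square is taken without conjugation. It tends to the real square because the limit
  of the deviations is real, and in its expansion the frequencies add, which is the form the kernel
  sums have.\<close>

lemma V_sum_tendsto:
  assumes \<nu>: "prob_measure_on_cube \<nu>"
  shows "(\<lambda>Q. LINT x|\<nu>. (deviation N Q x)\<^sup>2) \<longlonglongrightarrow> of_real (V_sum f N \<nu>)"
proof -
  interpret prob_space \<nu> using \<nu> by (simp add: prob_measure_on_cube_def)
  define S where "S n = (SOME S. 0 \<le> S \<and> (\<forall>Q x. norm (partial n Q x) \<le> S))" for n
  have S: "0 \<le> S n" "norm (partial n Q x) \<le> S n" if "1 \<le> n" for n Q x
  proof -
    have "\<exists>S. 0 \<le> S \<and> (\<forall>Q x. norm (partial n Q x) \<le> S)" using partial_bounded[OF that] by metis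
    from someI_ex[OF this] show "0 \<le> S n" "norm (partial n Q x) \<le> S n" unfolding S_def by auto
  qed
  define h where "h x = (\<Sum>n=1..N. f n x - (LINT z|lebesgue_cube. f n z))" for x
  define M where "M = (\<Sum>n=1..N. S n + norm (c n (\<lambda>_. 0)))"
  have dm: "deviation N Q \<in> borel_measurable borel" for Q
    unfolding deviation_def
    by (intro borel_measurable_sum borel_measurable_times borel_measurable_const character_measurable)
  have hm: "h \<in> borel_measurable \<nu>"
    unfolding h_def by (intro borel_measurable_sum borel_measurable_diff borel_measurable_const f_measurable[OF \<nu>]) auto
  have dM: "norm (deviation N Q x) \<le> M" for Q x
    unfolding deviation_eq M_def
    by (intro order_trans[OF norm_sum] sum_mono order_trans[OF norm_triangle_ineq4] add_right_mono S) auto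
  have lim: "(\<lambda>Q. deviation N Q x) \<longlonglongrightarrow> of_real (h x)" if "x \<in> unit_cube" for x
    unfolding deviation_eq h_def of_real_sum of_real_diff
    using that by (intro tendsto_sum tendsto_diff partial_tendsto) (auto simp: integral_f_cube)
  have "(\<lambda>Q. LINT x|\<nu>. (deviation N Q x)\<^sup>2) \<longlonglongrightarrow> (LINT x|\<nu>. complex_of_real ((h x)\<^sup>2))"
  proof (rule integral_dominated_convergence[where w = "\<lambda>_. M\<^sup>2"])
    show "(\<lambda>x. complex_of_real ((h x)\<^sup>2)) \<in> borel_measurable \<nu>" using hm by measurable
    show "(\<lambda>x. (deviation N Q x)\<^sup>2) \<in> borel_measurable \<nu>" for Q
      using measurable_prob_cube[OF \<nu> dm] by measurable
    show "AE x in \<nu>. (\<lambda>Q. (deviation N Q x)\<^sup>2) \<longlonglongrightarrow> complex_of_real ((h x)\<^sup>2)"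
      using lim by (intro AE_I2) (auto simp: space_prob_cube[OF \<nu>] intro!: tendsto_power)
    show "AE x in \<nu>. norm ((deviation N Q x)\<^sup>2) \<le> M\<^sup>2" for Q
      using dM by (intro AE_I2) (auto simp: norm_power intro!: power_mono)
  qed simp
  also have "(LINT x|\<nu>. complex_of_real ((h x)\<^sup>2)) = of_real (V_sum f N \<nu>)"
    unfolding integral_complex_of_real V_sum_def h_def ..
  finally show ?thesis .
qed

lemma integral_deviation_square:
  assumes \<nu>: "prob_measure_on_cube \<nu>"
  shows "(LINT x|\<nu>. (deviation N Q x)\<^sup>2)
    = (\<Sum>p\<in>{1..N} \<times> lattice_box Q. \<Sum>p'\<in>{1..N} \<times> lattice_box Q. excess (fst p) (snd p) * excess (fst p') (snd p')
        * (LINT x|\<nu>. character (\<lambda>j. int (fst p) * snd p j + int (fst p') * snd p' j) x))"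
proof -
  have "(deviation N Q x)\<^sup>2 = (\<Sum>p\<in>{1..N} \<times> lattice_box Q. \<Sum>p'\<in>{1..N} \<times> lattice_box Q.
      excess (fst p) (snd p) * excess (fst p') (snd p')
        * character (\<lambda>j. int (fst p) * snd p j + int (fst p') * snd p' j) x)" for x
    unfolding deviation_def power2_eq_square sum_product
    by (intro sum.cong refl) (simp add: character_add[symmetric] mult_ac)
  then show ?thesis
    by (simp only: Bochner_Integration.integral_sum Bochner_Integration.integrable_sum
        integrable_mult_right integrable_character[OF \<nu>] integral_mult_right_zero)
qed

section \<open>Comparison of variances and means under the two measures, block by block\<close>

definition block_pair :: "nat \<Rightarrow> nat \<Rightarrow> nat \<Rightarrow> real" where
  "block_pair Q a b = (\<Sum>n\<in>dyadic_block a. \<Sum>\<xi>\<in>lattice_box Q. \<Sum>m\<in>dyadic_block b. \<Sum>\<zeta>\<in>lattice_box Q.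
     lattice_weight (X a) \<xi> * lattice_weight (X b) \<zeta> * inv_sq (\<lambda>j::'k. int n * \<xi> j + int m * \<zeta> j))"

lemma block_pair_commute: "block_pair Q a b = block_pair Q b a"
proof -
  let ?t = "\<lambda>a n \<xi> b m \<zeta>. lattice_weight (X a) \<xi> * lattice_weight (X b) \<zeta> * inv_sq (\<lambda>j::'k. int n * \<xi> j + int m * \<zeta> j)"
  have t: "?t a n \<xi> b m \<zeta> = ?t b m \<zeta> a n \<xi>" for n m \<xi> \<zeta> by (simp add: add.commute mult.commute)
  have "block_pair Q a b = (\<Sum>n\<in>dyadic_block a. \<Sum>m\<in>dyadic_block b. \<Sum>\<xi>\<in>lattice_box Q. \<Sum>\<zeta>\<in>lattice_box Q. ?t a n \<xi> b m \<zeta>)"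
    unfolding block_pair_def by (intro sum.cong refl sum.swap)
  also have "\<dots> = (\<Sum>m\<in>dyadic_block b. \<Sum>n\<in>dyadic_block a. \<Sum>\<xi>\<in>lattice_box Q. \<Sum>\<zeta>\<in>lattice_box Q. ?t b m \<zeta> a n \<xi>)"
    unfolding t by (rule sum.swap)
  also have "\<dots> = (\<Sum>m\<in>dyadic_block b. \<Sum>n\<in>dyadic_block a. \<Sum>\<zeta>\<in>lattice_box Q. \<Sum>\<xi>\<in>lattice_box Q. ?t b m \<zeta> a n \<xi>)"
    by (intro sum.cong refl sum.swap)
  also have "\<dots> = block_pair Q b a"
    unfolding block_pair_def by (intro sum.cong refl sum.swap)
  finally show ?thesis .
qed

text \<open>The saving is a power of \<rho> whose exponent is the smaller of the two indices. The
  sum \<open>\<rho> ^ a + \<rho> ^ b\<close> dominates it, is symmetric, and lets the double sum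
  over blocks factor.\<close>

lemma block_pair_bound:
  obtains C where "0 \<le> C" "\<And>Q a b. 1 \<le> a \<Longrightarrow> 1 \<le> b \<Longrightarrow> block_pair Q a b \<le> C * (2 ^ a * 2 ^ b * (\<rho> ^ a + \<rho> ^ b))"
proof -
  obtain C where C: "0 \<le> C" and pair: "\<forall>a b n Q. 1 \<le> b \<longrightarrow> b \<le> a \<longrightarrow> n \<in> dyadic_block a \<longrightarrow>
    (\<Sum>m\<in>dyadic_block b. \<Sum>\<zeta>\<in>lattice_box Q. \<Sum>\<xi>\<in>lattice_box Q.
       lattice_weight (X a) \<xi> * lattice_weight (X b) \<zeta> * inv_sq (\<lambda>j::'k. int n * \<xi> j + int m * \<zeta> j))
     \<le> C * (2 ^ b * \<rho> ^ b)"
    using dyadic_pair_sum[OF k \<tau> B, folded X_def \<rho>_def] by (elim exE conjE)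
  have le: "block_pair Q a b \<le> C * (2 ^ a * 2 ^ b * (\<rho> ^ a + \<rho> ^ b))" if ab: "1 \<le> b" "b \<le> a" for Q a b
  proof -
    have "block_pair Q a b = (\<Sum>n\<in>dyadic_block a. \<Sum>m\<in>dyadic_block b. \<Sum>\<zeta>\<in>lattice_box Q. \<Sum>\<xi>\<in>lattice_box Q.
       lattice_weight (X a) \<xi> * lattice_weight (X b) \<zeta> * inv_sq (\<lambda>j::'k. int n * \<xi> j + int m * \<zeta> j))"
      unfolding block_pair_def
      by (rule sum.cong[OF refl], subst sum.swap, rule sum.cong[OF refl], rule sum.swap)
    also have "\<dots> \<le> (\<Sum>n\<in>dyadic_block a. C * (2 ^ b * \<rho> ^ b))"
      using pair ab by (intro sum_mono) blast
    also have "\<dots> = 2 ^ a / 2 * (C * (2 ^ b * \<rho> ^ b))"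
      using ab by (simp add: card_dyadic_block)
    also have "\<dots> \<le> 2 ^ a * (C * (2 ^ b * (\<rho> ^ a + \<rho> ^ b)))"
      using C \<rho> by (intro mult_mono mult_left_mono) auto
    finally show ?thesis by (simp add: mult_ac)
  qed
  show ?thesis
  proof (rule that[OF C])
    show "block_pair Q a b \<le> C * (2 ^ a * 2 ^ b * (\<rho> ^ a + \<rho> ^ b))" if "1 \<le> a" "1 \<le> b" for Q a b
    proof (cases "b \<le> a")
      case False
      then show ?thesis using le[of a b Q] that block_pair_commute[of Q a b] by (simp add: mult_ac add.commute)
    qed (use le that in blast)
  qed
qed

end

lemma sum_dyadic_grid:
  "(\<Sum>p\<in>{1..2 ^ L - 1} \<times> S. h p) = (\<Sum>a\<in>{1..L}. \<Sum>n\<in>dyadic_block a. \<Sum>\<xi>\<in>S. h (n, \<xi>))"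
proof -
  have "(\<Sum>p\<in>{1..2 ^ L - 1} \<times> S. h p) = (\<Sum>n\<in>{1..2 ^ L - 1}. \<Sum>\<xi>\<in>S. h (n, \<xi>))"
    by (simp add: sum.cartesian_product split_def)
  then show ?thesis by (simp only: sum_dyadic_blocks)
qed

context lattice_system
begin

text \<open>Twice the number of n in the block times their common scale. Index 0 gets the value 0
  because \<phi> is controlled only from 1 on.\<close>

definition size :: "nat \<Rightarrow> real" where
  "size a = (if 1 \<le> a then 2 ^ a * \<phi> a else 0)"

lemma size_nonneg: "0 \<le> size a"
  using \<phi> by (simp add: size_def)

lemma norm_excess_le:
  assumes "1 \<le> a" "n \<in> dyadic_block a"
  shows "norm (excess n \<xi>) \<le> A * \<phi> a * lattice_weight (X a) \<xi>"
  using coeff[OF assms, of \<xi>] A \<phi>[OF assms(1)] lattice_weight_bounds(1)[of "X a" \<xi>]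
  by (auto simp: excess_def X_def intro!: mult_nonneg_nonneg)

text \<open>In the expanded squares the terms of frequency zero cancel between the two measures, and
  the others are controlled by \<open>D * inv_sq\<close>. All bounds are independent of the
  truncation Q, so they survive the limit.\<close>

lemma variance_bound:
  assumes \<mu>: "prob_measure_on_cube \<mu>" and D: "0 \<le> D"
    and dec: "\<And>v::'k \<Rightarrow> int. norm ((LINT x|\<mu>. character v x) - (LINT x|lebesgue_cube. character v x)) \<le> D * inv_sq v"
  obtains K where "0 \<le> K" "\<And>L. \<bar>V_sum f (2 ^ L - 1) \<mu> - V_sum f (2 ^ L - 1) lebesgue_cube\<bar>
      \<le> K * (\<Sum>a\<in>{1..L}. size a * \<rho> ^ a) * (\<Sum>a\<in>{1..L}. size a)"
proof -
  obtain C where C: "0 \<le> C"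
    and pair: "\<And>Q a b. 1 \<le> a \<Longrightarrow> 1 \<le> b \<Longrightarrow> block_pair Q a b \<le> C * (2 ^ a * 2 ^ b * (\<rho> ^ a + \<rho> ^ b))"
    using block_pair_bound by blast
  \<comment> \<open>A twice for the two coefficients, D for the decay, C for the block pairs; the 2
    comes from the symmetric terms \<open>\<rho> ^ a\<close> and \<open>\<rho> ^ b\<close>.\<close>
  define K where "K = 2 * (A\<^sup>2 * D * C)"
  have K0: "0 \<le> K" using D C by (simp add: K_def)
  have "\<bar>V_sum f (2 ^ L - 1) \<mu> - V_sum f (2 ^ L - 1) lebesgue_cube\<bar>
      \<le> K * (\<Sum>a\<in>{1..L}. size a * \<rho> ^ a) * (\<Sum>a\<in>{1..L}. size a)" for L
  proof -
    let ?N = "2 ^ L - 1 :: nat"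
    have fin: "norm ((LINT x|\<mu>. (deviation ?N Q x)\<^sup>2) - (LINT x|lebesgue_cube. (deviation ?N Q x)\<^sup>2))
       \<le> K * (\<Sum>a\<in>{1..L}. size a * \<rho> ^ a) * (\<Sum>a\<in>{1..L}. size a)" for Q
    proof -
      let ?S = "{1..?N} \<times> (lattice_box Q :: ('k \<Rightarrow> int) set)"
      define G where "G p p' = norm (excess (fst p) (snd p)) * norm (excess (fst p') (snd p'))
          * (D * inv_sq (\<lambda>j. int (fst p) * snd p j + int (fst p') * snd p' j))"
        for p p' :: "nat \<times> ('k \<Rightarrow> int)"
      have "norm ((LINT x|\<mu>. (deviation ?N Q x)\<^sup>2) - (LINT x|lebesgue_cube. (deviation ?N Q x)\<^sup>2))
          = norm (\<Sum>p\<in>?S. \<Sum>p'\<in>?S. excess (fst p) (snd p) * excess (fst p') (snd p')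
            * ((LINT x|\<mu>. character (\<lambda>j. int (fst p) * snd p j + int (fst p') * snd p' j) x)
              - (LINT x|lebesgue_cube. character (\<lambda>j. int (fst p) * snd p j + int (fst p') * snd p' j) x)))"
        unfolding integral_deviation_square[OF \<mu>] integral_deviation_square[OF prob_measure_lebesgue_cube]
        by (simp only: sum_subtractf right_diff_distrib)
      also have "\<dots> \<le> (\<Sum>p\<in>?S. \<Sum>p'\<in>?S. G p p')"
      proof (rule order_trans[OF norm_sum], rule sum_mono, rule order_trans[OF norm_sum], rule sum_mono)
        fix p p'
        show "norm (excess (fst p) (snd p) * excess (fst p') (snd p')
            * ((LINT x|\<mu>. character (\<lambda>j. int (fst p) * snd p j + int (fst p') * snd p' j) x)
              - (LINT x|lebesgue_cube. character (\<lambda>j. int (fst p) * snd p j + int (fst p') * snd p' j) x))) \<le> G p p'"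
          unfolding norm_mult G_def by (intro mult_left_mono dec mult_nonneg_nonneg norm_ge_zero)
      qed
      also have "\<dots> = (\<Sum>a\<in>{1..L}. \<Sum>n\<in>dyadic_block a. \<Sum>\<xi>\<in>lattice_box Q.
          \<Sum>b\<in>{1..L}. \<Sum>m\<in>dyadic_block b. \<Sum>\<zeta>\<in>lattice_box Q. G (n, \<xi>) (m, \<zeta>))"
        unfolding sum_dyadic_grid ..
      also have "\<dots> \<le> (\<Sum>a\<in>{1..L}. \<Sum>n\<in>dyadic_block a. \<Sum>\<xi>\<in>lattice_box Q.
          \<Sum>b\<in>{1..L}. \<Sum>m\<in>dyadic_block b. \<Sum>\<zeta>\<in>lattice_box Q. (A\<^sup>2 * D * \<phi> a * \<phi> b) *
            (lattice_weight (X a) \<xi> * lattice_weight (X b) \<zeta> * inv_sq (\<lambda>j::'k. int n * \<xi> j + int m * \<zeta> j)))"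
      proof (rule sum_mono, rule sum_mono, rule sum_mono, rule sum_mono, rule sum_mono, rule sum_mono)
        fix a n b m :: nat and \<xi> \<zeta> :: "'k \<Rightarrow> int"
        assume "a \<in> {1..L}" "n \<in> dyadic_block a" "b \<in> {1..L}" "m \<in> dyadic_block b"
        then have a: "1 \<le> a" "n \<in> dyadic_block a" and b: "1 \<le> b" "m \<in> dyadic_block b" by auto
        have "G (n, \<xi>) (m, \<zeta>) \<le> (A * \<phi> a * lattice_weight (X a) \<xi>) * (A * \<phi> b * lattice_weight (X b) \<zeta>)
            * (D * inv_sq (\<lambda>j::'k. int n * \<xi> j + int m * \<zeta> j))"
          unfolding G_def fst_conv snd_conv
          by (intro mult_mono norm_excess_le a b mult_nonneg_nonneg D inv_sq_nonneg A \<phi> lattice_weight_bounds norm_ge_zero order_refl)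
        then show "G (n, \<xi>) (m, \<zeta>) \<le> (A\<^sup>2 * D * \<phi> a * \<phi> b) *
            (lattice_weight (X a) \<xi> * lattice_weight (X b) \<zeta> * inv_sq (\<lambda>j::'k. int n * \<xi> j + int m * \<zeta> j))"
          by (simp only: power2_eq_square mult_ac)
      qed
      also have "\<dots> = (\<Sum>a\<in>{1..L}. \<Sum>b\<in>{1..L}. \<Sum>n\<in>dyadic_block a. \<Sum>\<xi>\<in>lattice_box Q.
          \<Sum>m\<in>dyadic_block b. \<Sum>\<zeta>\<in>lattice_box Q. (A\<^sup>2 * D * \<phi> a * \<phi> b) *
            (lattice_weight (X a) \<xi> * lattice_weight (X b) \<zeta> * inv_sq (\<lambda>j::'k. int n * \<xi> j + int m * \<zeta> j)))"
      proof (rule sum.cong[OF refl])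
        fix a
        let ?h = "\<lambda>n \<xi> b. \<Sum>m\<in>dyadic_block b. \<Sum>\<zeta>\<in>lattice_box Q. (A\<^sup>2 * D * \<phi> a * \<phi> b) *
            (lattice_weight (X a) \<xi> * lattice_weight (X b) \<zeta> * inv_sq (\<lambda>j::'k. int n * \<xi> j + int m * \<zeta> j))"
        have "(\<Sum>n\<in>dyadic_block a. \<Sum>\<xi>\<in>lattice_box Q. \<Sum>b\<in>{1..L}. ?h n \<xi> b)
            = (\<Sum>n\<in>dyadic_block a. \<Sum>b\<in>{1..L}. \<Sum>\<xi>\<in>lattice_box Q. ?h n \<xi> b)"
          by (intro sum.cong refl sum.swap)
        also have "\<dots> = (\<Sum>b\<in>{1..L}. \<Sum>n\<in>dyadic_block a. \<Sum>\<xi>\<in>lattice_box Q. ?h n \<xi> b)"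
          by (rule sum.swap)
        finally show "(\<Sum>n\<in>dyadic_block a. \<Sum>\<xi>\<in>lattice_box Q. \<Sum>b\<in>{1..L}. ?h n \<xi> b)
            = (\<Sum>b\<in>{1..L}. \<Sum>n\<in>dyadic_block a. \<Sum>\<xi>\<in>lattice_box Q. ?h n \<xi> b)" .
      qed
      also have "\<dots> = (\<Sum>a\<in>{1..L}. \<Sum>b\<in>{1..L}. (A\<^sup>2 * D * \<phi> a * \<phi> b) * block_pair Q a b)"
        unfolding block_pair_def sum_distrib_left ..
      also have "\<dots> \<le> (\<Sum>a\<in>{1..L}. \<Sum>b\<in>{1..L}. (A\<^sup>2 * D * \<phi> a * \<phi> b) * (C * (2 ^ a * 2 ^ b * (\<rho> ^ a + \<rho> ^ b))))"
        using A D \<phi> by (intro sum_mono mult_left_mono pair mult_nonneg_nonneg) auto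
      also have "\<dots> = (\<Sum>a\<in>{1..L}. \<Sum>b\<in>{1..L}. (A\<^sup>2 * D * C) * ((size a * \<rho> ^ a) * size b + size a * (size b * \<rho> ^ b)))"
        by (intro sum.cong refl) (simp add: size_def algebra_simps)
      also have "\<dots> = (A\<^sup>2 * D * C) * (\<Sum>a\<in>{1..L}. (size a * \<rho> ^ a) * (\<Sum>b\<in>{1..L}. size b) + size a * (\<Sum>b\<in>{1..L}. size b * \<rho> ^ b))"
        by (simp only: sum_distrib_left[symmetric] sum.distrib)
      also have "\<dots> = K * (\<Sum>a\<in>{1..L}. size a * \<rho> ^ a) * (\<Sum>a\<in>{1..L}. size a)"
        unfolding sum.distrib sum_distrib_right[symmetric] K_def by (simp add: algebra_simps)
      finally show ?thesis .
    qed
    have "(\<lambda>Q. norm ((LINT x|\<mu>. (deviation ?N Q x)\<^sup>2) - (LINT x|lebesgue_cube. (deviation ?N Q x)\<^sup>2)))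
        \<longlonglongrightarrow> norm (complex_of_real (V_sum f ?N \<mu>) - complex_of_real (V_sum f ?N lebesgue_cube))"
      by (intro tendsto_norm tendsto_diff V_sum_tendsto \<mu> prob_measure_lebesgue_cube)
    then have "norm (complex_of_real (V_sum f ?N \<mu>) - complex_of_real (V_sum f ?N lebesgue_cube))
        \<le> K * (\<Sum>a\<in>{1..L}. size a * \<rho> ^ a) * (\<Sum>a\<in>{1..L}. size a)"
      by (rule Lim_bounded) (use fin in blast)
    then show ?thesis by (simp only: of_real_diff[symmetric] norm_of_real)
  qed
  then show ?thesis using that K0 by blast
qed

text \<open>A nonzero \<xi> gives a frequency \<open>n * \<xi>\<close> of length at least n, so the
  means under \<mu> and Lebesgue measure differ by at most a multiple of
  \<open>\<phi> a * (X a) ^ k / n^2\<close>, and the lower bound from the zeroth coefficient carries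
  over to \<mu>.\<close>

lemma mean_bound:
  assumes \<mu>: "prob_measure_on_cube \<mu>" and D: "0 \<le> D"
    and dec: "\<And>v::'k \<Rightarrow> int. norm ((LINT x|\<mu>. character v x) - (LINT x|lebesgue_cube. character v x)) \<le> D * inv_sq v"
  obtains K where "0 \<le> K"
    "\<And>L. \<alpha> / 2 * (\<Sum>a\<in>{1..L}. size a) - K * (\<Sum>a\<in>{1..L}. size a * \<rho> ^ a) \<le> E_sum f (2 ^ L - 1) \<mu>"
proof -
  define K where "K = D * A * (4 * (5 * B) ^ CARD('k))"
  have K0: "0 \<le> K" using D A B by (simp add: K_def)
  \<comment> \<open>The quotient is at most of order \<open>M powr (k * \<tau> - 1)\<close>. Only
    the power belonging to \<rho> is retained, to match the variance bound.\<close>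
  have decay: "(5 * X a) ^ CARD('k) / (real n)\<^sup>2 \<le> 4 * (5 * B) ^ CARD('k) * \<rho> ^ a"
    if a: "1 \<le> a" "n \<in> dyadic_block a" for a n
  proof -
    define k' where "k' = real CARD('k)"
    define M :: real where "M = 2 ^ a"
    have k3: "3 \<le> k'" using k by (simp add: k'_def)
    have M1: "1 \<le> M" by (simp add: M_def)
    have "k' * \<tau> \<le> k' * (1 / (8 * k'\<^sup>2))" using \<tau> k3 by (intro mult_left_mono) (auto simp: k'_def)
    then have kt: "k' * \<tau> \<le> 1 / (8 * k')" using k3 by (simp add: power2_eq_square)
    have k8: "1 / (8 * k') \<le> 1 / 24" using k3 by (intro divide_left_mono) auto
    have "(5 * X a) ^ CARD('k) = (5 * B) ^ CARD('k) * M powr (1 + k' * \<tau>)"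
    proof -
      have "(M powr (1 / k' + \<tau>)) ^ CARD('k) = M powr (k' * (1 / k' + \<tau>))"
        using M1 by (simp add: powr_power k'_def mult.commute)
      also have "k' * (1 / k' + \<tau>) = 1 + k' * \<tau>" using k3 by (simp add: field_simps)
      finally show ?thesis by (simp add: X_def power_mult_distrib M_def k'_def)
    qed
    moreover have "1 / (real n)\<^sup>2 \<le> 4 * M powr (- 2)"
    proof -
      have "1 / (real n)\<^sup>2 \<le> 1 / (M / 2)\<^sup>2"
      proof (intro divide_left_mono power_mono mult_pos_pos)
        show "M / 2 \<le> real n" using dyadic_block_half_le[OF a] by (simp add: M_def)
        then show "0 < (real n)\<^sup>2" "0 < (M / 2)\<^sup>2" using M1 by auto
      qed (use M1 in auto)
      also have "\<dots> = 4 * M powr (- 2)"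
        using M1 by (simp add: powr_minus powr_numeral field_simps)
      finally show ?thesis .
    qed
    ultimately have "(5 * X a) ^ CARD('k) * (1 / (real n)\<^sup>2)
        \<le> (5 * B) ^ CARD('k) * M powr (1 + k' * \<tau>) * (4 * M powr (- 2))"
      using B by (simp only:) (intro mult_left_mono mult_nonneg_nonneg, auto)
    also have "\<dots> = 4 * (5 * B) ^ CARD('k) * M powr (k' * \<tau> - 1)"
    proof -
      have "M powr (k' * \<tau> - 1) = M powr (1 + k' * \<tau>) * M powr (- 2)"
        by (simp add: powr_add[symmetric])
      then show ?thesis by simp
    qed
    also have "\<dots> \<le> 4 * (5 * B) ^ CARD('k) * M powr (- 1 / (8 * k'))"
      using kt k8 M1 B by (intro mult_left_mono powr_mono) auto
    also have "M powr (- 1 / (8 * k')) = \<rho> ^ a"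
    proof -
      have "M = 2 powr real a" by (simp add: M_def powr_realpow)
      then show ?thesis by (simp add: \<rho>_def k'_def powr_powr powr_power mult.commute)
    qed
    finally show ?thesis by simp
  qed
  have pt: "\<alpha> * \<phi> a - K * \<phi> a * \<rho> ^ a \<le> (LINT x|\<mu>. f n x)" if a: "1 \<le> a" "n \<in> dyadic_block a" for a n
  proof -
    have "2 ^ a / 2 \<le> real n" using dyadic_block_half_le[OF a] by simp
    moreover have "(0::real) < 2 ^ a / 2" by simp
    ultimately have "0 < real n" by linarith
    then have n: "1 \<le> n" by simp
    have "norm ((LINT x|\<mu>. partial n Q x) - (LINT x|lebesgue_cube. partial n Q x)) \<le> K * \<phi> a * \<rho> ^ a" for Q
    proof -
      have isq: "inv_sq (\<lambda>j. int n * \<xi> j) \<le> 1 / (real n)\<^sup>2" for \<xi> :: "'k \<Rightarrow> int"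
      proof (cases "\<xi> = (\<lambda>_. 0)")
        case True
        then show ?thesis by (simp add: inv_sq_zero)
      next
        case False
        then obtain j where "\<xi> j \<noteq> 0" by auto
        then have "1 \<le> \<bar>real_of_int (\<xi> j)\<bar>" by linarith
        then have "real n * 1 \<le> real n * \<bar>real_of_int (\<xi> j)\<bar>" by (intro mult_left_mono) auto
        then have "real n \<le> \<bar>real_of_int (int n * \<xi> j)\<bar>" by (simp add: abs_mult)
        then show ?thesis using n by (intro inv_sq_le[where j = j]) auto
      qed
      have "norm ((LINT x|\<mu>. partial n Q x) - (LINT x|lebesgue_cube. partial n Q x))
        = norm (\<Sum>\<xi>\<in>lattice_box Q. c n \<xi> * ((LINT x|\<mu>. character (\<lambda>j. int n * \<xi> j) x)
            - (LINT x|lebesgue_cube. character (\<lambda>j. int n * \<xi> j) x)))"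
        unfolding integral_partial[OF \<mu>] integral_partial[OF prob_measure_lebesgue_cube]
        by (simp only: sum_subtractf right_diff_distrib)
      also have "\<dots> \<le> (\<Sum>\<xi>\<in>lattice_box Q. norm (c n \<xi>) * (D * (1 / (real n)\<^sup>2)))"
      proof (rule order_trans[OF norm_sum], rule sum_mono)
        fix \<xi> :: "'k \<Rightarrow> int"
        have "norm ((LINT x|\<mu>. character (\<lambda>j. int n * \<xi> j) x) - (LINT x|lebesgue_cube. character (\<lambda>j. int n * \<xi> j) x))
            \<le> D * (1 / (real n)\<^sup>2)"
          using dec[of "\<lambda>j. int n * \<xi> j"] mult_left_mono[OF isq D] by (rule order_trans)
        then show "norm (c n \<xi> * ((LINT x|\<mu>. character (\<lambda>j. int n * \<xi> j) x)
            - (LINT x|lebesgue_cube. character (\<lambda>j. int n * \<xi> j) x))) \<le> norm (c n \<xi>) * (D * (1 / (real n)\<^sup>2))"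
          unfolding norm_mult by (rule mult_left_mono) simp
      qed
      also have "\<dots> = (\<Sum>\<xi>\<in>lattice_box Q. norm (c n \<xi>)) * (D * (1 / (real n)\<^sup>2))"
        by (simp only: sum_distrib_right)
      also have "\<dots> \<le> (A * \<phi> a * (5 * X a) ^ CARD('k)) * (D * (1 / (real n)\<^sup>2))"
        using D by (intro mult_right_mono sum_norm_coeff a) auto
      also have "\<dots> = D * A * \<phi> a * ((5 * X a) ^ CARD('k) / (real n)\<^sup>2)" by simp
      also have "\<dots> \<le> D * A * \<phi> a * (4 * (5 * B) ^ CARD('k) * \<rho> ^ a)"
        using D A \<phi> a by (intro mult_left_mono decay mult_nonneg_nonneg) auto
      also have "\<dots> = K * \<phi> a * \<rho> ^ a" by (simp add: K_def)
      finally show ?thesis .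
    qed
    moreover have "(\<lambda>Q. norm ((LINT x|\<mu>. partial n Q x) - (LINT x|lebesgue_cube. partial n Q x)))
        \<longlonglongrightarrow> norm (complex_of_real (LINT x|\<mu>. f n x) - complex_of_real (LINT x|lebesgue_cube. f n x))"
      by (intro tendsto_norm tendsto_diff integral_f_tendsto \<mu> prob_measure_lebesgue_cube n)
    ultimately have "norm (complex_of_real (LINT x|\<mu>. f n x) - complex_of_real (LINT x|lebesgue_cube. f n x)) \<le> K * \<phi> a * \<rho> ^ a"
      by (intro Lim_bounded) auto
    then have "\<bar>(LINT x|\<mu>. f n x) - (LINT x|lebesgue_cube. f n x)\<bar> \<le> K * \<phi> a * \<rho> ^ a"
      by (simp only: of_real_diff[symmetric] norm_of_real)
    moreover have "\<alpha> * \<phi> a \<le> (LINT x|lebesgue_cube. f n x)"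
      using coeff_zero[OF a] integral_f_cube[OF n] by (metis Re_complex_of_real)
    ultimately show ?thesis by linarith
  qed
  have "\<alpha> / 2 * (\<Sum>a\<in>{1..L}. size a) - K * (\<Sum>a\<in>{1..L}. size a * \<rho> ^ a) \<le> E_sum f (2 ^ L - 1) \<mu>" for L
  proof -
    have "\<alpha> / 2 * (\<Sum>a\<in>{1..L}. size a) - K * (\<Sum>a\<in>{1..L}. size a * \<rho> ^ a)
        = (\<Sum>a\<in>{1..L}. \<alpha> / 2 * size a - K * (size a * \<rho> ^ a))"
      by (simp only: sum_distrib_left sum_subtractf)
    also have "\<dots> \<le> (\<Sum>a\<in>{1..L}. \<Sum>n\<in>dyadic_block a. \<alpha> * \<phi> a - K * \<phi> a * \<rho> ^ a)"
    proof (rule sum_mono)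
      fix a assume "a \<in> {1..L}"
      then have a: "1 \<le> a" by simp
      \<comment> \<open>A block has \<open>2 ^ a / 2\<close> elements, whence
        \<open>\<alpha> / 2\<close>. The error term is halved as well, but the whole of it is
        subtracted.\<close>
      have "0 \<le> K * (size a * \<rho> ^ a)" using K0 size_nonneg \<rho> by (intro mult_nonneg_nonneg) auto
      moreover have "(\<Sum>n\<in>dyadic_block a. \<alpha> * \<phi> a - K * \<phi> a * \<rho> ^ a) = \<alpha> / 2 * size a - K * (size a * \<rho> ^ a) / 2"
        using a by (simp add: card_dyadic_block size_def algebra_simps)
      ultimately show "\<alpha> / 2 * size a - K * (size a * \<rho> ^ a) \<le> (\<Sum>n\<in>dyadic_block a. \<alpha> * \<phi> a - K * \<phi> a * \<rho> ^ a)"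
        by linarith
    qed
    also have "\<dots> \<le> (\<Sum>a\<in>{1..L}. \<Sum>n\<in>dyadic_block a. (LINT x|\<mu>. f n x))"
      by (intro sum_mono pt) auto
    also have "\<dots> = E_sum f (2 ^ L - 1) \<mu>"
      unfolding E_sum_def sum_dyadic_blocks ..
    finally show ?thesis .
  qed
  then show ?thesis using that K0 by blast
qed

lemma VTP_if_decay:
  assumes \<mu>: "prob_measure_on_cube \<mu>"
    and dec: "\<And>\<xi>. norm (fourier_transform \<mu> \<xi>) \<le> C * (1 + norm \<xi>) powr (- 2)"
  shows "VTP f \<mu>"
proof -
  note d = integral_character_decay[OF \<mu> dec]
  obtain K1 where K1: "0 \<le> K1" "\<And>L. \<bar>V_sum f (2 ^ L - 1) \<mu> - V_sum f (2 ^ L - 1) lebesgue_cube\<bar>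
      \<le> K1 * (\<Sum>a\<in>{1..L}. size a * \<rho> ^ a) * (\<Sum>a\<in>{1..L}. size a)"
    using variance_bound[OF \<mu> abs_ge_zero d] by blast
  obtain K2 where K2: "0 \<le> K2"
    "\<And>L. \<alpha> / 2 * (\<Sum>a\<in>{1..L}. size a) - K2 * (\<Sum>a\<in>{1..L}. size a * \<rho> ^ a) \<le> E_sum f (2 ^ L - 1) \<mu>"
    using mean_bound[OF \<mu> abs_ge_zero d] by blast
  have s: "0 \<le> (\<Sum>a\<in>{1..L}. size a)" "0 \<le> (\<Sum>a\<in>{1..L}. size a * \<rho> ^ a)" for L
    using \<rho> by (auto intro!: sum_nonneg mult_nonneg_nonneg size_nonneg)
  show ?thesis
  \<comment> \<open>Both estimates are weakened to the common constant
    \<open>K1 + K2\<close>.\<close>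
  proof (rule VTP_along_dyadic[where e = size and \<rho> = \<rho> and \<alpha> = "\<alpha> / 2" and K = "K1 + K2"])
    fix L
    have "K1 * (\<Sum>a\<in>{1..L}. size a * \<rho> ^ a) * (\<Sum>a\<in>{1..L}. size a)
        \<le> (K1 + K2) * (\<Sum>a\<in>{1..L}. size a * \<rho> ^ a) * (\<Sum>a\<in>{1..L}. size a)"
      using K2(1) s by (intro mult_right_mono) auto
    then show "\<bar>V_sum f (2 ^ L - 1) \<mu> - V_sum f (2 ^ L - 1) lebesgue_cube\<bar>
      \<le> (K1 + K2) * (\<Sum>a\<in>{1..L}. size a * \<rho> ^ a) * (\<Sum>a\<in>{1..L}. size a)"
      using K1(2)[of L] by (rule order_trans[rotated])
    have "K2 * (\<Sum>a\<in>{1..L}. size a * \<rho> ^ a) \<le> (K1 + K2) * (\<Sum>a\<in>{1..L}. size a * \<rho> ^ a)"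
      using K1(1) s by (intro mult_right_mono) auto
    then show "\<alpha> / 2 * (\<Sum>a\<in>{1..L}. size a) - (K1 + K2) * (\<Sum>a\<in>{1..L}. size a * \<rho> ^ a) \<le> E_sum f (2 ^ L - 1) \<mu>"
      using K2(2)[of L] by linarith
  qed (use size_nonneg \<rho> \<alpha> K1 K2 in auto)
qed

end

section \<open>Admissible function systems\<close>

lemma dyadic_block_unique:
  assumes "n \<in> dyadic_block a" "n \<in> dyadic_block b" "1 \<le> a" "1 \<le> b"
  shows "a = b"
proof (rule ccontr)
  assume "a \<noteq> b"
  moreover have "\<not> x < y" if "n \<in> dyadic_block x" "n \<in> dyadic_block y" "1 \<le> y" for x y
  proof
    assume "x < y"
    then have "(2::nat) ^ x \<le> 2 ^ (y - 1)" by (intro power_increasing) auto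
    moreover have "n < 2 ^ x" "2 ^ (y - 1) \<le> n" using that by (simp_all add: dyadic_block_def)
    ultimately show False by linarith
  qed
  ultimately show False using assms by (metis nat_neq_iff)
qed

lemma compact_bump_of_bump_function:
  assumes "bump_function_on S u" "S \<subseteq> {x. \<bar>x\<bar> < 1}"
  shows "compact_bump u"
  using assms unfolding bump_function_on_def compact_bump_def by fastforce

text \<open>At most one lattice point contributes, namely the one nearest to \<open>n * x - y\<close>.\<close>

lemma lattice_sum_eq_nearest:
  fixes x y d :: "real ^ 'k::finite"
  assumes n: "1 \<le> n" and d: "\<And>j. 0 < d $ j" "\<And>j. d $ j \<le> 1 / (2 * real n)"
    and b: "\<And>j s. 1 \<le> \<bar>s\<bar> \<Longrightarrow> b j s = (0::real)"
  shows "infsum (\<lambda>a. \<Prod>j\<in>UNIV. b j ((x $ j - (a $ j + y $ j) / real n) / d $ j)) integer_points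
    = (\<Prod>j\<in>UNIV. b j ((real n * x $ j - y $ j - of_int (round (real n * x $ j - y $ j))) / (real n * d $ j)))"
proof -
  define z where "z j = real n * x $ j - y $ j" for j
  define a0 :: "real ^ 'k" where "a0 = (\<chi> j. of_int (round (z j)))"
  have n0: "0 < real n" using n by simp
  have arg: "(x $ j - (a $ j + y $ j) / real n) / d $ j = (z j - a $ j) / (real n * d $ j)" for a :: "real ^ 'k" and j
    using n0 d(1)[of j] by (simp add: z_def field_simps)
  have zero: "(\<Prod>j\<in>UNIV. b j ((z j - a $ j) / (real n * d $ j))) = 0" if a: "a \<in> integer_points" "a \<noteq> a0" for a
  proof -
    obtain j where j: "a $ j \<noteq> of_int (round (z j))" using a(2) by (auto simp: a0_def vec_eq_iff)
    obtain p where p: "a $ j = of_int p" using a(1) unfolding integer_points_def by (auto elim: Ints_cases)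
    \<comment> \<open>An integer at distance below 1 / 2 would be the rounded one. As
      \<open>n * d\<close> is at most 1 / 2, the argument of the bump then has modulus at least 1.
      In case of a tie both neighbours contribute 0, so the rounding convention is harmless.\<close>
    have "1 / 2 \<le> \<bar>z j - of_int p\<bar>"
    proof (rule ccontr)
      assume "\<not> ?thesis"
      then have "round (z j) = p" by (intro round_unique') auto
      then show False using j p by simp
    qed
    moreover have "real n * d $ j \<le> 1 / 2" "0 < real n * d $ j"
      using d(1)[of j] d(2)[of j] n0 by (simp_all add: field_simps)
    ultimately have "1 \<le> \<bar>(z j - a $ j) / (real n * d $ j)\<bar>"
      unfolding p abs_divide by (simp only: abs_of_pos le_divide_eq_1_pos)
    then have "b j ((z j - a $ j) / (real n * d $ j)) = 0" by (rule b)
    then show ?thesis by (intro prod_zero) auto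
  qed
  have "a0 \<in> integer_points" by (simp add: a0_def integer_points_def)
  then have "infsum (\<lambda>a. \<Prod>j\<in>UNIV. b j ((z j - a $ j) / (real n * d $ j))) integer_points
      = infsum (\<lambda>a. \<Prod>j\<in>UNIV. b j ((z j - a $ j) / (real n * d $ j))) {a0}"
    by (intro infsum_cong_neutral zero) auto
  also have "\<dots> = (\<Prod>j\<in>UNIV. b j ((z j - a0 $ j) / (real n * d $ j)))" by simp
  finally show ?thesis unfolding arg by (simp add: a0_def z_def)
qed

lemma cis_frac: "cis (2 * pi * of_int q * (s - of_int (round s))) = cis (2 * pi * of_int q * s)"
proof -
  have "cis (2 * pi * of_int q * s) = cis (2 * pi * of_int q * (s - of_int (round s))) * cis (2 * pi * of_int (q * round s))"
    unfolding cis_mult by (simp add: algebra_simps)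
  moreover have "cis (2 * pi * of_int (q * round s)) = 1" by (rule cis_multiple_2pi) simp
  ultimately show ?thesis by simp
qed

context compact_bump
begin

text \<open>The series depends only on the fractional part of z, so inversion on the centred period
  extends to all real z.\<close>

lemma rescaled_inversion:
  assumes \<delta>: "0 < \<delta>" "\<delta> \<le> 1 / 2"
  shows "(\<lambda>Q. \<Sum>q\<in>{- int Q..int Q}. fourier_coeff (\<lambda>s. of_real (w (s / \<delta>))) q * cis (2 * pi * of_int q * z))
    \<longlonglongrightarrow> of_real (w ((z - of_int (round z)) / \<delta>))"
proof -
  obtain L where L: "0 \<le> L" "\<And>s t. \<bar>w s - w t\<bar> \<le> L * \<bar>s - t\<bar>" using lipschitz_bump by blast
  have "\<bar>w (s / \<delta>) - w (t / \<delta>)\<bar> \<le> L / \<delta> * \<bar>s - t\<bar>" for s t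
    using L(2)[of "s / \<delta>" "t / \<delta>"] \<delta> by (simp add: diff_divide_distrib[symmetric] abs_divide)
  moreover have "w (1 / 2 / \<delta>) = 0" "w (- 1 / 2 / \<delta>) = 0"
    using \<delta> by (auto intro!: supp simp: abs_divide)
  moreover have "\<bar>z - of_int (round z)\<bar> \<le> 1 / 2"
    by (metis abs_minus_commute of_int_round_abs_le)
  ultimately have "(\<lambda>Q. \<Sum>q\<in>{- int Q..int Q}. fourier_coeff (\<lambda>s. of_real (w (s / \<delta>))) q
      * cis (2 * pi * of_int q * (z - of_int (round z)))) \<longlonglongrightarrow> of_real (w ((z - of_int (round z)) / \<delta>))"
    by (intro fourier_inversion[where f = "\<lambda>s. w (s / \<delta>)" and L = "L / \<delta>"]) auto
  then show ?thesis by (simp only: cis_frac)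
qed

end

text \<open>In the variable \<open>s = n * x - y\<close> each factor is a bump of width
  \<open>n * d\<close>, made periodic. So the coefficient at \<open>n * \<xi>\<close> is a sum over
  i of products of one-dimensional coefficients, with a phase coming from y.\<close>

lemma admissible_is_lattice_system:
  fixes f :: "nat \<Rightarrow> real ^ 'k::finite \<Rightarrow> real"
  assumes k: "CARD('k) \<ge> 3" and \<tau>: "\<tau> \<le> 1 / (8 * (real CARD('k))\<^sup>2)"
    and adm: "admissible_function_system \<tau> y f"
  obtains c \<phi> A B \<alpha> where "lattice_system f c \<phi> A B \<tau> \<alpha>"
proof -
  obtain I d t u1 u2 where sys: "admissible_set_system \<tau> y I d t"
    and u1: "bump_function_on {x. \<bar>x\<bar> < 1} u1"
    and u2: "bump_function_on {x. 1 / 2 \<le> \<bar>x\<bar> \<and> \<bar>x\<bar> < 1} u2"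
    and f: "\<forall>m\<ge>1. \<forall>n\<in>dyadic_block m. f n = block_function y (I m) (d m) (t m) u1 u2 n"
    using adm unfolding admissible_function_system_def by blast
  interpret u1: compact_bump u1 using u1 by (rule compact_bump_of_bump_function) auto
  interpret u2: compact_bump u2 using u2 by (rule compact_bump_of_bump_function) auto
  have \<tau>0: "0 < \<tau>" and dpos: "\<And>m i j. 1 \<le> m \<Longrightarrow> i \<in> I m \<Longrightarrow> 0 < d m i $ j"
    and dle: "\<And>m i j n. 1 \<le> m \<Longrightarrow> i \<in> I m \<Longrightarrow> n \<in> dyadic_block m \<Longrightarrow> d m i $ j \<le> 1 / (2 * real n)"
    using sys unfolding admissible_set_system_def by simp_all
  obtain c0 where c0: "0 < c0" and dge: "\<And>m i j n. 1 \<le> m \<Longrightarrow> i \<in> I m \<Longrightarrow> n \<in> dyadic_block m \<Longrightarrow>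
      c0 * real n powr (- (1 + 1 / real CARD('k) + \<tau>)) \<le> d m i $ j"
  proof -
    from sys have "\<exists>c>0. \<exists>C>0. \<forall>m\<ge>1. \<forall>i\<in>I m. \<forall>j. \<forall>n\<in>dyadic_block m.
        c * real n powr (- (1 + 1 / real CARD('k) + \<tau>)) \<le> d m i $ j \<and>
        d m i $ j \<le> C * real n powr (- (1 + 1 / real CARD('k) - \<tau>))"
      unfolding admissible_set_system_def by (elim conjE)
    then show thesis using that by (elim exE conjE) simp
  qed
  obtain C1 where C1: "0 \<le> C1" "\<And>\<delta> q. 0 < \<delta> \<Longrightarrow> \<delta> \<le> 1 / 2 \<Longrightarrow>
    norm (fourier_coeff (\<lambda>s. of_real (u1 (s / \<delta>))) q) \<le> C1 * \<delta> * lorentz (1 / \<delta>) q"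
    using u1.fourier_coeff_bump_bound by blast
  obtain C2 where C2: "0 \<le> C2" "\<And>\<delta> q. 0 < \<delta> \<Longrightarrow> \<delta> \<le> 1 / 2 \<Longrightarrow>
    norm (fourier_coeff (\<lambda>s. of_real (u2 (s / \<delta>))) q) \<le> C2 * \<delta> * lorentz (1 / \<delta>) q"
    using u2.fourier_coeff_bump_bound by blast
  define C where "C = C1 + C2"
  define \<beta> where "\<beta> = min u1.mass u2.mass"
  have C0: "0 \<le> C" using C1 C2 by (simp add: C_def)
  have \<beta>0: "0 < \<beta>" using u1.mass_pos u2.mass_pos by (simp add: \<beta>_def)
  define \<theta> where "\<theta> = 1 / real CARD('k) + \<tau>"
  have \<theta>0: "0 < \<theta>" using \<tau>0 k by (simp add: \<theta>_def add_pos_pos)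
  \<comment> \<open>From \<open>n * d \<ge> c0 * n powr (- \<theta>)\<close> the frequency scale
    \<open>1 / (n * d)\<close> is at most \<open>n powr \<theta> / c0\<close>.\<close>
  define B where "B = max 1 (1 / c0)"
  define u where "u = type_bump u1 u2"
  have u_bound: "norm (fourier_coeff (\<lambda>s. of_real (u e (s / \<delta>))) q) \<le> C * \<delta> * lorentz (1 / \<delta>) q"
    if \<delta>: "0 < \<delta>" "\<delta> \<le> 1 / 2" for e \<delta> q
  proof -
    have l: "0 \<le> \<delta> * lorentz (1 / \<delta>) q" using \<delta> lorentz_bounds(1)[of "1 / \<delta>" q] by simp
    show ?thesis
    proof (cases e)
      case First_Type
      have "C1 * \<delta> * lorentz (1 / \<delta>) q \<le> C * \<delta> * lorentz (1 / \<delta>) q"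
        using mult_right_mono[of C1 C, OF _ l] C2 by (simp add: C_def mult.assoc)
      then show ?thesis using C1(2)[OF \<delta>, of q] First_Type by (simp add: u_def)
    next
      case Second_Type
      have "C2 * \<delta> * lorentz (1 / \<delta>) q \<le> C * \<delta> * lorentz (1 / \<delta>) q"
        using mult_right_mono[of C2 C, OF _ l] C1 by (simp add: C_def mult.assoc)
      then show ?thesis using C2(2)[OF \<delta>, of q] Second_Type by (simp add: u_def)
    qed
  qed
  have u_zero: "\<exists>\<beta>'\<ge>\<beta>. fourier_coeff (\<lambda>s. of_real (u e (s / \<delta>))) 0 = of_real (\<delta> * \<beta>')"
    if \<delta>: "0 < \<delta>" "\<delta> \<le> 1 / 2" for e \<delta>
  proof (cases e)
    case First_Type
    then show ?thesis using u1.fourier_coeff_bump_zero[OF \<delta>]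
      by (intro exI[of _ u1.mass]) (simp add: u_def \<beta>_def)
  next
    case Second_Type
    then show ?thesis using u2.fourier_coeff_bump_zero[OF \<delta>]
      by (intro exI[of _ u2.mass]) (simp add: u_def \<beta>_def)
  qed
  have u_supp: "u e s = 0" if "1 \<le> \<bar>s\<bar>" for e s
    using u1.supp[OF that] u2.supp[OF that] by (cases e) (auto simp: u_def)
  have u_inv: "(\<lambda>Q. \<Sum>q\<in>{- int Q..int Q}. fourier_coeff (\<lambda>s. of_real (u e (s / \<delta>))) q * cis (2 * pi * of_int q * z))
    \<longlonglongrightarrow> of_real (u e ((z - of_int (round z)) / \<delta>))" if \<delta>: "0 < \<delta>" "\<delta> \<le> 1 / 2" for e \<delta> z
  proof (cases e)
    case First_Type
    then show ?thesis using u1.rescaled_inversion[OF \<delta>, of z] by (simp only: u_def type_bump.simps)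
  next
    case Second_Type
    then show ?thesis using u2.rescaled_inversion[OF \<delta>, of z] by (simp only: u_def type_bump.simps)
  qed
  \<comment> \<open>The coefficients must depend on n alone, so the block of n is recovered by
    choice; among indices from 1 on it is unique.\<close>
  define blk where "blk n = (SOME a. 1 \<le> a \<and> n \<in> dyadic_block a)" for n
  have blk: "blk n = a" if "1 \<le> a" "n \<in> dyadic_block a" for n a
  proof -
    have "\<exists>a. 1 \<le> a \<and> n \<in> dyadic_block a" using that by blast
    from someI_ex[OF this] have "1 \<le> blk n \<and> n \<in> dyadic_block (blk n)" unfolding blk_def .
    then show ?thesis by (intro dyadic_block_unique[of n "blk n" a] that) simp_all
  qed
  define F where "F n a i j = fourier_coeff (\<lambda>s. of_real (u (t a i j) (s / (real n * d a i $ j))))" for n a i j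
  define c where "c n \<xi> = (\<Sum>i\<in>I (blk n). \<Prod>j\<in>UNIV. F n (blk n) i j (\<xi> j) * cis (- 2 * pi * of_int (\<xi> j) * y $ j))"
    for n and \<xi> :: "'k \<Rightarrow> int"
  \<comment> \<open>\<open>2 ^ a\<close> replaces n to make the scale constant on the block. As n is
    at least half of it, the lower bound loses at most a factor 2 per coordinate, hence
    \<open>(\<beta> / 2) ^ k\<close>.\<close>
  define \<phi> where "\<phi> a = (\<Sum>i\<in>I a. \<Prod>j\<in>UNIV. 2 ^ a * d a i $ j)" for a
  have c_eq: "c n \<xi> = (\<Sum>i\<in>I a. \<Prod>j\<in>UNIV. F n a i j (\<xi> j) * cis (- 2 * pi * of_int (\<xi> j) * y $ j))"
    if "1 \<le> a" "n \<in> dyadic_block a" for n a \<xi>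
    unfolding c_def blk[OF that] ..
  have npos: "0 < real n" if "1 \<le> a" "n \<in> dyadic_block a" for n a
  proof -
    have "(0::real) < 2 ^ a / 2" by simp
    then show ?thesis using dyadic_block_half_le(1)[OF that] by linarith
  qed
  have \<delta>: "0 < real n * d a i $ j" "real n * d a i $ j \<le> 1 / 2"
    if a: "1 \<le> a" "n \<in> dyadic_block a" and i: "i \<in> I a" for n a i j
  proof -
    show "0 < real n * d a i $ j" by (intro mult_pos_pos npos[OF a] dpos[OF a(1) i])
    have "real n * d a i $ j \<le> real n * (1 / (2 * real n))"
      by (intro mult_left_mono dle[OF a(1) i a(2)]) simp
    then show "real n * d a i $ j \<le> 1 / 2" using npos[OF a] by simp
  qed
  show ?thesis
  proof (rule that, unfold_locales)
    show "CARD('k) \<ge> 3" "0 < \<tau>" "\<tau> \<le> 1 / (8 * (real CARD('k))\<^sup>2)" by fact+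
    show "0 \<le> C ^ CARD('k)" "1 \<le> B" "0 < (\<beta> / 2) ^ CARD('k)" using C0 \<beta>0 by (auto simp: B_def)
    show "0 \<le> \<phi> a" if "1 \<le> a" for a
      unfolding \<phi>_def using dpos[OF that] by (intro sum_nonneg prod_nonneg) (auto intro: less_imp_le)
    show "norm (c n \<xi>) \<le> C ^ CARD('k) * \<phi> a * lattice_weight (B * (2 ^ a) powr (1 / real CARD('k) + \<tau>)) \<xi>"
      if a: "1 \<le> a" "n \<in> dyadic_block a" for a n \<xi>
    proof -
      define X where "X = B * (2 ^ a) powr \<theta>"
      have one: "norm (F n a i j (\<xi> j) * cis (- 2 * pi * of_int (\<xi> j) * y $ j)) \<le> C * (2 ^ a * d a i $ j) * lorentz X (\<xi> j)"
        if i: "i \<in> I a" for i j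
      proof -
        let ?\<delta> = "real n * d a i $ j"
        note \<delta>' = \<delta>[OF a i, of j]
        have "1 / ?\<delta> \<le> X"
        proof -
          have "c0 * real n powr (- \<theta>) = real n * (c0 * real n powr (- (1 + 1 / real CARD('k) + \<tau>)))"
            using npos[OF a] powr_add[of "real n" 1 "- (1 + 1 / real CARD('k) + \<tau>)"] by (simp add: \<theta>_def algebra_simps)
          also have "\<dots> \<le> ?\<delta>" using dge[OF a(1) i a(2), of j] by (intro mult_left_mono) auto
          finally have "1 / ?\<delta> \<le> 1 / (c0 * real n powr (- \<theta>))"
            using c0 npos[OF a] \<delta>' dpos[OF a(1) i, of j] by (intro divide_left_mono mult_pos_pos) auto
          also have "\<dots> = 1 / c0 * real n powr \<theta>" by (simp add: powr_minus field_simps)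
          also have "\<dots> \<le> B * (2 ^ a) powr \<theta>"
            using dyadic_block_half_le(2)[OF a] c0 \<theta>0 by (intro mult_mono powr_mono2) (auto simp: B_def)
          finally show ?thesis by (simp add: X_def)
        qed
        then have l: "lorentz (1 / ?\<delta>) (\<xi> j) \<le> lorentz X (\<xi> j)"
          using \<delta>' by (intro lorentz_mono) auto
        have dn: "?\<delta> \<le> 2 ^ a * d a i $ j"
          using dyadic_block_half_le(2)[OF a] dpos[OF a(1) i, of j] by (intro mult_right_mono) auto
        have "norm (F n a i j (\<xi> j) * cis (- 2 * pi * of_int (\<xi> j) * y $ j)) \<le> C * ?\<delta> * lorentz (1 / ?\<delta>) (\<xi> j)"
          unfolding F_def using u_bound[OF \<delta>'] by (simp add: norm_mult)
        also have "\<dots> \<le> C * (2 ^ a * d a i $ j) * lorentz X (\<xi> j)"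
          using l dn C0 dpos[OF a(1) i, of j] lorentz_bounds(1)[of "1 / ?\<delta>" "\<xi> j"]
          by (intro mult_mono mult_left_mono mult_nonneg_nonneg) (auto intro: less_imp_le)
        finally show ?thesis .
      qed
      have "norm (c n \<xi>) \<le> (\<Sum>i\<in>I a. \<Prod>j\<in>UNIV. C * (2 ^ a * d a i $ j) * lorentz X (\<xi> j))"
        unfolding c_eq[OF a]
      proof (rule order_trans[OF norm_sum], rule sum_mono)
        fix i assume i: "i \<in> I a"
        show "norm (\<Prod>j\<in>UNIV. F n a i j (\<xi> j) * cis (- 2 * pi * of_int (\<xi> j) * y $ j))
            \<le> (\<Prod>j\<in>UNIV. C * (2 ^ a * d a i $ j) * lorentz X (\<xi> j))"
          unfolding prod_norm[symmetric] by (intro prod_mono conjI norm_ge_zero one i)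
      qed
      also have "\<dots> = C ^ CARD('k) * \<phi> a * lattice_weight X \<xi>"
        by (simp add: prod.distrib \<phi>_def lattice_weight_def sum_distrib_left sum_distrib_right mult_ac)
      finally show ?thesis by (simp only: X_def \<theta>_def)
    qed
    show "(\<beta> / 2) ^ CARD('k) * \<phi> a \<le> Re (c n (\<lambda>_. 0))" if a: "1 \<le> a" "n \<in> dyadic_block a" for a n
    proof -
      \<comment> \<open>At frequency 0 every factor is real, so the products can be compared before
        real parts are taken.\<close>
      have ex: "\<exists>r. (\<beta> / 2) ^ CARD('k) * (\<Prod>j\<in>UNIV. 2 ^ a * d a i $ j) \<le> r \<and>
          (\<Prod>j\<in>UNIV. F n a i j 0) = complex_of_real r" if i: "i \<in> I a" for i
      proof -
        have "\<forall>j. \<exists>\<beta>'\<ge>\<beta>. F n a i j 0 = of_real (real n * d a i $ j * \<beta>')"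
          unfolding F_def by (intro allI u_zero \<delta>[OF a i])
        from choice[OF this] obtain \<beta>' where "\<forall>j. \<beta> \<le> \<beta>' j \<and> F n a i j 0 = of_real (real n * d a i $ j * \<beta>' j)" ..
        then have \<beta>': "\<beta> \<le> \<beta>' j" "F n a i j 0 = of_real (real n * d a i $ j * \<beta>' j)" for j by auto
        have "(\<beta> / 2) ^ CARD('k) * (\<Prod>j\<in>UNIV. 2 ^ a * d a i $ j) = (\<Prod>j\<in>UNIV. (\<beta> / 2) * (2 ^ a * d a i $ j))"
          by (subst prod.distrib[of "\<lambda>_. \<beta> / 2"]) simp
        also have "\<dots> \<le> (\<Prod>j\<in>UNIV. real n * d a i $ j * \<beta>' j)"
        proof (intro prod_mono conjI)
          fix j
          have dj: "0 < d a i $ j" by (rule dpos[OF a(1) i])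
          show "0 \<le> (\<beta> / 2) * (2 ^ a * d a i $ j)" using \<beta>0 dj by simp
          have "(\<beta> / 2) * (2 ^ a * d a i $ j) = (2 ^ a / 2 * d a i $ j) * \<beta>" by simp
          also have "\<dots> \<le> (real n * d a i $ j) * \<beta>' j"
            using dyadic_block_half_le(1)[OF a] dj \<beta>'(1)[of j] \<beta>0 by (intro mult_mono mult_right_mono) auto
          finally show "(\<beta> / 2) * (2 ^ a * d a i $ j) \<le> real n * d a i $ j * \<beta>' j" .
        qed
        finally show ?thesis using \<beta>'(2) by (intro exI[of _ "\<Prod>j\<in>UNIV. real n * d a i $ j * \<beta>' j"]) simp
      qed
      have "\<forall>i\<in>I a. \<exists>r. (\<beta> / 2) ^ CARD('k) * (\<Prod>j\<in>UNIV. 2 ^ a * d a i $ j) \<le> r \<and>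
          (\<Prod>j\<in>UNIV. F n a i j 0) = complex_of_real r"
        using ex by (rule ballI)
      from bchoice[OF this] obtain r where "\<forall>i\<in>I a. (\<beta> / 2) ^ CARD('k) * (\<Prod>j\<in>UNIV. 2 ^ a * d a i $ j) \<le> r i \<and>
          (\<Prod>j\<in>UNIV. F n a i j 0) = complex_of_real (r i)" ..
      then have r: "(\<beta> / 2) ^ CARD('k) * (\<Prod>j\<in>UNIV. 2 ^ a * d a i $ j) \<le> r i"
        "(\<Prod>j\<in>UNIV. F n a i j 0) = complex_of_real (r i)" if "i \<in> I a" for i
        using that by auto
      have "c n (\<lambda>_. 0) = (\<Sum>i\<in>I a. \<Prod>j\<in>UNIV. F n a i j 0)" unfolding c_eq[OF a] by simp
      also have "\<dots> = (\<Sum>i\<in>I a. complex_of_real (r i))" by (intro sum.cong refl r)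
      finally have "Re (c n (\<lambda>_. 0)) = (\<Sum>i\<in>I a. r i)" by simp
      then show ?thesis unfolding \<phi>_def sum_distrib_left using r(1) by (simp add: sum_mono)
    qed
    show "(\<lambda>Q. \<Sum>\<xi>\<in>lattice_box Q. c n \<xi> * character (\<lambda>j. int n * \<xi> j) x) \<longlonglongrightarrow> of_real (f n x)"
      if n: "1 \<le> n" for n x
    proof -
      obtain a where a: "1 \<le> a" "n \<in> dyadic_block a" using ex_dyadic_block[OF n] by blast
      define z where "z j = real n * x $ j - y $ j" for j
      have fx: "f n x = (\<Sum>i\<in>I a. \<Prod>j\<in>UNIV. u (t a i j) ((z j - of_int (round (z j))) / (real n * d a i $ j)))"
      proof -
        have "f n x = block_function y (I a) (d a) (t a) u1 u2 n x" using f a by simp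
        also have "\<dots> = (\<Sum>i\<in>I a. \<Prod>j\<in>UNIV. u (t a i j) ((z j - of_int (round (z j))) / (real n * d a i $ j)))"
          unfolding block_function_def u_def[symmetric] z_def
        proof (rule sum.cong[OF refl])
          fix i assume i: "i \<in> I a"
          show "infsum (\<lambda>v. \<Prod>j\<in>UNIV. u (t a i j) ((x $ j - (v $ j + y $ j) / real n) / d a i $ j)) integer_points
            = (\<Prod>j\<in>UNIV. u (t a i j) ((real n * x $ j - y $ j - of_int (round (real n * x $ j - y $ j))) / (real n * d a i $ j)))"
            by (rule lattice_sum_eq_nearest[OF n dpos[OF a(1) i] dle[OF a(1) i a(2)] u_supp])
        qed
        finally show ?thesis .
      qed
      have char: "character (\<lambda>j. int n * \<xi> j) x = (\<Prod>j\<in>UNIV. cis (2 * pi * of_int (\<xi> j) * (real n * x $ j)))" for \<xi>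
        by (simp add: character_def cis_conv_exp sum_distrib_left exp_sum mult_ac)
      have coeff_term: "c n \<xi> * character (\<lambda>j. int n * \<xi> j) x
          = (\<Sum>i\<in>I a. \<Prod>j\<in>UNIV. F n a i j (\<xi> j) * cis (2 * pi * of_int (\<xi> j) * z j))" for \<xi>
      proof -
        have "cis (2 * pi * of_int q * z j) = cis (- 2 * pi * of_int q * y $ j) * cis (2 * pi * of_int q * (real n * x $ j))" for q j
          by (simp add: cis_mult z_def algebra_simps)
        then show ?thesis
          unfolding c_eq[OF a] char sum_distrib_right prod.distrib[symmetric]
          by (simp only: mult.assoc)
      qed
      \<comment> \<open>Over a box the sum of products is a product of symmetric one-dimensional
        sums, whose limits are known at every point.\<close>
      have "(\<Sum>\<xi>\<in>lattice_box Q. c n \<xi> * character (\<lambda>j. int n * \<xi> j) x)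
          = (\<Sum>i\<in>I a. \<Prod>j\<in>UNIV. \<Sum>q\<in>{- int Q..int Q}. F n a i j q * cis (2 * pi * of_int q * z j))" for Q
        unfolding coeff_term
        by (subst sum.swap, rule sum.cong[OF refl],
            rule sum_lattice_box_prod[where g = "\<lambda>j q. F n a _ j q * cis (2 * pi * of_int q * z j)"])
      moreover have "(\<lambda>Q. \<Sum>i\<in>I a. \<Prod>j\<in>UNIV. \<Sum>q\<in>{- int Q..int Q}. F n a i j q * cis (2 * pi * of_int q * z j))
          \<longlonglongrightarrow> (\<Sum>i\<in>I a. \<Prod>j\<in>UNIV. of_real (u (t a i j) ((z j - of_int (round (z j))) / (real n * d a i $ j))))"
        unfolding F_def by (intro tendsto_sum tendsto_prod u_inv \<delta>[OF a])
      ultimately show ?thesis by (simp add: fx)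
    qed
  qed
qed

theorem mainTheorem9:
  assumes "CARD('k::finite) \<ge> 3"
  shows "\<exists>\<tau>\<^sub>0>0. \<forall>\<tau> (y :: real ^ 'k) f \<mu>.
    \<tau> < \<tau>\<^sub>0 \<longrightarrow>
    admissible_function_system \<tau> y f \<longrightarrow>
    prob_measure_on_cube \<mu> \<longrightarrow>
    (\<exists>C. \<forall>\<xi>. norm (fourier_transform \<mu> \<xi>) \<le> C * (1 + norm \<xi>) powr (- 2)) \<longrightarrow>
    VTP f \<mu>"
\<comment> \<open>The threshold at which k * \<tau> equals half of the exponent gained from long
  residue vectors.\<close>
proof (intro exI[of _ "1 / (8 * (real CARD('k))\<^sup>2)"] conjI allI impI)
  show "0 < 1 / (8 * (real CARD('k))\<^sup>2)" using assms by simp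
  fix \<tau> and y :: "real ^ 'k" and f and \<mu> :: "(real ^ 'k) measure"
  assume \<tau>: "\<tau> < 1 / (8 * (real CARD('k))\<^sup>2)" and adm: "admissible_function_system \<tau> y f"
    and \<mu>: "prob_measure_on_cube \<mu>"
    and "\<exists>C. \<forall>\<xi>. norm (fourier_transform \<mu> \<xi>) \<le> C * (1 + norm \<xi>) powr (- 2)"
  then obtain C where C: "\<And>\<xi>. norm (fourier_transform \<mu> \<xi>) \<le> C * (1 + norm \<xi>) powr (- 2)" by blast
  obtain c \<phi> A B \<alpha> where "lattice_system f c \<phi> A B \<tau> \<alpha>"
    using admissible_is_lattice_system[OF assms less_imp_le[OF \<tau>] adm] by blast
  then interpret lattice_system f c \<phi> A B \<tau> \<alpha> .
  show "VTP f \<mu>" by (rule VTP_if_decay[OF \<mu> C])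
qed

end
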